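(* Let $(\tilde H,\Gamma_{\tilde Q})$ be the monster model of $\mathcal{K}_{(H,\Gamma_Q)}$ and let $G\subseteq\tilde H$ be small. Then $dcl(G)=\tilde H_G$.
   Context: All Hilbert spaces are complex. For a self-adjoint (densely defined, possibly unbounded) operator $Q$ on $H$, $\sigma(Q)$ is its spectrum and $\sigma_e(Q)$ is the set of $\lambda\in\mathbb{C}$ such that $(Q-\lambda I)S\neq I+K$ for every bounded $S$ and compact $K$ on $H$. $Q_1\sim_\sigma Q_2$ means: $\sigma(Q_1)=\sigma(Q_2)$, $\sigma_e(Q_1)=\sigma_e(Q_2)$, and the $\lambda$-eigenspaces of $Q_1$ and $Q_2$ have equal dimension for all $\lambda\in\sigma(Q_1)\setminus\sigma_e(Q_1)$. $(H,\Gamma_Q)$ denotes the metric structure consisting of the Hilbert space $H$ (with $0$, $+$, multiplication by $i$ and by rationals, the norm) and the predicate $\Gamma_Q(v,w)=$ distance from $(v,w)\in H\times H$ to the graph of the closed self-adjoint operator $Q$. Fix $(H,\Gamma_Q)$ with $Q$ closed unbounded self-adjoint. $\mathcal{K}_{(H,\Gamma_Q)}$ is the class of all such structures $(H',\Gamma_{Q'})$ with $Q'\sim_\sigma Q$; $(H_1,\Gamma_{Q_1})\prec(H_2,\Gamma_{Q_2})$ iff $H_1\subseteq H_2$ and $Q_1\subseteq Q_2$. A $\mathcal{K}$-embedding $f:M\to N$ is an embedding of metric structures with $f(M)\prec N$. Galois types: for $M_1,M_2\in\mathcal{K}$, $A\subseteq M_1\cap M_2$, one writes $gatp_{M_1}((a_i)_{i<\alpha}/A)=gatp_{M_2}((b_i)_{i<\alpha}/A)$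 if there are $N\in\mathcal{K}$ and $\mathcal{K}$-embeddings $f:M_1\to N$, $g:M_2\to N$ with $f(a_i)=g(b_i)$ for all $i<\alpha$ and $f\upharpoonright A=g\upharpoonright A=\mathrm{Id}_A$. Monster model: for a fixed sufficiently large cardinal $\kappa$ (larger than the density of every structure to be studied), $(\tilde H,\Gamma_{\tilde Q})\in\mathcal{K}_{(H,\Gamma_Q)}$ is $\kappa$-universal (every $M\in\mathcal{K}$ with $|M|<\kappa$ has a $\mathcal{K}$-embedding into it) and $\kappa$-homogeneous (if two sequences of length $\alpha<\kappa$ in it have the property that all corresponding finite subtuples have the same Galois type over $\emptyset$, then some automorphism maps one sequence to the other). Small means of size $<\kappa$. Automorphisms of $(\tilde H,\Gamma_{\tilde Q})$ are the unitary operators $U$ on $\tilde H$ with $UD(\tilde Q)=D(\tilde Q)$ and $U\tilde Qv=\tilde QUv$ for $v\in D(\tilde Q)$. For small $A$, $dcl(A)$ is the set of $m\in\tilde H$ fixed by every automorphism of the monster model that fixes $A$ pointwise. $\tilde H_G$ is the closed subspace of $\tilde H$ generated by the vectors $f(\tilde Q)v$ with $v\in G$ and $f$ a bounded Borel function on $\mathbb{R}$. *)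

theory Defs
  imports "HOL-Analysis.Analysis"
begin

unbundle cardinal_syntax

section \<open>Complex Hilbert spaces\<close>

text \<open>
  The inner product \<open>cinner\<close> is linear in its first argument.  The norm, metric and topology are
  those of the underlying real inner product space, whose inner product is the real part
  of \<open>cinner\<close>.
\<close>

class complex_inner = real_inner +
  fixes scaleC :: "complex \<Rightarrow> 'a \<Rightarrow> 'a"  (infixr "*\<^sub>C" 75)
    and cinner :: "'a \<Rightarrow> 'a \<Rightarrow> complex"
  assumes scaleC_add_right: "c *\<^sub>C (x + y) = c *\<^sub>C x + c *\<^sub>C y"
    and scaleC_add_left: "(c + d) *\<^sub>C x = c *\<^sub>C x + d *\<^sub>C x"
    and scaleC_scaleC: "c *\<^sub>C (d *\<^sub>C x) = (c * d) *\<^sub>C x"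
    and scaleC_of_real: "complex_of_real r *\<^sub>C x = r *\<^sub>R x"
    and cinner_commute: "cinner x y = cnj (cinner y x)"
    and cinner_add_left: "cinner (x + y) z = cinner x z + cinner y z"
    and cinner_scaleC_left: "cinner (c *\<^sub>C x) y = c * cinner x y"
    and Re_cinner: "Re (cinner x y) = inner x y"

class chilbert_space = complex_inner + complete_space

instantiation complex :: chilbert_space
begin
definition scaleC_complex :: "complex \<Rightarrow> complex \<Rightarrow> complex" where
  "scaleC_complex c x = c * x"
definition cinner_complex :: "complex \<Rightarrow> complex \<Rightarrow> complex" where
  "cinner_complex x y = x * cnj y"
instance
  by standard
     (simp_all add: scaleC_complex_def cinner_complex_def algebra_simps scaleR_conv_of_real
        inner_complex_def)
end

definition csubspace :: "'a::complex_inner set \<Rightarrow> bool" where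
  "csubspace V \<longleftrightarrow>
     0 \<in> V \<and> (\<forall>x\<in>V. \<forall>y\<in>V. x + y \<in> V) \<and> (\<forall>c. \<forall>x\<in>V. c *\<^sub>C x \<in> V)"

definition closed_cspan :: "'a::complex_inner set \<Rightarrow> 'a set" where
  "closed_cspan S = (\<lambda>V. csubspace V \<and> closed V) hull S"

definition orthonormal_basis :: "'a::complex_inner set \<Rightarrow> 'a set \<Rightarrow> bool" where
  "orthonormal_basis V B \<longleftrightarrow>
     (\<forall>x\<in>B. norm x = 1) \<and> (\<forall>x\<in>B. \<forall>y\<in>B. x \<noteq> y \<longrightarrow> cinner x y = 0) \<and> closed_cspan B = V"

definition same_dimension :: "'a::complex_inner set \<Rightarrow> 'a set \<Rightarrow> bool" where
  "same_dimension V W \<longleftrightarrow>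
     (\<exists>B C. orthonormal_basis V B \<and> orthonormal_basis W C \<and> |B| =o |C| )"

text \<open>
  Operators defined on all of a subspace \<open>V\<close> are given by functions on the ambient type; only
  their values on \<open>V\<close> matter.
\<close>

definition clinear_on :: "'a::complex_inner set \<Rightarrow> ('a \<Rightarrow> 'a) \<Rightarrow> bool" where
  "clinear_on V T \<longleftrightarrow>
     (\<forall>x\<in>V. \<forall>y\<in>V. T (x + y) = T x + T y) \<and> (\<forall>c. \<forall>x\<in>V. T (c *\<^sub>C x) = c *\<^sub>C T x)"

definition bounded_op_on :: "'a::complex_inner set \<Rightarrow> ('a \<Rightarrow> 'a) \<Rightarrow> bool" where
  "bounded_op_on V T \<longleftrightarrow>
     T ` V \<subseteq> V \<and> clinear_on V T \<and> (\<exists>C. \<forall>x\<in>V. norm (T x) \<le> C * norm x)"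

definition compact_op_on :: "'a::complex_inner set \<Rightarrow> ('a \<Rightarrow> 'a) \<Rightarrow> bool" where
  "compact_op_on V T \<longleftrightarrow> bounded_op_on V T \<and> compact (closure (T ` (V \<inter> cball 0 1)))"

definition unitary_on :: "'a::complex_inner set \<Rightarrow> ('a \<Rightarrow> 'a) \<Rightarrow> bool" where
  "unitary_on V U \<longleftrightarrow>
     bij_betw U V V \<and> clinear_on V U \<and> (\<forall>x\<in>V. \<forall>y\<in>V. cinner (U x) (U y) = cinner x y)"

definition projection_on :: "'a::complex_inner set \<Rightarrow> ('a \<Rightarrow> 'a) \<Rightarrow> bool" where
  "projection_on V P \<longleftrightarrow>
     bounded_op_on V P \<and> (\<forall>x\<in>V. P (P x) = P x) \<and> (\<forall>x\<in>V. \<forall>y\<in>V. cinner (P x) y = cinner x (P y))"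


section \<open>Structures: a Hilbert space with an unbounded self-adjoint operator\<close>

text \<open>
  The Hilbert spaces considered are the closed subspaces of an ambient Hilbert space \<open>'a\<close>, which
  serves as the universe containing all structures: up to isomorphism, these are all Hilbert
  spaces whose density character is at most that of \<open>'a\<close>.  A partial operator on a Hilbert
  space is given by its graph.  The structure \<open>(H, \<Gamma>\<^sub>Q)\<close> is represented by the pair \<open>(H, Q)\<close>;
  see \<open>Gamma\<close> for the predicate.
\<close>

record 'a opstruct =
  hspace :: "'a set"
  ograph :: "('a \<times> 'a) set"

definition odom :: "'a opstruct \<Rightarrow> 'a set" where
  "odom M = fst ` ograph M"

definition oapp :: "'a opstruct \<Rightarrow> 'a \<Rightarrow> 'a" where
  "oapp M v = (THE w. (v, w) \<in> ograph M)"

definition linear_operator :: "'a::complex_inner opstruct \<Rightarrow> bool" where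
  "linear_operator M \<longleftrightarrow>
     ograph M \<subseteq> hspace M \<times> hspace M \<and> single_valued (ograph M) \<and> csubspace (odom M) \<and>
     clinear_on (odom M) (oapp M)"

definition densely_defined :: "'a::complex_inner opstruct \<Rightarrow> bool" where
  "densely_defined M \<longleftrightarrow> hspace M \<subseteq> closure (odom M)"

definition adjoint_graph :: "'a::complex_inner opstruct \<Rightarrow> ('a \<times> 'a) set" where
  "adjoint_graph M =
     {(x, y). x \<in> hspace M \<and> y \<in> hspace M \<and> (\<forall>v\<in>odom M. cinner (oapp M v) x = cinner v y)}"

definition self_adjoint :: "'a::complex_inner opstruct \<Rightarrow> bool" where
  "self_adjoint M \<longleftrightarrow> linear_operator M \<and> densely_defined M \<and> ograph M = adjoint_graph M"

definition unbounded_operator :: "'a::complex_inner opstruct \<Rightarrow> bool" where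
  "unbounded_operator M \<longleftrightarrow> \<not> (\<exists>C. \<forall>v\<in>odom M. norm (oapp M v) \<le> C * norm v)"

definition selfadjoint_structure :: "'a::chilbert_space opstruct \<Rightarrow> bool" where
  "selfadjoint_structure M \<longleftrightarrow>
     csubspace (hspace M) \<and> closed (hspace M) \<and>
     self_adjoint M \<and> closed (ograph M) \<and> unbounded_operator M"

text \<open>The product type carries the Hilbert space norm of the direct sum.\<close>

definition Gamma :: "'a::complex_inner opstruct \<Rightarrow> 'a \<Rightarrow> 'a \<Rightarrow> real" where
  "Gamma M v w = infdist (v, w) (ograph M)"


section \<open>Spectrum and spectral equivalence\<close>

definition resolvent_set :: "'a::complex_inner opstruct \<Rightarrow> complex set" where
  "resolvent_set M =
     {l. \<exists>R. bounded_op_on (hspace M) R \<and>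
          (\<forall>x\<in>hspace M. R x \<in> odom M \<and> oapp M (R x) - l *\<^sub>C R x = x) \<and>
          (\<forall>v\<in>odom M. R (oapp M v - l *\<^sub>C v) = v)}"

definition spectrum :: "'a::complex_inner opstruct \<Rightarrow> complex set" where
  "spectrum M = - resolvent_set M"

text \<open>
  For \<open>(Q - \<lambda>I) S = I + K\<close> the composition on the left has to be defined on the whole space,
  so \<open>S\<close> maps into the domain of \<open>Q\<close>.
\<close>

definition essential_spectrum :: "'a::complex_inner opstruct \<Rightarrow> complex set" where
  "essential_spectrum M =
     {l. \<not> (\<exists>S K. bounded_op_on (hspace M) S \<and> compact_op_on (hspace M) K \<and>
          (\<forall>x\<in>hspace M. S x \<in> odom M \<and> oapp M (S x) - l *\<^sub>C S x = x + K x))}"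

definition eigenspace :: "'a::complex_inner opstruct \<Rightarrow> complex \<Rightarrow> 'a set" where
  "eigenspace M l = {v \<in> odom M. oapp M v = l *\<^sub>C v}"

definition spectrally_equivalent :: "'a::complex_inner opstruct \<Rightarrow> 'a opstruct \<Rightarrow> bool" where
  "spectrally_equivalent M N \<longleftrightarrow>
     spectrum M = spectrum N \<and> essential_spectrum M = essential_spectrum N \<and>
     (\<forall>l \<in> spectrum M - essential_spectrum M. same_dimension (eigenspace M l) (eigenspace N l))"


section \<open>The abstract elementary class and its Galois types\<close>

definition Kclass :: "'a::chilbert_space opstruct \<Rightarrow> 'a opstruct set" where
  "Kclass H = {M. selfadjoint_structure M \<and> spectrally_equivalent M H}"

definition strong_substructure ::
    "'a::chilbert_space opstruct \<Rightarrow> 'a opstruct \<Rightarrow> 'a opstruct \<Rightarrow> bool" where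
  "strong_substructure H M N \<longleftrightarrow>
     M \<in> Kclass H \<and> N \<in> Kclass H \<and> hspace M \<subseteq> hspace N \<and> ograph M \<subseteq> ograph N"

definition structure_embedding ::
    "'a::chilbert_space opstruct \<Rightarrow> 'a opstruct \<Rightarrow> ('a \<Rightarrow> 'a) \<Rightarrow> bool" where
  "structure_embedding M N f \<longleftrightarrow>
     f ` hspace M \<subseteq> hspace N \<and> f 0 = 0 \<and>
     (\<forall>x\<in>hspace M. \<forall>y\<in>hspace M. f (x + y) = f x + f y) \<and>
     (\<forall>x\<in>hspace M. f (\<i> *\<^sub>C x) = \<i> *\<^sub>C f x) \<and>
     (\<forall>q::rat. \<forall>x\<in>hspace M. f (of_rat q *\<^sub>R x) = of_rat q *\<^sub>R f x) \<and>
     (\<forall>x\<in>hspace M. norm (f x) = norm x) \<and>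
     (\<forall>x\<in>hspace M. \<forall>y\<in>hspace M. Gamma N (f x) (f y) = Gamma M x y)"

definition image_structure :: "('a \<Rightarrow> 'a) \<Rightarrow> 'a opstruct \<Rightarrow> 'a opstruct" where
  "image_structure f M = \<lparr>hspace = f ` hspace M, ograph = map_prod f f ` ograph M\<rparr>"

definition K_embedding ::
    "'a::chilbert_space opstruct \<Rightarrow> 'a opstruct \<Rightarrow> 'a opstruct \<Rightarrow> ('a \<Rightarrow> 'a) \<Rightarrow> bool" where
  "K_embedding H M N f \<longleftrightarrow>
     M \<in> Kclass H \<and> structure_embedding M N f \<and> strong_substructure H (image_structure f M) N"

text \<open>Equality of the Galois types over \<open>A\<close> of \<open>(a\<^sub>i)\<^sub>i\<^sub>\<in>\<^sub>I\<close> in \<open>M1\<close> and \<open>(b\<^sub>i)\<^sub>i\<^sub>\<in>\<^sub>I\<close> in \<open>M2\<close>.\<close>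

definition same_gatp ::
    "'a::chilbert_space opstruct \<Rightarrow> 'a opstruct \<Rightarrow> 'a opstruct \<Rightarrow> 'a set \<Rightarrow>
     'i set \<Rightarrow> ('i \<Rightarrow> 'a) \<Rightarrow> ('i \<Rightarrow> 'a) \<Rightarrow> bool" where
  "same_gatp H M1 M2 A I a b \<longleftrightarrow>
     (\<exists>N f g. K_embedding H M1 N f \<and> K_embedding H M2 N g \<and>
        (\<forall>i\<in>I. f (a i) = g (b i)) \<and> (\<forall>x\<in>A. f x = x \<and> g x = x))"


section \<open>Monster model and definable closure\<close>

definition automorphism :: "'a::complex_inner opstruct \<Rightarrow> ('a \<Rightarrow> 'a) \<Rightarrow> bool" where
  "automorphism M U \<longleftrightarrow>
     unitary_on (hspace M) U \<and> U ` odom M = odom M \<and> (\<forall>v\<in>odom M. U (oapp M v) = oapp M (U v))"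

definition density_less :: "'a::topological_space set \<Rightarrow> 'k rel \<Rightarrow> bool" where
  "density_less S \<kappa> \<longleftrightarrow> (\<exists>D \<subseteq> S. S \<subseteq> closure D \<and> |D| <o \<kappa>)"

definition K_universal :: "'k rel \<Rightarrow> 'a::chilbert_space opstruct \<Rightarrow> 'a opstruct \<Rightarrow> bool" where
  "K_universal \<kappa> H M \<longleftrightarrow> (\<forall>N \<in> Kclass H. |hspace N| <o \<kappa> \<longrightarrow> (\<exists>f. K_embedding H N M f))"

text \<open>
  For a cardinal \<open>\<kappa>\<close>, represented by a well-order, the ordinals below \<open>\<kappa>\<close> are the initial
  segments \<open>underS \<kappa> \<beta>\<close> with \<open>\<beta>\<close> in the field of \<open>\<kappa>\<close>; these index the sequences of length
  less than \<open>\<kappa>\<close>.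
\<close>

definition K_homogeneous :: "'k rel \<Rightarrow> 'a::chilbert_space opstruct \<Rightarrow> 'a opstruct \<Rightarrow> bool" where
  "K_homogeneous \<kappa> H M \<longleftrightarrow>
     (\<forall>\<beta> \<in> Field \<kappa>. \<forall>a b. a ` underS \<kappa> \<beta> \<subseteq> hspace M \<longrightarrow> b ` underS \<kappa> \<beta> \<subseteq> hspace M \<longrightarrow>
        (\<forall>F. finite F \<and> F \<subseteq> underS \<kappa> \<beta> \<longrightarrow> same_gatp H M M {} F a b) \<longrightarrow>
        (\<exists>U. automorphism M U \<and> (\<forall>i \<in> underS \<kappa> \<beta>. U (a i) = b i)))"

text \<open>
  The condition on \<open>UNIV\<close> says that the ambient space has density character at least \<open>\<kappa>\<close>. Hence
  it contains a copy of every Hilbert space of size less than \<open>\<kappa>\<close>, and universality is not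
  affected by the restriction to structures inside the ambient space.
\<close>

definition monster_model :: "'k rel \<Rightarrow> 'a::chilbert_space opstruct \<Rightarrow> 'a opstruct \<Rightarrow> bool" where
  "monster_model \<kappa> H M \<longleftrightarrow>
     Card_order \<kappa> \<and> infinite (Field \<kappa>) \<and> density_less (hspace H) \<kappa> \<and>
     \<not> density_less (UNIV :: 'a set) \<kappa> \<and>
     M \<in> Kclass H \<and> K_universal \<kappa> H M \<and> K_homogeneous \<kappa> H M"

definition dcl :: "'a::complex_inner opstruct \<Rightarrow> 'a set \<Rightarrow> 'a set" where
  "dcl M A = {m \<in> hspace M. \<forall>U. automorphism M U \<and> (\<forall>a\<in>A. U a = a) \<longrightarrow> U m = m}"


section \<open>Borel functional calculus\<close>

definition projection_valued_measure ::
    "'a::complex_inner set \<Rightarrow> (real set \<Rightarrow> 'a \<Rightarrow> 'a) \<Rightarrow> bool" where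
  "projection_valued_measure V E \<longleftrightarrow>
     (\<forall>B \<in> sets borel. projection_on V (E B)) \<and> (\<forall>x\<in>V. E UNIV x = x) \<and>
     (\<forall>B :: nat \<Rightarrow> real set. range B \<subseteq> sets borel \<longrightarrow> disjoint_family B \<longrightarrow>
        (\<forall>x\<in>V. (\<lambda>n. E (B n) x) sums E (\<Union>n. B n) x))"

definition scalar_measure ::
    "(real set \<Rightarrow> 'a \<Rightarrow> 'a) \<Rightarrow> 'a::complex_inner \<Rightarrow> real measure" where
  "scalar_measure E x = measure_of UNIV (sets borel) (\<lambda>B. ennreal (Re (cinner (E B x) x)))"

text \<open>
  \<open>Q = \<integral> t dE(t)\<close>, with the domain given by square integrability; the quadratic form determines
  the operator by polarization.
\<close>

definition spectral_resolution ::
    "'a::complex_inner opstruct \<Rightarrow> (real set \<Rightarrow> 'a \<Rightarrow> 'a) \<Rightarrow> bool" where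
  "spectral_resolution M E \<longleftrightarrow>
     projection_valued_measure (hspace M) E \<and>
     odom M = {x \<in> hspace M. integrable (scalar_measure E x) (\<lambda>t. t\<^sup>2)} \<and>
     (\<forall>x \<in> odom M. cinner (oapp M x) x = complex_of_real (\<integral>t. t \<partial>scalar_measure E x))"

text \<open>
  By the spectral theorem, \<open>spectral_measure M\<close> and \<open>borel_calculus M f\<close>, for bounded Borel \<open>f\<close>,
  exist and are uniquely determined on \<open>hspace M\<close>; the choice operator only affects the
  irrelevant values outside \<open>hspace M\<close> (and on non-Borel sets).
\<close>

definition spectral_measure :: "'a::complex_inner opstruct \<Rightarrow> real set \<Rightarrow> 'a \<Rightarrow> 'a" where
  "spectral_measure M = (SOME E. spectral_resolution M E)"

definition borel_calculus :: "'a::complex_inner opstruct \<Rightarrow> (real \<Rightarrow> complex) \<Rightarrow> 'a \<Rightarrow> 'a" where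
  "borel_calculus M f =
     (SOME T. bounded_op_on (hspace M) T \<and>
        (\<forall>x \<in> hspace M. cinner (T x) x = (\<integral>t. f t \<partial>scalar_measure (spectral_measure M) x)))"

definition generated_subspace :: "'a::complex_inner opstruct \<Rightarrow> 'a set \<Rightarrow> 'a set" where
  "generated_subspace M G =
     closed_cspan {borel_calculus M f v | f v.
        v \<in> G \<and> f \<in> borel_measurable borel \<and> bounded (range f)}"

end

theory Submission
  imports Defs
begin

text \<open>
  The theorem holds because automorphisms are exactly the unitary operators that commute with the
  spectral measure \<open>E\<close> of \<open>Q\<close> (lemma \<open>automorphism_iff_commuting\<close>).  A bounded Borel function is a
  uniform limit of step functions, so \<open>H\<^sub>G\<close> is the closed span of the vectors \<open>E(B) v\<close> with
  \<open>v \<in> G\<close> (lemma \<open>generated_subspace_eq\<close>).  If an automorphism fixes \<open>G\<close>, it fixes every \<open>E(B) v\<close>, and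
  its fixed vectors form a closed subspace; hence \<open>H\<^sub>G \<subseteq> dcl(G)\<close>.  Conversely, every \<open>E(B)\<close> maps
  \<open>H\<^sub>G\<close> into itself, so the orthogonal projection \<open>P\<close> onto \<open>H\<^sub>G\<close> commutes with \<open>E\<close>.  Then
  \<open>2 P - 1\<close> is an automorphism, and the vectors that it fixes are precisely those of \<open>H\<^sub>G\<close>; hence
  \<open>dcl(G) \<subseteq> H\<^sub>G\<close>.

  Both the spectral measure and the functional calculus are given by choice, so existence and
  uniqueness of the spectral resolution of an unbounded self-adjoint operator have to be
  established first.

  Existence: the orthogonal projection of \<open>(x, 0)\<close> onto the graph of \<open>Q\<close> yields the commuting
  bounded operators \<open>A = (1 + Q\<^sup>2)\<^sup>-\<^sup>1\<close> and \<open>Q A\<close>.  The operator \<open>Q A - l A\<close> has the same sign as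
  \<open>Q - l\<close>, so the projector onto its positive part is the spectral projector of \<open>(l, \<infinity>)\<close>.  This
  sign is a strong limit of polynomials (the Newton--Schulz iteration); therefore all operators
  that commute with \<open>Q\<close> commute with the projectors as well.  These form a monotone
  right-continuous family, whose Stieltjes measures give a projection for every Borel set by a
  Dynkin argument.  On the range of the projector of \<open>(a, b]\<close> the operator \<open>Q\<close> differs from \<open>a\<close> by
  at most \<open>b - a\<close>, and cutting bounded intervals into short pieces gives \<open>Q = \<integral> t dE(t)\<close> with
  the correct domain.

  Uniqueness: if \<open>F\<close> is any spectral resolution of \<open>Q\<close>, the reflections \<open>2 F(B) - 1\<close> preserve all
  scalar measures of \<open>F\<close>, hence commute with \<open>Q\<close> and with \<open>E\<close>.  A nonzero vector \<open>x\<close> in the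
  domain and in the ranges of both \<open>E((-\<infinity>, l])\<close> and \<open>F((l, \<infinity>))\<close> would satisfy
  \<open>\<langle>Q x, x\<rangle> \<le> l \<parallel>x\<parallel>\<^sup>2 < \<langle>Q x, x\<rangle>\<close>, so \<open>E\<close> and \<open>F\<close> agree on half-lines and then on all Borel sets.
\<close>

section \<open>Operators on real Hilbert spaces\<close>

text \<open>
  By the parallelogram law a sequence in \<open>S\<close> whose distance to \<open>x\<close> tends to the infimum is Cauchy.
  At its limit the squared distance cannot decrease along any direction of \<open>S\<close>.
\<close>

lemma orthogonal_decomposition:
  fixes S :: "'a::{real_inner,complete_space} set"
  assumes S: "subspace S" "closed S"
  shows "\<exists>y\<in>S. \<forall>s\<in>S. inner (x - y) s = 0"
proof -
  define d where "d = Inf ((\<lambda>s. (norm (x - s))\<^sup>2) ` S)"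
  have ne: "S \<noteq> {}" using S(1) subspace_0 by blast
  have bdd: "bdd_below ((\<lambda>s. (norm (x - s))\<^sup>2) ` S)" by (rule bdd_belowI[of _ 0]) auto
  have dle: "d \<le> (norm (x - s))\<^sup>2" if "s \<in> S" for s
    unfolding d_def using bdd that by (intro cInf_lower) auto
  have "\<exists>s\<in>S. (norm (x - s))\<^sup>2 < d + e" if "e > 0" for e
  proof -
    have "Inf ((\<lambda>s. (norm (x - s))\<^sup>2) ` S) < d + e" using that d_def by simp
    then show ?thesis using ne bdd by (subst (asm) cInf_less_iff) auto
  qed
  then have "\<forall>n. \<exists>s. s \<in> S \<and> (norm (x - s))\<^sup>2 < d + 1 / real (Suc n)"
    by (metis of_nat_0_less_iff zero_less_Suc zero_less_divide_1_iff)
  then obtain y where y: "\<And>n. y n \<in> S" "\<And>n. (norm (x - y n))\<^sup>2 < d + 1 / real (Suc n)"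
    by metis
  have close: "(norm (y n - y m))\<^sup>2 < 2 * (1 / real (Suc n)) + 2 * (1 / real (Suc m))" for n m
  proof -
    have mid: "(1/2) *\<^sub>R (y n + y m) \<in> S" using y(1) S(1) by (simp add: subspace_add subspace_scale)
    have "(norm (y n - y m))\<^sup>2 + 4 * (norm (x - (1/2) *\<^sub>R (y n + y m)))\<^sup>2
        = 2 * (norm (x - y n))\<^sup>2 + 2 * (norm (x - y m))\<^sup>2"
      by (simp add: power2_norm_eq_inner algebra_simps inner_commute)
    then show ?thesis using dle[OF mid] y(2)[of n] y(2)[of m] by linarith
  qed
  have "Cauchy y"
  proof (rule metric_CauchyI)
    fix e :: real assume "e > 0"
    obtain N where N: "4 / e\<^sup>2 < real (Suc N)" using reals_Archimedean2
      by (metis less_Suc_eq of_nat_less_iff order_less_trans)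
    have "dist (y m) (y n) < e" if "m \<ge> N" "n \<ge> N" for m n
    proof -
      have "2 / real (Suc m) \<le> 2 / real (Suc N)" "2 / real (Suc n) \<le> 2 / real (Suc N)"
        using that by (auto intro!: divide_left_mono)
      then have "(norm (y m - y n))\<^sup>2 < 4 / real (Suc N)" using close[of m n] by simp
      also have "\<dots> < e\<^sup>2" using N \<open>e > 0\<close> by (simp add: field_simps)
      finally show ?thesis using \<open>e > 0\<close> by (simp add: dist_norm power2_less_imp_less)
    qed
    then show "\<exists>N. \<forall>m\<ge>N. \<forall>n\<ge>N. dist (y m) (y n) < e" by blast
  qed
  then obtain z where z: "y \<longlonglongrightarrow> z" using Cauchy_convergent convergentD by blast
  have zS: "z \<in> S" using S(2) y(1) z closed_sequentially by blast
  have "(\<lambda>n. (norm (x - y n))\<^sup>2) \<longlonglongrightarrow> (norm (x - z))\<^sup>2" by (intro tendsto_intros z)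
  moreover have "(\<lambda>n. d + 1 / real (Suc n)) \<longlonglongrightarrow> d + 0"
    by (intro tendsto_intros) (use LIMSEQ_inverse_real_of_nat in \<open>simp add: inverse_eq_divide\<close>)
  ultimately have "(norm (x - z))\<^sup>2 \<le> d + 0"
    by (rule LIMSEQ_le) (use y(2) less_imp_le in blast)
  then have zmin: "(norm (x - z))\<^sup>2 \<le> (norm (x - s))\<^sup>2" if "s \<in> S" for s using dle[OF that] by linarith
  have "inner (x - z) s = 0" if s: "s \<in> S" for s
  proof (cases "s = 0")
    case False
    \<comment> \<open>The minimum of the quadratic polynomial \<open>t \<mapsto> \<parallel>x - z - t s\<parallel>\<^sup>2\<close>.\<close>
    define t where "t = inner (x - z) s / (norm s)\<^sup>2"
    have t: "t * (norm s)\<^sup>2 = inner (x - z) s" using False by (simp add: t_def)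
    have "z + t *\<^sub>R s \<in> S" using zS s S(1) by (simp add: subspace_add subspace_scale)
    from zmin[OF this] have "(norm (x - z))\<^sup>2 \<le> (norm ((x - z) - t *\<^sub>R s))\<^sup>2"
      by (simp add: algebra_simps)
    also have "\<dots> = (norm (x - z))\<^sup>2 - 2 * t * inner (x - z) s + t * (t * (norm s)\<^sup>2)"
      unfolding power2_norm_eq_inner by (simp add: algebra_simps inner_commute)
    also have "\<dots> = (norm (x - z))\<^sup>2 - t * inner (x - z) s" using t by simp
    finally have "t * inner (x - z) s \<le> 0" by simp
    then have "inner (x - z) s * inner (x - z) s \<le> 0" using False
      by (simp add: t_def divide_le_0_iff)
    then show ?thesis by (metis mult_le_0_iff order_antisym_conv linorder_le_cases)
  qed simp
  then show ?thesis using zS by blast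
qed

definition orth_proj :: "'a::real_inner set \<Rightarrow> 'a \<Rightarrow> 'a" where
  "orth_proj S x = (SOME y. y \<in> S \<and> (\<forall>s\<in>S. inner (x - y) s = 0))"

definition selfadj :: "('a::real_inner \<Rightarrow> 'a) \<Rightarrow> bool" where
  "selfadj T \<longleftrightarrow> bounded_linear T \<and> (\<forall>x y. inner (T x) y = inner x (T y))"

text \<open>
  Over the reals a nonnegative quadratic form does not force symmetry, so self-adjointness is part
  of the definition.
\<close>

definition positive_op :: "('a::real_inner \<Rightarrow> 'a) \<Rightarrow> bool" where
  "positive_op T \<longleftrightarrow> selfadj T \<and> (\<forall>x. 0 \<le> inner (T x) x)"

definition orth_projector :: "('a::real_inner \<Rightarrow> 'a) \<Rightarrow> bool" where
  "orth_projector P \<longleftrightarrow> selfadj P \<and> (\<forall>x. P (P x) = P x)"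

definition commuting :: "('a \<Rightarrow> 'a) \<Rightarrow> ('a \<Rightarrow> 'a) \<Rightarrow> bool" where
  "commuting S T \<longleftrightarrow> (\<forall>x. S (T x) = T (S x))"

lemma commutingD: "commuting S T \<Longrightarrow> S (T x) = T (S x)"
  by (simp add: commuting_def)

lemma commuting_sym: "commuting S T \<Longrightarrow> commuting T S"
  by (simp add: commuting_def)

lemma bounded_linear_simps:
  assumes "bounded_linear T"
  shows "T (x + y) = T x + T y" "T (x - y) = T x - T y" "T (- x) = - T x" "T 0 = 0"
    "T (r *\<^sub>R x) = r *\<^sub>R T x"
  using assms by (simp_all add: linear_simps)

lemma selfadj_bounded_linear: "selfadj T \<Longrightarrow> bounded_linear T"
  by (simp add: selfadj_def)

lemma selfadj_inner: "selfadj T \<Longrightarrow> inner (T x) y = inner x (T y)"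
  by (simp add: selfadj_def)

lemmas selfadj_simps = bounded_linear_simps[OF selfadj_bounded_linear]

lemma positive_op_selfadj: "positive_op T \<Longrightarrow> selfadj T"
  by (simp add: positive_op_def)

lemma positive_opD: "positive_op T \<Longrightarrow> 0 \<le> inner (T x) x"
  by (simp add: positive_op_def)

lemma orth_projector_selfadj: "orth_projector P \<Longrightarrow> selfadj P"
  by (simp add: orth_projector_def)

lemma orth_projector_idem: "orth_projector P \<Longrightarrow> P (P x) = P x"
  by (simp add: orth_projector_def)

lemmas orth_projector_simps =
  selfadj_simps[OF orth_projector_selfadj] orth_projector_idem

lemma selfadj_linear_combination:
  assumes "selfadj S" "selfadj T"
  shows "selfadj (\<lambda>x. a *\<^sub>R S x + b *\<^sub>R T x)"
  using assms unfolding selfadj_def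
  by (auto intro!: bounded_linear_add bounded_linear_scaleR_right bounded_linear_const_scaleR
      simp: inner_add_left inner_add_right)

lemma selfadj_add: "selfadj S \<Longrightarrow> selfadj T \<Longrightarrow> selfadj (\<lambda>x. S x + T x)"
  using selfadj_linear_combination[of S T 1 1] by simp

lemma selfadj_diff: "selfadj S \<Longrightarrow> selfadj T \<Longrightarrow> selfadj (\<lambda>x. S x - T x)"
  using selfadj_linear_combination[of S T 1 "-1"] by simp

lemma selfadj_scaleR: "selfadj S \<Longrightarrow> selfadj (\<lambda>x. a *\<^sub>R S x)"
  using selfadj_linear_combination[of S S a 0] by simp

lemma selfadj_id: "selfadj (\<lambda>x. x)"
  by (simp add: selfadj_def bounded_linear_ident)

lemma selfadj_zero: "selfadj (\<lambda>x. 0)"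
  by (simp add: selfadj_def bounded_linear_zero)

lemma selfadj_compose_commuting:
  assumes "selfadj S" "selfadj T" "commuting S T"
  shows "selfadj (\<lambda>x. S (T x))"
  using assms bounded_linear_compose[of S T] unfolding selfadj_def commuting_def by simp

lemma orth_projector_norm_sq: "orth_projector P \<Longrightarrow> inner (P x) x = (norm (P x))\<^sup>2"
  by (metis orth_projector_def power2_norm_eq_inner selfadj_inner)

lemma orth_projector_pythagoras:
  assumes "orth_projector P"
  shows "(norm x)\<^sup>2 = (norm (P x))\<^sup>2 + (norm (x - P x))\<^sup>2"
  using orth_projector_norm_sq[OF assms, of x]
  by (simp add: power2_norm_eq_inner algebra_simps inner_commute)

lemma orth_projector_norm_le: "orth_projector P \<Longrightarrow> norm (P x) \<le> norm x"
  by (rule power2_le_imp_le) (use orth_projector_pythagoras[of P x] in auto)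

lemma orth_projector_complement:
  assumes "orth_projector P"
  shows "orth_projector (\<lambda>x. x - P x)"
  using assms selfadj_diff[OF selfadj_id orth_projector_selfadj[OF assms]]
  by (simp add: orth_projector_def selfadj_simps[OF orth_projector_selfadj[OF assms]])

context
  fixes S :: "'a::{real_inner,complete_space} set"
  assumes S: "subspace S" "closed S"
begin

lemma orth_proj_in: "orth_proj S x \<in> S"
  and orth_proj_orthogonal: "s \<in> S \<Longrightarrow> inner (x - orth_proj S x) s = 0"
  using someI_ex[of "\<lambda>y. y \<in> S \<and> (\<forall>s\<in>S. inner (x - y) s = 0)"] orthogonal_decomposition[OF S, of x]
  unfolding orth_proj_def by blast+

lemma orth_proj_unique:
  assumes "y \<in> S" "\<And>s. s \<in> S \<Longrightarrow> inner (x - y) s = 0"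
  shows "orth_proj S x = y"
proof -
  have "orth_proj S x - y \<in> S" using orth_proj_in assms(1) S(1) by (simp add: subspace_diff)
  from orth_proj_orthogonal[OF this, of x] assms(2)[OF this]
  have "inner (orth_proj S x - y) (orth_proj S x - y) = 0" by (simp add: inner_diff_left)
  then show ?thesis by simp
qed

lemma orth_proj_eq_iff: "orth_proj S x = x \<longleftrightarrow> x \<in> S"
  using orth_proj_in[of x] orth_proj_unique[of x x] by auto

lemma orth_projector_orth_proj: "orth_projector (orth_proj S)"
proof -
  have add: "orth_proj S (x + y) = orth_proj S x + orth_proj S y" for x y
    by (rule orth_proj_unique)
       (use S orth_proj_in orth_proj_orthogonal in \<open>auto simp: subspace_add add_diff_add inner_add_left\<close>)
  have scale: "orth_proj S (r *\<^sub>R x) = r *\<^sub>R orth_proj S x" for r x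
    by (rule orth_proj_unique)
       (use S orth_proj_in orth_proj_orthogonal in
         \<open>auto simp: subspace_scale simp flip: scaleR_diff_right\<close>)
  have sym: "inner (orth_proj S x) y = inner x (orth_proj S y)" for x y
    using orth_proj_orthogonal[OF orth_proj_in, of x y] orth_proj_orthogonal[OF orth_proj_in, of y x]
      inner_commute[of "orth_proj S x" y] inner_commute[of "orth_proj S x" "orth_proj S y"]
    by (simp add: inner_diff_left)
  have idem: "orth_proj S (orth_proj S x) = orth_proj S x" for x
    using orth_proj_eq_iff orth_proj_in by blast
  have "norm (orth_proj S x) \<le> norm x" for x
  proof -
    have "norm (orth_proj S x) * norm (orth_proj S x) = inner x (orth_proj S x)"
      by (metis idem power2_eq_square power2_norm_eq_inner sym)
    also have "\<dots> \<le> norm x * norm (orth_proj S x)" by (rule norm_cauchy_schwarz)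
    finally show ?thesis by (cases "orth_proj S x = 0") simp_all
  qed
  then have "bounded_linear (orth_proj S)"
    by (intro bounded_linear_intro[of _ 1] add scale) simp
  then show ?thesis by (simp add: orth_projector_def selfadj_def sym idem)
qed

end

subsection \<open>Products of commuting positive operators\<close>

text \<open>
  The residuals of the greedy expansion of \<open>0 \<le> A \<le> 1\<close> as a sum of squares: each step
  removes the square of the current residual.
\<close>

primrec square_residual :: "('a::real_inner \<Rightarrow> 'a) \<Rightarrow> nat \<Rightarrow> 'a \<Rightarrow> 'a" where
  "square_residual A 0 = A"
| "square_residual A (Suc n)
    = (\<lambda>x. square_residual A n x - square_residual A n (square_residual A n x))"

lemma square_residual_bounds:
  assumes A: "positive_op A" "\<And>x. inner (A x) x \<le> inner x x"
  shows "positive_op (square_residual A n) \<and>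
    (\<forall>x. inner (square_residual A n x) x \<le> inner x x)"
proof (induction n)
  case 0 then show ?case using A by simp
next
  case (Suc n)
  let ?B = "square_residual A n"
  have B: "selfadj ?B" "\<And>x. 0 \<le> inner (?B x) x" "\<And>x. inner (?B x) x \<le> inner x x"
    using Suc by (auto simp: positive_op_def)
  note lin = selfadj_simps[OF B(1)]
  have sa: "selfadj (square_residual A (Suc n))"
    using selfadj_diff[OF B(1) selfadj_compose_commuting[OF B(1) B(1)]] by (simp add: commuting_def)
  have "0 \<le> inner (?B x - ?B (?B x)) x" for x
  proof -
    \<comment> \<open>\<open>R - R\<^sup>2 = (1 - R) R (1 - R) + (R\<^sup>2 - R\<^sup>3)\<close>, and both summands are positive if \<open>0 \<le> R \<le> 1\<close>.\<close>
    have "inner (?B x - ?B (?B x)) x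
        = inner (?B (x - ?B x)) (x - ?B x) + (inner (?B x) (?B x) - inner (?B (?B x)) (?B x))"
      using selfadj_inner[OF B(1), of "?B x" x] selfadj_inner[OF B(1), of "?B x" "?B x"]
      by (simp add: lin algebra_simps)
    then show ?thesis using B(2)[of "x - ?B x"] B(3)[of "?B x"] by linarith
  qed
  moreover have "inner (?B x - ?B (?B x)) x \<le> inner x x" for x
  proof -
    have "inner (?B (?B x)) x = inner (?B x) (?B x)" by (rule selfadj_inner[OF B(1)])
    then show ?thesis using B(3)[of x] inner_ge_zero[of "?B x"] unfolding inner_diff_left by linarith
  qed
  ultimately show ?case using sa by (simp add: positive_op_def)
qed

lemma square_residual_telescope:
  assumes A: "positive_op A" "\<And>x. inner (A x) x \<le> inner x x"
  shows "A x = square_residual A n x + (\<Sum>k<n. square_residual A k (square_residual A k x))"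
  by (induction n) auto

text \<open>
  The telescoping sum bounds \<open>\<Sum>k<n. \<parallel>R\<^sub>k x\<parallel>\<^sup>2\<close> by \<open>\<langle>A x, x\<rangle>\<close> for the residuals \<open>R\<^sub>k\<close>.
\<close>

lemma square_residual_tendsto_0:
  assumes A: "positive_op A" "\<And>x. inner (A x) x \<le> inner x x"
  shows "(\<lambda>n. square_residual A n x) \<longlonglongrightarrow> 0"
proof -
  let ?B = "square_residual A"
  have sq: "inner (?B n (?B n x)) x = (norm (?B n x))\<^sup>2" for n
    using square_residual_bounds[OF A, of n] selfadj_inner[of "?B n" "?B n x" x]
    by (simp add: positive_op_def power2_norm_eq_inner)
  have "(\<Sum>k<n. (norm (?B k x))\<^sup>2) \<le> inner (A x) x" for n
  proof -
    have "inner (A x) x = inner (?B n x) x + (\<Sum>k<n. (norm (?B k x))\<^sup>2)"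
      by (subst square_residual_telescope[OF A, of x n]) (simp add: inner_add_left inner_sum_left sq)
    moreover have "0 \<le> inner (?B n x) x" using square_residual_bounds[OF A, of n]
      by (simp add: positive_op_def)
    ultimately show ?thesis by simp
  qed
  then have "summable (\<lambda>k. (norm (?B k x))\<^sup>2)" by (intro summableI_nonneg_bounded) auto
  then have "(\<lambda>n. (norm (?B n x))\<^sup>2) \<longlonglongrightarrow> 0" by (rule summable_LIMSEQ_zero)
  then have "(\<lambda>n. sqrt ((norm (?B n x))\<^sup>2)) \<longlonglongrightarrow> sqrt 0" by (rule tendsto_real_sqrt)
  then show ?thesis by (simp add: tendsto_norm_zero_iff)
qed

lemma square_residual_commuting:
  assumes "bounded_linear T" "commuting T A"
  shows "T (square_residual A n x) = square_residual A n (T x)"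
proof (induction n arbitrary: x)
  case 0 show ?case using assms(2) by (simp add: commutingD)
next
  case (Suc n) then show ?case by (simp add: bounded_linear_simps(2)[OF assms(1)])
qed

text \<open>
  If \<open>A\<close> is scaled below 1, it is a strongly convergent sum of squares \<open>A\<^sub>k\<^sup>2\<close> of self-adjoint
  operators that commute with \<open>B\<close>, and \<open>\<langle>A B x, x\<rangle> = (\<Sum>k. \<langle>B (A\<^sub>k x), A\<^sub>k x\<rangle>) \<ge> 0\<close>.
\<close>

lemma positive_commuting_product:
  assumes A: "positive_op A" and B: "positive_op B" and com: "commuting A B"
  shows "0 \<le> inner (A (B x)) x"
proof -
  obtain K where K: "K > 0" "\<And>x. norm (A x) \<le> norm x * K"
    using bounded_linear.pos_bounded A positive_op_selfadj selfadj_bounded_linear by blast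
  let ?A = "\<lambda>x. (1 / K) *\<^sub>R A x"
  have pos: "positive_op ?A" using A K by (simp add: positive_op_def selfadj_scaleR)
  have le: "inner (?A x) x \<le> inner x x" for x
  proof -
    have "inner (A x) x \<le> norm (A x) * norm x" by (rule norm_cauchy_schwarz)
    also have "\<dots> \<le> norm x * K * norm x" using K by (intro mult_right_mono) auto
    also have "\<dots> = K * inner x x" by (simp add: power2_norm_eq_inner[symmetric] power2_eq_square)
    finally show ?thesis using K by (simp add: field_simps)
  qed
  let ?R = "square_residual ?A"
  have sB: "selfadj B" using B by (simp add: positive_op_def)
  have comR: "B (?R n x) = ?R n (B x)" for n x
    by (rule square_residual_commuting)
       (use com selfadj_bounded_linear[OF sB] in \<open>auto simp: commuting_def selfadj_simps[OF sB]\<close>)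
  have "inner (?R n (B x)) x \<le> inner (?A (B x)) x" for n
  proof -
    have "inner (?R k (?R k (B x))) x = inner (B (?R k x)) (?R k x)" for k
      using square_residual_bounds[OF pos le, of k] selfadj_inner[of "?R k" "?R k (B x)" x]
      by (simp add: positive_op_def comR)
    then have "inner (?A (B x)) x = inner (?R n (B x)) x + (\<Sum>k<n. inner (B (?R k x)) (?R k x))"
      by (subst square_residual_telescope[OF pos le, of "B x" n])
          (simp add: inner_add_left inner_sum_left)
    moreover have "0 \<le> (\<Sum>k<n. inner (B (?R k x)) (?R k x))"
      using B by (intro sum_nonneg) (simp add: positive_op_def)
    ultimately show ?thesis by linarith
  qed
  moreover have "(\<lambda>n. inner (?R n (B x)) x) \<longlonglongrightarrow> inner 0 x"
    by (intro tendsto_intros square_residual_tendsto_0[OF pos le])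
  ultimately have "inner 0 x \<le> inner (?A (B x)) x" by (meson LIMSEQ_le_const2)
  then show ?thesis using K by (simp add: zero_le_divide_iff)
qed

subsection \<open>Strong limits\<close>

lemma selfadj_strong_limit:
  assumes T: "\<And>n. selfadj (T n)" "\<And>n x. norm (T n x) \<le> norm x"
    and lim: "\<And>x. (\<lambda>n. T n x) \<longlonglongrightarrow> J x"
  shows "selfadj J" "norm (J x) \<le> norm x"
proof -
  have le: "norm (J x) \<le> norm x" for x
    by (rule LIMSEQ_le_const2[OF tendsto_norm[OF lim]]) (use T in auto)
  have "J (x + y) = J x + J y" for x y
  proof (rule LIMSEQ_unique[OF lim])
    show "(\<lambda>n. T n (x + y)) \<longlonglongrightarrow> J x + J y"
      using tendsto_add[OF lim lim, of x y] by (simp add: selfadj_simps[OF T(1)])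
  qed
  moreover have "J (r *\<^sub>R x) = r *\<^sub>R J x" for r x
  proof (rule LIMSEQ_unique[OF lim])
    show "(\<lambda>n. T n (r *\<^sub>R x)) \<longlonglongrightarrow> r *\<^sub>R J x"
      using tendsto_scaleR[OF tendsto_const lim, of r x] by (simp add: selfadj_simps[OF T(1)])
  qed
  ultimately have "bounded_linear J" using le by (intro bounded_linear_intro[of _ 1]) auto
  moreover have "inner (J x) y = inner x (J y)" for x y
  proof (rule LIMSEQ_unique)
    show "(\<lambda>n. inner (T n x) y) \<longlonglongrightarrow> inner (J x) y" by (intro tendsto_intros lim)
    show "(\<lambda>n. inner (T n x) y) \<longlonglongrightarrow> inner x (J y)"
      unfolding selfadj_inner[OF T(1)] by (intro tendsto_intros lim)
  qed
  ultimately show "selfadj J" by (simp add: selfadj_def)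
  show "norm (J x) \<le> norm x" by (rule le)
qed

lemma strong_limit_compose:
  assumes T: "\<And>n. selfadj (T n)" "\<And>n x. norm (T n x) \<le> norm x"
    and lim: "\<And>x. (\<lambda>n. T n x) \<longlonglongrightarrow> J x" and y: "y \<longlonglongrightarrow> z"
  shows "(\<lambda>n. T n (y n)) \<longlonglongrightarrow> J z"
proof -
  have "(\<lambda>n. T n (y n - z)) \<longlonglongrightarrow> 0"
    by (rule Lim_null_comparison[OF _ tendsto_norm_zero[OF y[THEN LIM_zero]]]) (use T in auto)
  from tendsto_add[OF this lim[of z]] show ?thesis by (simp add: selfadj_simps[OF T(1)])
qed

lemma strong_limit_commuting:
  assumes T: "bounded_linear T" "\<And>n. commuting T (u n)" and lim: "\<And>x. (\<lambda>n. u n x) \<longlonglongrightarrow> J x"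
  shows "commuting T J"
  unfolding commuting_def
proof
  fix x
  have "(\<lambda>n. T (u n x)) \<longlonglongrightarrow> T (J x)" by (rule bounded_linear.tendsto[OF T(1) lim])
  moreover have "(\<lambda>n. T (u n x)) \<longlonglongrightarrow> J (T x)" using lim[of "T x"] by (simp add: commutingD[OF T(2)])
  ultimately show "T (J x) = J (T x)" by (rule LIMSEQ_unique)
qed

text \<open>
  The form in which monotonicity of operators yields strong convergence: the increments of the
  vectors are controlled by those of a bounded increasing real sequence.
\<close>

lemma Cauchy_by_increasing_real:
  fixes y :: "nat \<Rightarrow> 'a::real_normed_vector"
  assumes le: "\<And>m n. m \<le> n \<Longrightarrow> (norm (y n - y m))\<^sup>2 \<le> f n - f m" and bdd: "\<And>n. f n \<le> C"
  shows "Cauchy y"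
proof (rule metric_CauchyI)
  fix e :: real assume e: "e > 0"
  have "incseq f" unfolding incseq_def using order_trans[OF zero_le_power2 le] by (simp add: le_diff_eq)
  then have "convergent f" using incseq_convergent[of f C] bdd convergentI by blast
  then have "Cauchy f" by (rule convergent_Cauchy)
  then obtain N where N: "\<And>m n. m \<ge> N \<Longrightarrow> n \<ge> N \<Longrightarrow> dist (f m) (f n) < e\<^sup>2"
    using e metric_CauchyD[of f "e\<^sup>2"] by auto
  have lt: "dist (y n) (y m) < e" if "N \<le> m" "m \<le> n" for m n
  proof -
    have "(norm (y n - y m))\<^sup>2 < e\<^sup>2" using le[OF that(2)] N[of n m] that by (simp add: dist_real_def)
    then show ?thesis using e by (simp add: dist_norm power2_less_imp_less)
  qed
  have "dist (y m) (y n) < e" if "m \<ge> N" "n \<ge> N" for m n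
    using lt[of m n] lt[of n m] that by (cases "m \<le> n") (auto simp: dist_commute)
  then show "\<exists>N. \<forall>m\<ge>N. \<forall>n\<ge>N. dist (y m) (y n) < e" by blast
qed

subsection \<open>The sign of a self-adjoint operator\<close>

text \<open>
  The Newton--Schulz iteration \<open>u \<mapsto> (3 u - u\<^sup>3) / 2\<close>, which drives every point of \<open>[-1, 1]\<close> except 0
  monotonically to its sign.
\<close>

primrec sign_iter :: "('a::real_inner \<Rightarrow> 'a) \<Rightarrow> nat \<Rightarrow> 'a \<Rightarrow> 'a" where
  "sign_iter S 0 = S"
| "sign_iter S (Suc n) =
     (\<lambda>x. (3 / 2) *\<^sub>R sign_iter S n x - (1 / 2) *\<^sub>R sign_iter S n (sign_iter S n (sign_iter S n x)))"

lemma sign_iter_commuting: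
  assumes "bounded_linear T" "commuting T S"
  shows "commuting T (sign_iter S n)"
proof (induction n)
  case (Suc n) then show ?case by (simp add: commuting_def bounded_linear_simps[OF assms(1)])
qed (simp add: assms)

context
  fixes S :: "'a::{real_inner,complete_space} \<Rightarrow> 'a"
  assumes S: "selfadj S" and S_le: "\<And>x. norm (S x) \<le> norm x"
begin

lemma selfadj_sign_iter: "selfadj (sign_iter S n)"
proof (induction n)
  case (Suc n)
  let ?u = "sign_iter S n"
  have "selfadj (\<lambda>x. ?u (?u x))"
    by (rule selfadj_compose_commuting[OF Suc Suc]) (simp add: commuting_def)
  then have "selfadj (\<lambda>x. ?u (?u (?u x)))"
    by (rule selfadj_compose_commuting[OF Suc]) (simp add: commuting_def)
  from selfadj_linear_combination[OF Suc this, of "3/2" "-1/2"] show ?case by simp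
qed (simp add: S)

lemma sign_iter_norm_le: "norm (sign_iter S n x) \<le> norm x"
proof (induction n arbitrary: x)
  case (Suc n)
  let ?u = "sign_iter S n"
  define y where "y = x - ?u (?u x)"
  note lin = selfadj_simps[OF selfadj_sign_iter[of n]] selfadj_inner[OF selfadj_sign_iter[of n]]
  \<comment> \<open>With \<open>w = 1 - u\<^sup>2\<close> and \<open>u' = (3 u - u\<^sup>3) / 2\<close> one has \<open>1 - u'\<^sup>2 = w\<^sup>2 (3 + w) / 4\<close>.\<close>
  have "(norm x)\<^sup>2 - (norm (sign_iter S (Suc n) x))\<^sup>2
      = (3/4) * (norm y)\<^sup>2 + (1/4) * ((norm y)\<^sup>2 - (norm (?u y))\<^sup>2)"
    unfolding power2_norm_eq_inner y_def
    by (simp add: lin inner_diff_left inner_diff_right algebra_simps)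
  moreover have "(norm (?u y))\<^sup>2 \<le> (norm y)\<^sup>2" using Suc[of y] by (simp add: power_mono)
  ultimately have "0 \<le> (norm x)\<^sup>2 - (norm (sign_iter S (Suc n) x))\<^sup>2" by simp
  then have "(norm (sign_iter S (Suc n) x))\<^sup>2 \<le> (norm x)\<^sup>2" by (simp only: diff_ge_0_iff_ge)
  then show ?case by (rule power2_le_imp_le) simp
qed (simp add: S_le)

lemma sign_iter_commuting_iter: "sign_iter S n (sign_iter S m x) = sign_iter S m (sign_iter S n x)"
proof -
  have "commuting S (sign_iter S m)" for m
    by (rule sign_iter_commuting) (simp_all add: S selfadj_bounded_linear commuting_def)
  then have "commuting (sign_iter S n) (sign_iter S m)"
    by (intro sign_iter_commuting selfadj_bounded_linear[OF selfadj_sign_iter]) (rule commuting_sym)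
  then show ?thesis by (rule commutingD)
qed

text \<open>The iterates keep their sign and grow in modulus: \<open>u\<^sub>n u\<^sub>m \<ge> u\<^sub>n\<^sup>2\<close> for \<open>n \<le> m\<close>.\<close>

lemma sign_iter_product_ge:
  assumes "n \<le> m"
  shows "(norm (sign_iter S n x))\<^sup>2 \<le> inner (sign_iter S n (sign_iter S m x)) x"
  using assms
proof (induction m arbitrary: x rule: dec_induct)
  case base
  show ?case using selfadj_inner[OF selfadj_sign_iter[of n]] by (simp add: power2_norm_eq_inner)
next
  case (step m)
  let ?u = "sign_iter S n" and ?w = "sign_iter S m"
  note lin = selfadj_simps[OF selfadj_sign_iter[of n]] selfadj_simps[OF selfadj_sign_iter[of m]]
  have pos: "positive_op (\<lambda>x. ?u (?w x))"
    unfolding positive_op_def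
  proof (intro conjI allI)
    show "selfadj (\<lambda>x. ?u (?w x))"
      by (rule selfadj_compose_commuting[OF selfadj_sign_iter selfadj_sign_iter])
         (simp add: commuting_def sign_iter_commuting_iter)
    show "0 \<le> inner (?u (?w x)) x" for x
      by (rule order_trans[OF zero_le_power2 step.IH])
  qed
  have "selfadj (\<lambda>x. ?w (?w x))"
    by (rule selfadj_compose_commuting[OF selfadj_sign_iter selfadj_sign_iter])
        (simp add: commuting_def)
  then have pos': "positive_op (\<lambda>x. x - ?w (?w x))"
    unfolding positive_op_def using power_mono[OF sign_iter_norm_le[of m] norm_ge_zero, of _ 2]
    by (auto simp: selfadj_diff[OF selfadj_id] inner_diff_left power2_norm_eq_inner
        selfadj_inner[OF selfadj_sign_iter[of m]])
  \<comment> \<open>The increment is \<open>u\<^sub>m\<^sub>+\<^sub>1 - u\<^sub>m = u\<^sub>m (1 - u\<^sub>m\<^sup>2) / 2\<close>, and \<open>u\<^sub>n u\<^sub>m\<close> and \<open>1 - u\<^sub>m\<^sup>2\<close> are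
    commuting positive operators.\<close>
  have "0 \<le> inner (?u (?w (x - ?w (?w x)))) x"
    using positive_commuting_product[OF pos pos']
      by (simp add: commuting_def lin sign_iter_commuting_iter)
  moreover have aux: "(3/2) *\<^sub>R a - (1/2) *\<^sub>R b = a + (1/2) *\<^sub>R (a - b)" for a b :: 'a
    using scaleR_add_left[of 1 "1/2" a] by (simp add: scaleR_diff_right)
  have "?u (sign_iter S (Suc m) x) = ?u (?w x) + (1/2) *\<^sub>R ?u (?w (x - ?w (?w x)))"
    using aux[of "?u (?w x)"] by (simp add: lin)
  ultimately show ?case using step.IH[of x] by (simp only: inner_add_left inner_scaleR_left)
qed

text \<open>
  Commuting operators \<open>u\<^sub>n\<close>, \<open>u\<^sub>m\<close> with \<open>u\<^sub>n u\<^sub>m \<ge> u\<^sub>n\<^sup>2\<close> satisfy \<open>(u\<^sub>m - u\<^sub>n)\<^sup>2 \<le> u\<^sub>m\<^sup>2 - u\<^sub>n\<^sup>2\<close>.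
\<close>

lemma sign_iter_convergent: "convergent (\<lambda>n. sign_iter S n x)"
proof -
  have "(norm (sign_iter S n x - sign_iter S m x))\<^sup>2
      \<le> (norm (sign_iter S n x))\<^sup>2 - (norm (sign_iter S m x))\<^sup>2" if "m \<le> n" for m n
    using sign_iter_product_ge[OF that, of x] selfadj_inner[OF selfadj_sign_iter[of m], of "sign_iter S n x" x]
    by (simp add: power2_norm_eq_inner inner_diff_left inner_diff_right inner_commute)
  moreover have "(norm (sign_iter S n x))\<^sup>2 \<le> (norm x)\<^sup>2" for n
    by (intro power_mono sign_iter_norm_le norm_ge_zero)
  ultimately have "Cauchy (\<lambda>n. sign_iter S n x)" by (rule Cauchy_by_increasing_real)
  then show ?thesis by (simp add: Cauchy_convergent_iff)
qed

text \<open>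
  The strong limit \<open>J\<close> of the iteration is the sign of \<open>S\<close>: it satisfies \<open>J\<^sup>3 = J\<close>, \<open>S J \<ge> 0\<close>, and
  has the same kernel as \<open>S\<close>.  The projector onto the strictly positive part is \<open>(J\<^sup>2 + J) / 2\<close>; it
  commutes with every operator that commutes with \<open>S\<close>, being a limit of polynomials in \<open>S\<close>.
\<close>

lemma sign_projector_exists_contraction:
  "\<exists>P. orth_projector P \<and> (\<forall>x. P x = x \<longrightarrow> 0 \<le> inner (S x) x) \<and> (\<forall>x. P x = 0 \<longrightarrow> inner (S x) x \<le> 0) \<and>
    (\<forall>x. S x = 0 \<longrightarrow> P x = 0) \<and> (\<forall>T. bounded_linear T \<longrightarrow> commuting T S \<longrightarrow> commuting T P)"
proof -
  let ?u = "sign_iter S"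
  define J where "J x = lim (\<lambda>n. ?u n x)" for x
  have lim: "(\<lambda>n. ?u n x) \<longlonglongrightarrow> J x" for x
    using sign_iter_convergent[of x] by (simp add: J_def convergent_LIMSEQ_iff)
  note J = selfadj_strong_limit[OF selfadj_sign_iter sign_iter_norm_le lim]
  note compose = strong_limit_compose[OF selfadj_sign_iter sign_iter_norm_le lim]
  note lin = selfadj_simps[OF J(1)]
  have com: "commuting T J" if "bounded_linear T" "commuting T S" for T
    by (rule strong_limit_commuting[OF that(1) sign_iter_commuting[OF that] lim])
  have cube: "J (J (J x)) = J x" for x
  proof -
    have "(\<lambda>n. ?u (Suc n) x) \<longlonglongrightarrow> (3 / 2) *\<^sub>R J x - (1 / 2) *\<^sub>R J (J (J x))"
      unfolding sign_iter.simps by (intro tendsto_intros compose lim)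
    moreover have "(\<lambda>n. ?u (Suc n) x) \<longlonglongrightarrow> J x" using lim by (rule LIMSEQ_Suc)
    ultimately have "(3 / 2) *\<^sub>R J x - (1 / 2) *\<^sub>R J (J (J x)) = J x" by (rule LIMSEQ_unique)
    then have "2 *\<^sub>R ((3 / 2) *\<^sub>R J x - (1 / 2) *\<^sub>R J (J (J x))) = 2 *\<^sub>R J x" by simp
    then have "3 *\<^sub>R J x - 2 *\<^sub>R J x = J (J (J x))" by (simp add: scaleR_diff_right algebra_simps)
    then show ?thesis by (simp flip: scaleR_diff_left)
  qed
  have SJ: "S (J x) = J (S x)" for x
    using com[of S] S by (simp add: selfadj_bounded_linear commuting_def)
  have SJ_pos: "0 \<le> inner (S (J x)) x" for x
  proof (rule LIMSEQ_le_const)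
    show "(\<lambda>n. inner (S (?u n x)) x) \<longlonglongrightarrow> inner (S (J x)) x"
      by (intro tendsto_intros bounded_linear.tendsto[OF selfadj_bounded_linear[OF S] lim])
    have "0 \<le> inner (S (?u n x)) x" for n
      using order_trans[OF zero_le_power2 sign_iter_product_ge[of 0 n x]] by simp
    then show "\<exists>N. \<forall>n\<ge>N. 0 \<le> inner (S (?u n x)) x" by blast
  qed
  have kerJ: "S x = 0" if "J x = 0" for x
  proof -
    have "norm (S x) \<le> norm (?u n x)" for n
    proof (rule power2_le_imp_le)
      have "(norm (?u 0 x))\<^sup>2 \<le> norm (?u 0 x) * norm (?u n x)"
        using sign_iter_product_ge[of 0 n x] selfadj_inner[OF S, of "?u n x" x]
          norm_cauchy_schwarz[of "S x" "?u n x"] by (simp add: inner_commute)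
      then show "(norm (S x))\<^sup>2 \<le> (norm (?u n x))\<^sup>2"
        by (cases "S x = 0") (auto simp: power2_eq_square intro: mult_mono)
    qed simp
    then have "norm (S x) \<le> norm (J x)" by (intro LIMSEQ_le_const[OF tendsto_norm[OF lim]]) auto
    then show ?thesis using that by simp
  qed
  define P where "P x = (1/2) *\<^sub>R J (J x) + (1/2) *\<^sub>R J x" for x
  have "selfadj (\<lambda>x. J (J x))"
    by (rule selfadj_compose_commuting[OF J(1) J(1)]) (simp add: commuting_def)
  from selfadj_linear_combination[OF this J(1), of "1/2" "1/2"] have "selfadj P"
    unfolding P_def[abs_def] .
  moreover have JP: "J (P x) = P x" for x
    by (simp add: P_def lin cube add.commute)
  then have "P (P x) = P x" for x
    by (simp add: P_def[of "P x"] flip: scaleR_add_left)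
  ultimately have "orth_projector P" by (simp add: orth_projector_def)
  moreover have "0 \<le> inner (S x) x" if "P x = x" for x
    using SJ_pos[of x] JP[of x] that by simp
  moreover have "inner (S x) x \<le> 0" if "P x = 0" for x
  proof -
    have "(1/2) *\<^sub>R J (J x) = - ((1/2) *\<^sub>R J x)" using that unfolding P_def by (simp add: add_eq_0_iff2)
    then have "J (J x) = - J x"
      by (metis scaleR_cancel_left scaleR_minus_right divide_eq_0_iff zero_neq_one zero_neq_numeral)
    moreover have "S (x - J (J x)) = 0" by (rule kerJ) (simp add: lin cube)
    ultimately have "S x = - S (J x)" by (simp add: selfadj_simps[OF S] add_eq_0_iff2)
    then show ?thesis using SJ_pos[of x] by simp
  qed
  moreover have "P x = 0" if "S x = 0" for x
  proof -
    have "?u n x = 0" for n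
      by (induction n) (simp_all add: that selfadj_simps[OF selfadj_sign_iter])
    then have "J x = 0" using lim[of x] by (simp add: LIMSEQ_const_iff)
    then show ?thesis by (simp add: P_def lin)
  qed
  moreover have "commuting T P" if "bounded_linear T" "commuting T S" for T
    using com[OF that] by (simp add: commuting_def P_def bounded_linear_simps[OF that(1)])
  ultimately show ?thesis by blast
qed

end

lemma sign_projector_exists:
  fixes S :: "'a::{real_inner,complete_space} \<Rightarrow> 'a"
  assumes S: "selfadj S"
  shows "\<exists>P. orth_projector P \<and> (\<forall>x. P x = x \<longrightarrow> 0 \<le> inner (S x) x) \<and> (\<forall>x. P x = 0 \<longrightarrow> inner (S x) x \<le> 0) \<and>
    (\<forall>x. S x = 0 \<longrightarrow> P x = 0) \<and> (\<forall>T. bounded_linear T \<longrightarrow> commuting T S \<longrightarrow> commuting T P)"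
proof -
  obtain K where K: "K > 0" "\<And>x. norm (S x) \<le> norm x * K"
    using bounded_linear.pos_bounded S selfadj_bounded_linear by blast
  have le: "norm ((1 / K) *\<^sub>R S x) \<le> norm x" for x using K by (simp add: field_simps)
  have "commuting T (\<lambda>x. (1 / K) *\<^sub>R S x)" if "bounded_linear T" "commuting T S" for T
    using that by (simp add: commuting_def bounded_linear_simps[OF that(1)])
  then show ?thesis
    using sign_projector_exists_contraction[OF selfadj_scaleR[OF S] le] K
    by (simp add: zero_le_divide_iff divide_le_0_iff) blast
qed

definition positive_part_projector :: "('a::real_inner \<Rightarrow> 'a) \<Rightarrow> 'a \<Rightarrow> 'a" where
  "positive_part_projector S = (SOME P. orth_projector P \<and> (\<forall>x. P x = x \<longrightarrow> 0 \<le> inner (S x) x) \<and>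
    (\<forall>x. P x = 0 \<longrightarrow> inner (S x) x \<le> 0) \<and> (\<forall>x. S x = 0 \<longrightarrow> P x = 0) \<and>
    (\<forall>T. bounded_linear T \<longrightarrow> commuting T S \<longrightarrow> commuting T P))"

context
  fixes S :: "'a::{real_inner,complete_space} \<Rightarrow> 'a"
  assumes S: "selfadj S"
begin

lemma
  shows orth_projector_positive_part: "orth_projector (positive_part_projector S)"
    and positive_part_nonneg: "positive_part_projector S x = x \<Longrightarrow> 0 \<le> inner (S x) x"
    and positive_part_complement_nonpos: "positive_part_projector S x = 0 \<Longrightarrow> inner (S x) x \<le> 0"
    and positive_part_kernel: "S x = 0 \<Longrightarrow> positive_part_projector S x = 0"
    and positive_part_commuting: "bounded_linear T \<Longrightarrow> commuting T S \<Longrightarrow> commuting T (positive_part_projector S)"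
  using someI_ex[OF sign_projector_exists[OF S]] unfolding positive_part_projector_def[symmetric]
  by blast+

end

subsection \<open>Monotone sequences of projectors\<close>

text \<open>
  The order of projectors, expressed through norms: if \<open>\<parallel>P x\<parallel> \<le> \<parallel>Q x\<parallel>\<close> for all \<open>x\<close>, then \<open>Q\<close>
  preserves the norm of the vectors \<open>P x\<close> and therefore fixes them.
\<close>

lemma projector_le_absorb:
  assumes P: "orth_projector P" and Q: "orth_projector Q" and le: "\<And>x. norm (P x) \<le> norm (Q x)"
  shows "Q (P x) = P x" "P (Q x) = P x"
proof -
  have QP: "Q (P x) = P x" for x
  proof -
    have "norm (P x) \<le> norm (Q (P x))" using le[of "P x"] by (simp add: orth_projector_idem[OF P])
    then have "(norm (P x))\<^sup>2 \<le> (norm (Q (P x)))\<^sup>2" by (rule power_mono) simp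
    then have "(norm (P x - Q (P x)))\<^sup>2 \<le> 0" using orth_projector_pythagoras[OF Q, of "P x"] by linarith
    then show ?thesis by simp
  qed
  show "Q (P x) = P x" by (rule QP)
  have "inner (P (Q x)) z = inner (P x) z" for z
    using selfadj_inner[OF orth_projector_selfadj[OF P]] selfadj_inner[OF orth_projector_selfadj[OF Q]] QP
    by metis
  then show "P (Q x) = P x" by (metis vector_eq_ldot inner_commute)
qed

lemma projector_le_diff:
  assumes P: "orth_projector P" and Q: "orth_projector Q" and le: "\<And>x. norm (P x) \<le> norm (Q x)"
  shows "orth_projector (\<lambda>x. Q x - P x)" "(norm (Q x - P x))\<^sup>2 = (norm (Q x))\<^sup>2 - (norm (P x))\<^sup>2"
proof -
  note absorb = projector_le_absorb[OF P Q le]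
  show *: "orth_projector (\<lambda>x. Q x - P x)"
    unfolding orth_projector_def
      using selfadj_diff[OF Q[THEN orth_projector_selfadj] P[THEN orth_projector_selfadj]]
    by (simp add: orth_projector_simps[OF P] orth_projector_simps[OF Q] absorb)
  show "(norm (Q x - P x))\<^sup>2 = (norm (Q x))\<^sup>2 - (norm (P x))\<^sup>2"
    using orth_projector_norm_sq[OF *, of x] orth_projector_norm_sq[OF P, of x]
      orth_projector_norm_sq[OF Q, of x] by (simp add: inner_diff_left)
qed

lemma increasing_projectors_converge:
  fixes P :: "nat \<Rightarrow> 'a::{real_inner,complete_space} \<Rightarrow> 'a"
  assumes P: "\<And>n. orth_projector (P n)" and le: "\<And>n x. norm (P n x) \<le> norm (P (Suc n) x)"
  shows "\<exists>Q. orth_projector Q \<and> (\<forall>x. (\<lambda>n. P n x) \<longlonglongrightarrow> Q x)"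
proof -
  have mono: "norm (P m x) \<le> norm (P n x)" if "m \<le> n" for m n x
    by (rule lift_Suc_mono_le[OF _ that]) (rule le)
  have "Cauchy (\<lambda>n. P n x)" for x
  proof (rule Cauchy_by_increasing_real)
    show "(norm (P n x - P m x))\<^sup>2 \<le> (norm (P n x))\<^sup>2 - (norm (P m x))\<^sup>2" if "m \<le> n" for m n
      using projector_le_diff(2)[OF P P mono[OF that]] by simp
    show "(norm (P n x))\<^sup>2 \<le> (norm x)\<^sup>2" for n by (intro power_mono orth_projector_norm_le P) simp
  qed
  then have "\<exists>y. (\<lambda>n. P n x) \<longlonglongrightarrow> y" for x using Cauchy_convergent convergentD by blast
  then obtain Q where lim: "\<And>x. (\<lambda>n. P n x) \<longlonglongrightarrow> Q x" by metis
  have *: "selfadj (P n)" "norm (P n x) \<le> norm x" for n x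
    using P by (auto simp: orth_projector_selfadj orth_projector_norm_le)
  have "Q (Q x) = Q x" for x
  proof (rule LIMSEQ_unique[OF _ lim])
    show "(\<lambda>n. P n x) \<longlonglongrightarrow> Q (Q x)"
      using strong_limit_compose[OF * lim lim, of x] by (simp add: orth_projector_idem[OF P])
  qed
  then show ?thesis using selfadj_strong_limit(1)[OF * lim] lim by (auto simp: orth_projector_def)
qed

lemma decreasing_projectors_converge:
  fixes P :: "nat \<Rightarrow> 'a::{real_inner,complete_space} \<Rightarrow> 'a"
  assumes P: "\<And>n. orth_projector (P n)" and le: "\<And>n x. norm (P (Suc n) x) \<le> norm (P n x)"
  shows "\<exists>Q. orth_projector Q \<and> (\<forall>x. (\<lambda>n. P n x) \<longlonglongrightarrow> Q x)"
proof -
  have "norm (x - P n x) \<le> norm (x - P (Suc n) x)" for n x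
  proof (rule power2_le_imp_le)
    show "(norm (x - P n x))\<^sup>2 \<le> (norm (x - P (Suc n) x))\<^sup>2"
      using orth_projector_pythagoras[OF P, of x n] orth_projector_pythagoras[OF P, of x "Suc n"]
        power_mono[OF le norm_ge_zero, of n x 2] by linarith
  qed simp
  then obtain Q where Q: "orth_projector Q" "\<And>x. (\<lambda>n. x - P n x) \<longlonglongrightarrow> Q x"
    using increasing_projectors_converge[of "\<lambda>n x. x - P n x"] orth_projector_complement[OF P] by blast
  have "(\<lambda>n. P n x) \<longlonglongrightarrow> x - Q x" for x
    using tendsto_diff[OF tendsto_const[of x] Q(2)[of x]] by simp
  then show ?thesis using orth_projector_complement[OF Q(1)] by blast
qed

lemma orthogonal_projector_add:
  assumes P: "orth_projector P" and Q: "orth_projector Q" and 0: "\<And>x. P (Q x) = 0" "\<And>x. Q (P x) = 0"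
  shows "orth_projector (\<lambda>x. P x + Q x)"
  unfolding orth_projector_def
  using selfadj_add[OF P[THEN orth_projector_selfadj] Q[THEN orth_projector_selfadj]]
  by (simp add: orth_projector_simps[OF P] orth_projector_simps[OF Q] 0)

lemma orthogonal_projectors_sum:
  fixes P :: "nat \<Rightarrow> 'a::{real_inner,complete_space} \<Rightarrow> 'a"
  assumes P: "\<And>n. orth_projector (P n)" and orth: "\<And>i j x. i \<noteq> j \<Longrightarrow> P i (P j x) = 0"
  shows "\<exists>Q. orth_projector Q \<and> (\<forall>x. (\<lambda>n. P n x) sums Q x)"
proof -
  let ?S = "\<lambda>n x. \<Sum>k<n. P k x"
  have 0: "?S n (P m x) = 0" "P m (?S n x) = 0" if "n \<le> m" for n m x
    using that orth by (auto simp: bounded_linear.linear linear_sum[OF bounded_linear.linear]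
        selfadj_bounded_linear[OF orth_projector_selfadj[OF P]] intro!: sum.neutral)
  have S: "orth_projector (?S n)" for n
  proof (induction n)
    case 0 show ?case by (simp add: orth_projector_def selfadj_zero)
  next
    case (Suc n) show ?case
      using orthogonal_projector_add[OF Suc P[of n]] 0[of n n] by simp
  qed
  have "norm (?S n x) \<le> norm (?S (Suc n) x)" for n x
  proof -
    have "?S n (?S (Suc n) x) = ?S n x"
      using selfadj_simps(1)[OF orth_projector_selfadj[OF S[of n]], of "?S n x" "P n x"]
        orth_projector_idem[OF S[of n], of x] 0(1)[of n n x] by simp
    then show ?thesis using orth_projector_norm_le[OF S[of n], of "?S (Suc n) x"] by simp
  qed
  from increasing_projectors_converge[of ?S, OF S this] show ?thesis by (simp add: sums_def)
qed

lemma projectors_orthogonal_if_norms_add: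
  assumes P: "orth_projector P" and Q: "orth_projector Q"
    and le: "\<And>x. (norm (P x))\<^sup>2 + (norm (Q x))\<^sup>2 \<le> (norm x)\<^sup>2"
  shows "Q (P x) = 0"
proof -
  have "(norm (Q (P x)))\<^sup>2 \<le> 0" using le[of "P x"] by (simp add: orth_projector_idem[OF P])
  then show ?thesis by simp
qed

section \<open>From a monotone family of projectors to a projection-valued measure\<close>

lemma projector_eqI:
  assumes P: "orth_projector P" and Q: "orth_projector Q" and eq: "\<And>x. norm (P x) = norm (Q x)"
  shows "P x = Q x"
  using projector_le_absorb(2)[OF P Q, of x] projector_le_absorb(1)[OF Q P, of x] by (simp add: eq)

text \<open>
  The limits are only required along sequences; monotonicity extends them to the filters
  \<open>at_right l\<close>, \<open>at_bot\<close> and \<open>at_top\<close>.  The limit \<open>Q\<close> at \<open>\<infinity>\<close> is a projector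
  and not the identity, so that the family can live on a closed subspace of the ambient space.
\<close>

locale spectral_family =
  fixes E :: "real \<Rightarrow> 'a::{real_inner,complete_space} \<Rightarrow> 'a" and Q :: "'a \<Rightarrow> 'a"
  assumes projector: "orth_projector (E l)"
    and mono: "l \<le> m \<Longrightarrow> norm (E l x) \<le> norm (E m x)"
    and right_cont: "(\<lambda>n. E (l + 1 / real (Suc n)) x) \<longlonglongrightarrow> E l x"
    and at_bot: "(\<lambda>n. E (- real n) x) \<longlonglongrightarrow> 0"
    and at_top: "(\<lambda>n. E (real n) x) \<longlonglongrightarrow> Q x"
    and total: "orth_projector Q"
begin

definition family_measure :: "'a \<Rightarrow> real measure" where
  "family_measure x = interval_measure (\<lambda>l. (norm (E l x))\<^sup>2)"

lemma norm_sq_mono: "l \<le> m \<Longrightarrow> (norm (E l x))\<^sup>2 \<le> (norm (E m x))\<^sup>2"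
  by (intro power_mono mono) auto

lemma norm_sq_right_cont: "continuous (at_right a) (\<lambda>l. (norm (E l x))\<^sup>2)"
  unfolding continuous_within
proof (rule decreasing_tendsto)
  show "\<forall>\<^sub>F l in at_right a. (norm (E a x))\<^sup>2 \<le> (norm (E l x))\<^sup>2"
    by (auto simp: eventually_at_right_field intro!: exI[of _ "a + 1"] mono)
  fix c assume c: "(norm (E a x))\<^sup>2 < c"
  have "(\<lambda>n. (norm (E (a + 1 / real (Suc n)) x))\<^sup>2) \<longlonglongrightarrow> (norm (E a x))\<^sup>2"
    by (intro tendsto_intros right_cont)
  then have "\<forall>\<^sub>F n in sequentially. (norm (E (a + 1 / real (Suc n)) x))\<^sup>2 < c"
    using c by (rule order_tendstoD)
  then obtain n where n: "(norm (E (a + 1 / real (Suc n)) x))\<^sup>2 < c"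
    using eventually_happens'[OF sequentially_bot] by blast
  have "(norm (E l x))\<^sup>2 < c" if "a < l" "l < a + 1 / real (Suc n)" for l
    using norm_sq_mono[of l "a + 1 / real (Suc n)" x] n that by linarith
  then show "\<forall>\<^sub>F l in at_right a. (norm (E l x))\<^sup>2 < c"
    unfolding eventually_at_right_field by (intro exI[of _ "a + 1 / real (Suc n)"]) auto
qed

lemma sets_family_measure [simp, measurable_cong]: "sets (family_measure x) = sets borel"
  and space_family_measure [simp]: "space (family_measure x) = UNIV"
  by (simp_all add: family_measure_def)

lemma emeasure_family_Ioc:
  "a \<le> b \<Longrightarrow> emeasure (family_measure x) {a<..b} = ennreal ((norm (E b x))\<^sup>2 - (norm (E a x))\<^sup>2)"
  unfolding family_measure_def
  by (intro emeasure_interval_measure_Ioc norm_sq_mono norm_sq_right_cont)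

lemma emeasure_family_UNIV: "emeasure (family_measure x) UNIV = ennreal ((norm (Q x))\<^sup>2)"
proof -
  have "(\<lambda>n. emeasure (family_measure x) {- real n<..real n}) \<longlonglongrightarrow>
      emeasure (family_measure x) (\<Union>n. {- real n<..real n})"
    by (rule Lim_emeasure_incseq) (auto simp: incseq_def)
  moreover have "(\<Union>n. {- real n<..real n}) = UNIV"
  proof -
    have "\<exists>n. - real n < t \<and> t \<le> real n" for t
      using reals_Archimedean2[of "\<bar>t\<bar>"] by (metis abs_less_iff less_eq_real_def minus_less_iff)
    then show ?thesis by auto
  qed
  moreover have "(\<lambda>n. emeasure (family_measure x) {- real n<..real n})
      \<longlonglongrightarrow> ennreal ((norm (Q x))\<^sup>2 - (norm (0 :: 'a))\<^sup>2)"
  proof -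
    have "(\<lambda>n. (norm (E (real n) x))\<^sup>2 - (norm (E (- real n) x))\<^sup>2)
        \<longlonglongrightarrow> (norm (Q x))\<^sup>2 - (norm (0 :: 'a))\<^sup>2"
      by (intro tendsto_intros at_bot at_top)
    then show ?thesis by (subst emeasure_family_Ioc) (auto intro!: tendsto_ennrealI)
  qed
  ultimately show ?thesis using LIMSEQ_unique by fastforce
qed

lemma finite_measure_family: "finite_measure (family_measure x)"
  by (rule finite_measureI) (simp add: emeasure_family_UNIV)

lemma measure_family_UNIV: "measure (family_measure x) UNIV = (norm (Q x))\<^sup>2"
  by (simp add: measure_def emeasure_family_UNIV)

lemma commuting_total:
  assumes "bounded_linear T" "\<And>l. commuting T (E l)"
  shows "commuting T Q"
  by (rule strong_limit_commuting[OF assms(1) _ at_top]) (rule assms(2))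

text \<open>
  Projectors that belong to disjoint sets have squared norms adding up to at most \<open>\<parallel>x\<parallel>\<^sup>2\<close>; hence
  they are orthogonal and can be summed.
\<close>

lemma disjoint_projectors_sum:
  assumes A: "\<And>i :: nat. A i \<in> sets borel" and disj: "disjoint_family A"
    and P: "\<And>i. orth_projector (P i)" "\<And>i x. measure (family_measure x) (A i) = (norm (P i x))\<^sup>2"
  shows "\<exists>R. orth_projector R \<and> (\<forall>x. (\<lambda>i. P i x) sums R x) \<and>
    (\<forall>x. measure (family_measure x) (\<Union>i. A i) = (norm (R x))\<^sup>2)"
proof -
  interpret finite_measure "family_measure y" for y by (rule finite_measure_family)
  have orth: "P i (P j x) = 0" if "i \<noteq> j" for i j x
  proof (rule projectors_orthogonal_if_norms_add[OF P(1) P(1)])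
    fix x
    have "(norm (P j x))\<^sup>2 + (norm (P i x))\<^sup>2 = measure (family_measure x) (A j \<union> A i)"
      using disj that A by (subst finite_measure_Union) (auto simp: disjoint_family_on_def P(2))
    also have "\<dots> \<le> measure (family_measure x) UNIV" using A by (intro finite_measure_mono) auto
    also have "\<dots> \<le> (norm x)\<^sup>2"
      unfolding measure_family_UNIV by (intro power_mono orth_projector_norm_le total) simp
    finally show "(norm (P j x))\<^sup>2 + (norm (P i x))\<^sup>2 \<le> (norm x)\<^sup>2" .
  qed
  obtain R where R: "orth_projector R" "\<And>x. (\<lambda>i. P i x) sums R x"
    using orthogonal_projectors_sum[of P, OF P(1) orth] by blast
  have "measure (family_measure x) (\<Union>i. A i) = (norm (R x))\<^sup>2" for x
  proof (rule sums_unique2)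
    show "(\<lambda>i. measure (family_measure x) (A i)) sums measure (family_measure x) (\<Union>i. A i)"
      by (rule finite_measure_UNION) (use A disj in auto)
    have "(\<lambda>i. inner (P i x) x) sums inner (R x) x"
      by (rule bounded_linear.sums[OF bounded_linear_inner_left R(2)])
    then show "(\<lambda>i. measure (family_measure x) (A i)) sums (norm (R x))\<^sup>2"
      by (simp add: P(2) orth_projector_norm_sq P(1) R(1))
  qed
  with R show ?thesis by blast
qed

text \<open>
  The sets that carry a projector form a Dynkin system: half-open intervals carry the differences
  of the family, complements the difference to \<open>Q\<close>, and disjoint unions the orthogonal sum.
  Commutation is part of the induction, so that it passes from the family to all Borel sets.
\<close>

lemma projector_of_borel_exists:
  assumes "B \<in> sets borel"
  shows "\<exists>P. orth_projector P \<and> (\<forall>x. measure (family_measure x) B = (norm (P x))\<^sup>2) \<and>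
    (\<forall>T. bounded_linear T \<longrightarrow> (\<forall>l. commuting T (E l)) \<longrightarrow> commuting T P)"
proof -
  have stable: "Int_stable (range (\<lambda>(a, b). {a<..b::real}))"
    unfolding Int_stable_def by auto
  moreover have "range (\<lambda>(a, b). {a<..b::real}) \<subseteq> Pow UNIV" by simp
  moreover have "B \<in> sigma_sets UNIV (range (\<lambda>(a, b). {a<..b::real}))"
    using assms unfolding borel_sigma_sets_Ioc by simp
  ultimately show ?thesis
  proof (induction rule: sigma_sets_induct_disjoint)
    case (basic A)
    then obtain a b where A: "A = {a<..b}" by auto
    show ?case
    proof (cases "a \<le> b")
      case True
      show ?thesis
      proof (intro exI[of _ "\<lambda>x. E b x - E a x"] conjI allI impI)
        show "orth_projector (\<lambda>x. E b x - E a x)"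
          by (rule projector_le_diff[OF projector projector mono[OF True]])
        show "measure (family_measure x) A = (norm (E b x - E a x))\<^sup>2" for x
          using emeasure_family_Ioc[OF True] norm_sq_mono[OF True]
          by (simp add: A measure_def projector_le_diff(2)[OF projector projector mono[OF True]])
        show "commuting T (\<lambda>x. E b x - E a x)" if "bounded_linear T" "\<forall>l. commuting T (E l)" for T
          using that(2) by (simp add: commuting_def bounded_linear_simps[OF that(1)])
      qed
    next
      case False
      then show ?thesis
        by (intro exI[of _ "\<lambda>x. 0"])
           (auto simp: A orth_projector_def selfadj_zero commuting_def bounded_linear_simps)
    qed
  next
    case empty
    then show ?case
      by (intro exI[of _ "\<lambda>x. 0"])
         (auto simp: orth_projector_def selfadj_zero commuting_def bounded_linear_simps)
  next
    case (compl A)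
    then obtain P where P: "orth_projector P" "\<And>x. measure (family_measure x) A = (norm (P x))\<^sup>2"
      "\<And>T. bounded_linear T \<Longrightarrow> (\<And>l. commuting T (E l)) \<Longrightarrow> commuting T P" by blast
    interpret finite_measure "family_measure y" for y by (rule finite_measure_family)
    have A: "A \<in> sets borel" using compl unfolding borel_sigma_sets_Ioc by simp
    have "(norm (P x))\<^sup>2 \<le> (norm (Q x))\<^sup>2" for x
      using finite_measure_mono[of A UNIV x] A by (simp add: measure_family_UNIV P(2)[symmetric])
    then have le: "norm (P x) \<le> norm (Q x)" for x by (rule power2_le_imp_le) simp
    show ?case
    proof (intro exI[of _ "\<lambda>x. Q x - P x"] conjI allI impI)
      show "orth_projector (\<lambda>x. Q x - P x)" by (rule projector_le_diff[OF P(1) total le])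
      show "measure (family_measure x) (UNIV - A) = (norm (Q x - P x))\<^sup>2" for x
        using finite_measure_compl[of A x] A
        by (simp add: measure_family_UNIV P(2) projector_le_diff(2)[OF P(1) total le])
      show "commuting T (\<lambda>x. Q x - P x)" if "bounded_linear T" "\<forall>l. commuting T (E l)" for T
        using P(3)[of T] commuting_total[of T] that
          by (simp add: commuting_def bounded_linear_simps[OF that(1)])
    qed
  next
    case (union A)
    have A: "A i \<in> sets borel" for i using union(2) unfolding borel_sigma_sets_Ioc by auto
    have "\<forall>i. \<exists>P. orth_projector P \<and> (\<forall>x. measure (family_measure x) (A i) = (norm (P x))\<^sup>2) \<and>
        (\<forall>T. bounded_linear T \<longrightarrow> (\<forall>l. commuting T (E l)) \<longrightarrow> commuting T P)"
      using union(3) by blast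
    then obtain P where P: "\<And>i. orth_projector (P i)"
        "\<And>i x. measure (family_measure x) (A i) = (norm (P i x))\<^sup>2"
        "\<And>i T. bounded_linear T \<Longrightarrow> (\<And>l. commuting T (E l)) \<Longrightarrow> commuting T (P i)"
      by metis
    obtain R where R: "orth_projector R" "\<And>x. (\<lambda>i. P i x) sums R x"
        "\<And>x. measure (family_measure x) (\<Union>i. A i) = (norm (R x))\<^sup>2"
      using disjoint_projectors_sum[of A P, OF A union(1) P(1,2)] by blast
    show ?case
    proof (intro exI[of _ R] conjI allI impI)
      show "orth_projector R" by (rule R)
      show "measure (family_measure x) (\<Union>i. A i) = (norm (R x))\<^sup>2" for x by (rule R)
      show "commuting T R" if "bounded_linear T" "\<forall>l. commuting T (E l)" for T
      proof (rule strong_limit_commuting[OF that(1)])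
        show "(\<lambda>n. (\<Sum>i<n. P i x)) \<longlonglongrightarrow> R x" for x using R(2) by (simp add: sums_def)
        show "commuting T (\<lambda>x. \<Sum>i<n. P i x)" for n
          using P(3)[OF that(1)] that(2)
          by (simp add: commuting_def linear_sum[OF bounded_linear.linear[OF that(1)]])
      qed
    qed
  qed
qed

definition family_pvm :: "real set \<Rightarrow> 'a \<Rightarrow> 'a" where
  "family_pvm B = (SOME P. orth_projector P \<and> (\<forall>x. measure (family_measure x) B = (norm (P x))\<^sup>2) \<and>
    (\<forall>T. bounded_linear T \<longrightarrow> (\<forall>l. commuting T (E l)) \<longrightarrow> commuting T P))"

lemma
  assumes "B \<in> sets borel"
  shows projector_pvm: "orth_projector (family_pvm B)"
    and norm_pvm: "(norm (family_pvm B x))\<^sup>2 = measure (family_measure x) B"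
    and commuting_pvm: "bounded_linear T \<Longrightarrow> (\<And>l. commuting T (E l)) \<Longrightarrow> commuting T (family_pvm B)"
  using someI_ex[OF projector_of_borel_exists[OF assms]] unfolding family_pvm_def[symmetric]
  by auto

lemma pvm_eqI:
  assumes "B \<in> sets borel" "orth_projector P" "\<And>x. (norm (P x))\<^sup>2 = measure (family_measure x) B"
  shows "family_pvm B x = P x"
  by (rule projector_eqI[OF projector_pvm[OF assms(1)] assms(2)])
     (metis assms(1,3) norm_pvm norm_ge_zero power2_eq_imp_eq)

lemma pvm_Ioc:
  assumes "a \<le> b"
  shows "family_pvm {a<..b} x = E b x - E a x"
  using emeasure_family_Ioc[OF assms] norm_sq_mono[OF assms]
  by (intro pvm_eqI projector_le_diff[OF projector projector mono[OF assms]])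
     (simp_all add: measure_def projector_le_diff(2)[OF projector projector mono[OF assms]])

lemma pvm_UNIV: "family_pvm UNIV x = Q x"
  by (rule pvm_eqI) (simp_all add: total measure_family_UNIV)

lemma pvm_sums:
  assumes A: "range A \<subseteq> sets borel" and disj: "disjoint_family A"
  shows "(\<lambda>n. family_pvm (A n) x) sums family_pvm (\<Union>n. A n) x"
proof -
  have An: "A i \<in> sets borel" for i using A by auto
  obtain R where R: "orth_projector R" "\<And>x. (\<lambda>i. family_pvm (A i) x) sums R x"
      "\<And>x. measure (family_measure x) (\<Union>i. A i) = (norm (R x))\<^sup>2"
    using disjoint_projectors_sum[of A "\<lambda>i. family_pvm (A i)", OF An disj projector_pvm[OF An]
        norm_pvm[OF An, symmetric]] by blast
  have eq: "family_pvm (\<Union>n. A n) x = R x"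
    by (rule pvm_eqI[OF sets.countable_UN[OF A] R(1) R(3)[symmetric]])
  show ?thesis unfolding eq by (rule R(2))
qed

end

section \<open>Complex Hilbert spaces\<close>

lemma scaleC_one [simp]: "1 *\<^sub>C x = (x :: 'a::complex_inner)"
  using scaleC_of_real[of 1 x] by simp

lemma scaleC_zero_left [simp]: "0 *\<^sub>C x = (0 :: 'a::complex_inner)"
  using scaleC_of_real[of 0 x] by simp

lemma scaleC_minus_one [simp]: "(-1) *\<^sub>C x = - (x :: 'a::complex_inner)"
  using scaleC_of_real[of "-1" x] by simp

lemma scaleC_zero_right [simp]: "c *\<^sub>C (0 :: 'a::complex_inner) = 0"
  using scaleC_add_right[of c 0 0] by simp

lemma scaleC_minus_right: "c *\<^sub>C (- x) = - (c *\<^sub>C (x :: 'a::complex_inner))"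
  using scaleC_add_right[of c x "- x"] by (simp add: eq_neg_iff_add_eq_0 add.commute)

lemma scaleC_diff_right: "c *\<^sub>C (x - y) = c *\<^sub>C x - c *\<^sub>C (y :: 'a::complex_inner)"
  using scaleC_add_right[of c x "- y"] by (simp add: scaleC_minus_right)

lemma scaleC_scaleR: "c *\<^sub>C (r *\<^sub>R x) = r *\<^sub>R (c *\<^sub>C (x :: 'a::complex_inner))"
  by (simp add: scaleC_scaleC mult.commute flip: scaleC_of_real)

lemma cinner_scaleC_right: "cinner x (c *\<^sub>C y) = cnj c * cinner x (y :: 'a::complex_inner)"
  by (metis cinner_commute cinner_scaleC_left complex_cnj_mult)

lemma cinner_add_right: "cinner x (y + z) = cinner x y + cinner x (z :: 'a::complex_inner)"
  by (metis cinner_commute cinner_add_left complex_cnj_add)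

lemma cinner_diff_left: "cinner (x - y) z = cinner x z - cinner y (z :: 'a::complex_inner)"
  using cinner_add_left[of "x - y" y z] by simp

lemma cinner_diff_right: "cinner z (x - y) = cinner z x - cinner z (y :: 'a::complex_inner)"
  using cinner_add_right[of z "x - y" y] by simp

lemma cinner_zero_left [simp]: "cinner 0 (x :: 'a::complex_inner) = 0"
  using cinner_diff_left[of 0 0 x] by simp

lemma cinner_zero_right [simp]: "cinner (x :: 'a::complex_inner) 0 = 0"
  using cinner_diff_right[of x 0 0] by simp

lemma cinner_eq_Complex: "cinner x y = Complex (inner x y) (inner x (\<i> *\<^sub>C (y :: 'a::complex_inner)))"
  by (rule complex_eqI) (simp_all add: cinner_scaleC_right flip: Re_cinner)

lemma cinner_self: "cinner x x = complex_of_real ((norm (x :: 'a::complex_inner))\<^sup>2)"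
proof (rule complex_eqI)
  show "Im (cinner x x) = Im (complex_of_real ((norm x)\<^sup>2))"
    using arg_cong[OF cinner_commute[of x x], of Im] by simp
qed (simp add: Re_cinner power2_norm_eq_inner)

lemma norm_scaleC: "norm (c *\<^sub>C x) = cmod c * norm (x :: 'a::complex_inner)"
proof (rule power2_eq_imp_eq)
  have "cinner (c *\<^sub>C x) (c *\<^sub>C x) = complex_of_real ((cmod c * norm x)\<^sup>2)"
    by (simp only: cinner_scaleC_left cinner_scaleC_right cinner_self[of x] power_mult_distrib
        of_real_mult complex_norm_square[of c] mult_ac)
  then have "complex_of_real ((norm (c *\<^sub>C x))\<^sup>2) = complex_of_real ((cmod c * norm x)\<^sup>2)"
    by (simp only: cinner_self)
  then show "(norm (c *\<^sub>C x))\<^sup>2 = (cmod c * norm x)\<^sup>2" by (simp only: of_real_eq_iff)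
qed auto

lemma bounded_linear_scaleC: "bounded_linear (\<lambda>x :: 'a::complex_inner. c *\<^sub>C x)"
  by (rule bounded_linear_intro[of _ "cmod c"])
     (simp_all add: scaleC_add_right scaleC_scaleR norm_scaleC mult.commute)

lemma inner_scaleC_i: "inner (\<i> *\<^sub>C x) y = - inner x (\<i> *\<^sub>C (y :: 'a::complex_inner))"
  by (simp add: cinner_scaleC_left cinner_scaleC_right flip: Re_cinner)

lemma csubspace_imp_subspace: "csubspace V \<Longrightarrow> subspace V"
  unfolding csubspace_def subspace_def by (metis scaleC_of_real)

lemma csubspaceD:
  assumes "csubspace V"
  shows "0 \<in> V" "x \<in> V \<Longrightarrow> y \<in> V \<Longrightarrow> x + y \<in> V" "x \<in> V \<Longrightarrow> c *\<^sub>C x \<in> V"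
    "x \<in> V \<Longrightarrow> y \<in> V \<Longrightarrow> x - y \<in> V" "x \<in> V \<Longrightarrow> r *\<^sub>R x \<in> V" "x \<in> V \<Longrightarrow> - x \<in> V"
  using assms csubspace_imp_subspace[OF assms]
  by (auto simp: csubspace_def intro: subspace_diff subspace_scale subspace_neg)

lemma csubspace_closed_cspan: "csubspace (closed_cspan S)"
  and closed_closed_cspan: "closed (closed_cspan S)"
  and closed_cspan_superset: "S \<subseteq> closed_cspan S"
proof -
  have "csubspace (closed_cspan S) \<and> closed (closed_cspan S)"
    unfolding closed_cspan_def by (rule hull_in) (auto simp: csubspace_def)
  then show "csubspace (closed_cspan S)" "closed (closed_cspan S)" by auto
  show "S \<subseteq> closed_cspan S" unfolding closed_cspan_def by (rule hull_subset)
qed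

lemma closed_cspan_minimal: "S \<subseteq> V \<Longrightarrow> csubspace V \<Longrightarrow> closed V \<Longrightarrow> closed_cspan S \<subseteq> V"
  unfolding closed_cspan_def by (rule hull_minimal) auto

lemma orth_proj_scaleC_commuting:
  fixes V :: "'a::chilbert_space set"
  assumes V: "csubspace V" "closed V"
  shows "commuting (\<lambda>x. c *\<^sub>C x) (orth_proj V)"
  unfolding commuting_def
proof
  fix x
  note V' = csubspace_imp_subspace[OF V(1)] V(2)
  have "inner (c *\<^sub>C x - c *\<^sub>C orth_proj V x) s = 0" if "s \<in> V" for s
  proof -
    have "inner (c *\<^sub>C x - c *\<^sub>C orth_proj V x) s = inner (x - orth_proj V x) (cnj c *\<^sub>C s)"
      by (simp add: cinner_scaleC_left cinner_scaleC_right flip: Re_cinner scaleC_diff_right)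
    then show ?thesis using orth_proj_orthogonal[OF V' csubspaceD(3)[OF V(1) that]] by simp
  qed
  from orth_proj_unique[OF V' csubspaceD(3)[OF V(1) orth_proj_in[OF V']] this]
  show "c *\<^sub>C orth_proj V x = orth_proj V (c *\<^sub>C x)" by simp
qed

text \<open>
  A complex operator is self-adjoint as soon as it is symmetric for the real inner product and
  commutes with \<open>\<i>\<close>; real operator theory thus suffices for constructing the projections.
\<close>

lemma selfadj_cinner:
  fixes T :: "'a::complex_inner \<Rightarrow> 'a"
  assumes T: "selfadj T" and i: "commuting (\<lambda>x. \<i> *\<^sub>C x) T"
  shows "cinner (T x) y = cinner x (T y)"
  using selfadj_inner[OF T, of x y] selfadj_inner[OF T, of x "\<i> *\<^sub>C y"] i
  by (simp add: cinner_eq_Complex commuting_def)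

lemma positive_zero_form:
  assumes T: "positive_op T" and 0: "inner (T x) x = 0"
  shows "T x = 0"
proof -
  note lin = selfadj_simps[OF positive_op_selfadj[OF T]]
  define a where "a = inner (T x) (T x)"
  define c where "c = inner (T (T x)) (T x)"
  \<comment> \<open>Positivity of the form at \<open>x - s T x\<close>; the term that is linear in \<open>s\<close> must vanish.\<close>
  have quad: "0 \<le> s * (s * c) - 2 * s * a" for s
  proof -
    have "0 \<le> inner (T (x - s *\<^sub>R T x)) (x - s *\<^sub>R T x)" using positive_opD[OF T] .
    also have "\<dots> = s * (s * c) - 2 * s * a"
      using 0 selfadj_inner[OF positive_op_selfadj[OF T], of "T x" x]
      by (simp add: lin a_def c_def inner_diff_left inner_diff_right algebra_simps)
    finally show ?thesis .
  qed
  have c: "0 \<le> c" unfolding c_def using positive_opD[OF T] .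
  have "a = 0"
  proof (cases "c = 0")
    case True
    then have "a \<le> 0" using quad[of 1] by simp
    moreover have "0 \<le> a" unfolding a_def by (rule inner_ge_zero)
    ultimately show ?thesis by simp
  next
    case False
    then have "0 \<le> - (a * a / c)" using quad[of "a / c"] c by (simp add: field_simps)
    then show ?thesis using c False by (simp add: divide_le_0_iff)
       (metis mult_le_0_iff order_antisym_conv linorder_le_cases)
  qed
  then show ?thesis by (simp add: a_def)
qed

section \<open>The spectral family of an unbounded self-adjoint operator\<close>

locale selfadjoint_operator =
  fixes M :: "'a::chilbert_space opstruct"
  assumes sa: "selfadjoint_structure M"
begin

abbreviation "V \<equiv> hspace M"

abbreviation "G \<equiv> ograph M"

lemma csubspace_V: "csubspace V" and closed_V: "closed V" and closed_G: "closed G"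
  using sa by (auto simp: selfadjoint_structure_def)

lemmas subspace_V = csubspace_imp_subspace[OF csubspace_V]

lemma G_in: "(x, y) \<in> G \<Longrightarrow> x \<in> V" "(x, y) \<in> G \<Longrightarrow> y \<in> V"
  using sa by (auto simp: selfadjoint_structure_def self_adjoint_def linear_operator_def)

lemma G_unique: "(x, y) \<in> G \<Longrightarrow> (x, z) \<in> G \<Longrightarrow> y = z"
  using sa by (auto simp: selfadjoint_structure_def self_adjoint_def linear_operator_def single_valued_def)

lemma oapp_eq: "(x, y) \<in> G \<Longrightarrow> oapp M x = y"
  unfolding oapp_def using G_unique by blast

lemma odomI: "(x, y) \<in> G \<Longrightarrow> x \<in> odom M"
  unfolding odom_def by force

lemma oapp_in: "x \<in> odom M \<Longrightarrow> (x, oapp M x) \<in> G"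
  unfolding odom_def using oapp_eq by force

lemma odom_subset: "odom M \<subseteq> V"
  using oapp_in G_in by blast

lemma csubspace_odom: "csubspace (odom M)" and clinear_oapp: "clinear_on (odom M) (oapp M)"
  using sa by (auto simp: selfadjoint_structure_def self_adjoint_def linear_operator_def)

lemma G_add: "(x, y) \<in> G \<Longrightarrow> (x', y') \<in> G \<Longrightarrow> (x + x', y + y') \<in> G"
  using csubspace_odom clinear_oapp oapp_in[of "x + x'"]
  by (simp add: clinear_on_def csubspaceD odomI oapp_eq)

lemma G_scaleC: "(x, y) \<in> G \<Longrightarrow> (c *\<^sub>C x, c *\<^sub>C y) \<in> G"
  using csubspace_odom clinear_oapp oapp_in[of "c *\<^sub>C x"]
  by (simp add: clinear_on_def csubspaceD odomI oapp_eq)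

lemma G_scaleR: "(x, y) \<in> G \<Longrightarrow> (r *\<^sub>R x, r *\<^sub>R y) \<in> G"
  using G_scaleC[of x y "complex_of_real r"] by (simp add: scaleC_of_real)

lemma G_diff: "(x, y) \<in> G \<Longrightarrow> (x', y') \<in> G \<Longrightarrow> (x - x', y - y') \<in> G"
  using G_add[of x y "- x'" "- y'"] G_scaleR[of x' y' "-1"] by simp

lemma G_zero: "(0, 0) \<in> G"
  using oapp_in[OF csubspaceD(1)[OF csubspace_odom]] G_scaleR[of 0 "oapp M 0" 0] by simp

lemma subspace_G: "subspace G"
  unfolding subspace_def using G_zero G_add G_scaleR by (auto simp: zero_prod_def)

lemma csymmetric: "(x, y) \<in> G \<Longrightarrow> (v, w) \<in> G \<Longrightarrow> cinner y v = cinner x w"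
proof -
  assume xy: "(x, y) \<in> G" and vw: "(v, w) \<in> G"
  have "(v, w) \<in> adjoint_graph M"
    using vw sa by (simp add: selfadjoint_structure_def self_adjoint_def)
  then show ?thesis using odomI[OF xy] oapp_eq[OF xy] by (auto simp: adjoint_graph_def)
qed

lemma symmetric: "(x, y) \<in> G \<Longrightarrow> (v, w) \<in> G \<Longrightarrow> inner y v = inner x w"
  using csymmetric by (simp flip: Re_cinner)

text \<open>
  Self-adjointness in terms of the graph.  Testing with the real inner product is enough because
  the graph is closed under multiplication by \<open>\<i>\<close>.
\<close>

lemma G_maximal:
  assumes "x \<in> V" "y \<in> V" and eq: "\<And>v w. (v, w) \<in> G \<Longrightarrow> inner w x = inner v y"
  shows "(x, y) \<in> G"
proof -
  have "cinner (oapp M v) x = cinner v y" if "v \<in> odom M" for v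
    using eq[OF oapp_in[OF that]] eq[OF G_scaleC[OF oapp_in[OF that], of \<i>]]
    by (simp add: cinner_eq_Complex inner_scaleC_i)
  then have "(x, y) \<in> adjoint_graph M" using assms by (simp add: adjoint_graph_def)
  then show ?thesis using sa by (simp add: selfadjoint_structure_def self_adjoint_def)
qed

lemma dense: "V \<subseteq> closure (odom M)"
  using sa by (simp add: selfadjoint_structure_def self_adjoint_def densely_defined_def)

text \<open>
  The orthogonal projection of \<open>(x, 0)\<close> onto the graph of \<open>Q\<close> is \<open>((1 + Q\<^sup>2)\<^sup>-\<^sup>1 x, Q (1 + Q\<^sup>2)\<^sup>-\<^sup>1 x)\<close>;
  this gives both bounded operators on the whole ambient space without inverting anything.
  They vanish on the orthogonal complement of \<open>V\<close>.
\<close>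

definition smooth :: "'a \<Rightarrow> 'a" where
  "smooth x = fst (orth_proj G (x, 0))"

definition op_smooth :: "'a \<Rightarrow> 'a" where
  "op_smooth x = snd (orth_proj G (x, 0))"

definition proj_V :: "'a \<Rightarrow> 'a" where
  "proj_V = orth_proj V"

lemma projector_V: "orth_projector proj_V"
  unfolding proj_V_def by (rule orth_projector_orth_proj[OF subspace_V closed_V])

lemma proj_V_in: "proj_V x \<in> V"
  unfolding proj_V_def by (rule orth_proj_in[OF subspace_V closed_V])

lemma proj_V_eq_iff: "proj_V x = x \<longleftrightarrow> x \<in> V"
  unfolding proj_V_def by (rule orth_proj_eq_iff[OF subspace_V closed_V])

lemma proj_V_id: "x \<in> V \<Longrightarrow> proj_V x = x"
  by (simp add: proj_V_eq_iff)

lemma smooth_G: "(smooth x, op_smooth x) \<in> G"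
  unfolding smooth_def op_smooth_def using orth_proj_in[OF subspace_G closed_G, of "(x, 0)"] by simp

lemma smooth_in: "smooth x \<in> V" and op_smooth_in: "op_smooth x \<in> V"
  using smooth_G G_in by blast+

lemma bounded_linear_smooth: "bounded_linear smooth"
    and bounded_linear_op_smooth: "bounded_linear op_smooth"
proof -
  have P: "bounded_linear (\<lambda>x :: 'a. orth_proj G (x, 0))"
    using bounded_linear_compose[OF selfadj_bounded_linear[OF orth_projector_selfadj[OF
            orth_projector_orth_proj[OF subspace_G closed_G]]]
          bounded_linear_Pair[OF bounded_linear_ident bounded_linear_zero]] .
  show "bounded_linear smooth" unfolding smooth_def[abs_def]
    by (rule bounded_linear_compose[OF bounded_linear_fst P])
  show "bounded_linear op_smooth" unfolding op_smooth_def[abs_def]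
    by (rule bounded_linear_compose[OF bounded_linear_snd P])
qed

lemmas smooth_lin = bounded_linear_simps[OF bounded_linear_smooth]
lemmas op_smooth_lin = bounded_linear_simps[OF bounded_linear_op_smooth]

text \<open>
  The pair \<open>(z, Q z)\<close> is the projection of \<open>(x, 0)\<close> iff \<open>Q (Q z) = x - z\<close>, since the orthogonal
  complement of the graph consists of the pairs \<open>(Q w, - w)\<close>.
\<close>

lemma smooth_unique:
  assumes "(z, w) \<in> G" "(w, x - z) \<in> G"
  shows "smooth x = z" "op_smooth x = w"
proof -
  have "orth_proj G (x, 0) = (z, w)"
  proof (rule orth_proj_unique[OF subspace_G closed_G assms(1)])
    fix s assume "s \<in> G"
    then show "inner ((x, 0) - (z, w)) s = 0"
      using symmetric[OF assms(2), of "fst s" "snd s"] by (cases s) (simp add: inner_prod_def)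
  qed
  then show "smooth x = z" "op_smooth x = w" by (simp_all add: smooth_def op_smooth_def)
qed

lemma smooth_proj_V: "smooth (proj_V x) = smooth x" "op_smooth (proj_V x) = op_smooth x"
proof -
  have "orth_proj G (x - proj_V x, 0) = 0"
  proof (rule orth_proj_unique[OF subspace_G closed_G])
    show "0 \<in> G" using G_zero by (simp add: zero_prod_def)
    fix s assume "s \<in> G"
    then have "fst s \<in> V" using G_in(1)[of "fst s" "snd s"] by simp
    then show "inner ((x - proj_V x, 0) - 0) s = 0"
      using orth_proj_orthogonal[OF subspace_V closed_V, of "fst s" x]
      by (cases s) (simp add: inner_prod_def proj_V_def)
  qed
  then have "smooth (x - proj_V x) = 0" "op_smooth (x - proj_V x) = 0"
    by (simp_all add: smooth_def op_smooth_def)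
  then show "smooth (proj_V x) = smooth x" "op_smooth (proj_V x) = op_smooth x"
    by (simp_all add: smooth_lin op_smooth_lin)
qed

text \<open>
  The residual \<open>(x - A x, - Q A x)\<close> is orthogonal to the graph, which says that \<open>Q A x\<close> is in the
  domain of the adjoint of \<open>Q\<close>, with value \<open>x - A x\<close>.
\<close>

lemma op_smooth_G: 
  assumes "x \<in> V"
  shows "(op_smooth x, x - smooth x) \<in> G"
proof (rule G_maximal)
  show "op_smooth x \<in> V" "x - smooth x \<in> V"
    using assms smooth_in op_smooth_in csubspaceD(4)[OF csubspace_V] by auto
  fix v w assume "(v, w) \<in> G"
  from orth_proj_orthogonal[OF subspace_G closed_G this, of "(x, 0)"]
  have "inner (x - smooth x) v - inner (op_smooth x) w = 0"
    by (cases "orth_proj G (x, 0)") (simp add: smooth_def op_smooth_def inner_prod_def)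
  then show "inner w (op_smooth x) = inner v (x - smooth x)" by (simp add: inner_commute)
qed

lemma smooth_form: "inner (smooth x) x = (norm (smooth x))\<^sup>2 + (norm (op_smooth x))\<^sup>2"
proof -
  note P = orth_projector_orth_proj[OF subspace_G closed_G]
  show ?thesis using orth_projector_norm_sq[OF P, of "(x, 0)"]
    by (cases "orth_proj G (x, 0)") (simp add: smooth_def op_smooth_def inner_prod_def norm_prod_def)
qed

lemma positive_smooth: "positive_op smooth"
proof -
  note P = orth_projector_selfadj[OF orth_projector_orth_proj[OF subspace_G closed_G]]
  have "inner (smooth x) y = inner x (smooth y)" for x y
    using selfadj_inner[OF P, of "(x, 0)" "(y, 0)"]
    by (cases "orth_proj G (x, 0)", cases "orth_proj G (y, 0)") (simp add: smooth_def inner_prod_def)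
  then show ?thesis
    by (simp add: positive_op_def selfadj_def bounded_linear_smooth smooth_form)
qed

lemma selfadj_smooth: "selfadj smooth"
  by (rule positive_op_selfadj[OF positive_smooth])

lemma selfadj_op_smooth: "selfadj op_smooth"
proof -
  have V: "inner (op_smooth x) y = inner x (op_smooth y)" if "x \<in> V" "y \<in> V" for x y
    using symmetric[OF op_smooth_G[OF that(1)] smooth_G[of y]]
      symmetric[OF smooth_G[of x] op_smooth_G[OF that(2)]]
      symmetric[OF op_smooth_G[OF that(1)] op_smooth_G[OF that(2)]]
      symmetric[OF smooth_G[of x] smooth_G[of y]]
    by (simp add: inner_diff_left inner_diff_right)
  have "inner (op_smooth x) y = inner x (op_smooth y)" for x y
  proof -
    have "inner (op_smooth x) y = inner (proj_V (op_smooth x)) y" by (simp add: proj_V_id op_smooth_in)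
    also have "\<dots> = inner (op_smooth (proj_V x)) (proj_V y)"
      using selfadj_inner[OF orth_projector_selfadj[OF projector_V]] by (simp add: smooth_proj_V)
    also have "\<dots> = inner (proj_V x) (op_smooth (proj_V y))" by (rule V[OF proj_V_in proj_V_in])
    also have "\<dots> = inner (proj_V x) (op_smooth y)" by (simp add: smooth_proj_V)
    also have "\<dots> = inner x (proj_V (op_smooth y))"
      by (rule selfadj_inner[OF orth_projector_selfadj[OF projector_V]])
    finally show ?thesis by (simp add: proj_V_id op_smooth_in)
  qed
  then show ?thesis by (simp add: selfadj_def bounded_linear_op_smooth)
qed

lemma smooth_injective:
  assumes "x \<in> V" "smooth x = 0"
  shows "x = 0"
proof -
  have "op_smooth x = 0" using smooth_G[of x] assms(2) G_unique[OF _ G_zero] by simp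
  then show ?thesis using op_smooth_G[OF assms(1)] assms(2) G_unique[OF _ G_zero] by simp
qed

lemma smooth_form_zero:
  assumes "x \<in> V" "inner (smooth x) x \<le> 0"
  shows "x = 0"
proof -
  have "(norm (smooth x))\<^sup>2 \<le> 0"
    using smooth_form[of x] assms(2) zero_le_power2[of "norm (op_smooth x)"] by linarith
  then show ?thesis using smooth_injective[OF assms(1)] by simp
qed

text \<open>
  The graph of \<open>Q\<close> is recovered from the two bounded operators.  Commutation with \<open>Q\<close>, where domains
  would have to be tracked, can therefore be replaced by commutation with these.
\<close>

lemma G_iff: "(x, y) \<in> G \<longleftrightarrow> x \<in> V \<and> y \<in> V \<and> smooth y = op_smooth x \<and> op_smooth y = x - smooth x"
proof
  assume xy: "(x, y) \<in> G"
  then have V: "x \<in> V" "y \<in> V" using G_in by auto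
  have "smooth y = op_smooth x" "op_smooth y = x - smooth x"
    using smooth_unique[OF op_smooth_G[OF V(1)], of y] G_diff[OF xy smooth_G[of x]] by auto
  with V show "x \<in> V \<and> y \<in> V \<and> smooth y = op_smooth x \<and> op_smooth y = x - smooth x" by simp
next
  assume *: "x \<in> V \<and> y \<in> V \<and> smooth y = op_smooth x \<and> op_smooth y = x - smooth x"
  then have "(x - smooth x, y - op_smooth x) \<in> G" using op_smooth_G[of y] by simp
  from G_add[OF this smooth_G[of x]] show "(x, y) \<in> G" by simp
qed

lemma smooth_op_smooth: "smooth (op_smooth x) = op_smooth (smooth x)"
  using smooth_G[of x] unfolding G_iff by simp

lemma commuting_smooth_op_smooth: "commuting smooth op_smooth"
  by (simp add: commuting_def smooth_op_smooth)

lemma G_invariant: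
  assumes T: "bounded_linear T" "\<And>x. x \<in> V \<Longrightarrow> T x \<in> V"
    and com: "commuting T smooth" "commuting T op_smooth" and xy: "(x, y) \<in> G"
  shows "(T x, T y) \<in> G"
  using xy unfolding G_iff
  by (auto simp: T(2) commutingD[OF com(1), symmetric] commutingD[OF com(2), symmetric] bounded_linear_simps[OF T(1)])

lemma commuting_if_G_invariant:
  assumes T: "bounded_linear T" "\<And>x. T x = T (proj_V x)" and inv: "\<And>x y. (x, y) \<in> G \<Longrightarrow> (T x, T y) \<in> G"
  shows "commuting T smooth" "commuting T op_smooth"
proof -
  have *: "smooth (T x) = T (smooth x) \<and> op_smooth (T x) = T (op_smooth x)" for x
  proof -
    have "(T (op_smooth x), T x - T (smooth x)) \<in> G"
      using inv[OF op_smooth_G[OF proj_V_in[of x]]]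
      by (simp add: smooth_proj_V bounded_linear_simps[OF T(1)] flip: T(2))
    from smooth_unique[OF inv[OF smooth_G] this] show ?thesis by simp
  qed
  then show "commuting T smooth" "commuting T op_smooth" by (simp_all add: commuting_def)
qed

lemma commuting_scaleC_smooth: "commuting (\<lambda>x. c *\<^sub>C x) smooth" "commuting (\<lambda>x. c *\<^sub>C x) op_smooth"
proof -
  have *: "smooth (c *\<^sub>C x) = c *\<^sub>C smooth x \<and> op_smooth (c *\<^sub>C x) = c *\<^sub>C op_smooth x" if "x \<in> V" for x
    using smooth_unique[OF G_scaleC[OF smooth_G[of x], of c], of "c *\<^sub>C x"]
      G_scaleC[OF op_smooth_G[OF that], of c] by (simp add: scaleC_diff_right)
  have "proj_V (c *\<^sub>C x) = c *\<^sub>C proj_V x" for x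
    using orth_proj_scaleC_commuting[OF csubspace_V closed_V, of c]
      by (simp add: proj_V_def commuting_def)
  then have "smooth (c *\<^sub>C x) = c *\<^sub>C smooth x \<and> op_smooth (c *\<^sub>C x) = c *\<^sub>C op_smooth x" for x
    using *[OF proj_V_in[of x]] smooth_proj_V[of "c *\<^sub>C x"] smooth_proj_V[of x] by simp
  then show "commuting (\<lambda>x. c *\<^sub>C x) smooth" "commuting (\<lambda>x. c *\<^sub>C x) op_smooth"
    by (simp_all add: commuting_def)
qed

end

lemma subspace_closure_normed:
  fixes S :: "'a::real_normed_vector set"
  assumes S: "subspace S"
  shows "subspace (closure S)"
proof -
  have "x + y \<in> closure S" if "x \<in> closure S" "y \<in> closure S" for x y
  proof -
    obtain f g where "\<And>n. f n \<in> S" "f \<longlonglongrightarrow> x" "\<And>n. g n \<in> S" "g \<longlonglongrightarrow> y"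
      using \<open>x \<in> closure S\<close> \<open>y \<in> closure S\<close> unfolding closure_sequential by blast
    then show ?thesis unfolding closure_sequential
      by (intro exI[of _ "\<lambda>n. f n + g n"]) (auto intro!: tendsto_add subspace_add[OF S])
  qed
  moreover have "c *\<^sub>R x \<in> closure S" if x: "x \<in> closure S" for c x
  proof -
    obtain f where "\<And>n. f n \<in> S" "f \<longlonglongrightarrow> x"
      using x unfolding closure_sequential by blast
    then show ?thesis unfolding closure_sequential
      by (intro exI[of _ "\<lambda>n. c *\<^sub>R f n"]) (auto intro!: tendsto_scaleR subspace_scale[OF S])
  qed
  moreover have "0 \<in> closure S" using subspace_0[OF S] closure_subset by blast
  ultimately show ?thesis by (simp add: subspace_def)
qed

context selfadjoint_operator
begin

text \<open>The bounded operator \<open>(Q - l) (1 + Q\<^sup>2)\<^sup>-\<^sup>1\<close> has the same sign as \<open>Q - l\<close>.\<close>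

definition shifted :: "real \<Rightarrow> 'a \<Rightarrow> 'a" where
  "shifted l x = op_smooth x - l *\<^sub>R smooth x"

definition upper_proj :: "real \<Rightarrow> 'a \<Rightarrow> 'a" where
  "upper_proj l = positive_part_projector (shifted l)"

text \<open>
  Subtracting from \<open>proj_V\<close> and not from the identity removes the complement of \<open>V\<close>, where
  \<open>shifted l\<close> vanishes for every \<open>l\<close>; otherwise the limit at \<open>-\<infinity>\<close> would not be 0.
\<close>

definition spectral_proj :: "real \<Rightarrow> 'a \<Rightarrow> 'a" where
  "spectral_proj l x = proj_V x - upper_proj l x"

lemma selfadj_shifted: "selfadj (shifted l)"
  unfolding shifted_def[abs_def]
  using selfadj_linear_combination[OF selfadj_op_smooth selfadj_smooth, of 1 "- l"] by simp

lemma shifted_proj_V: "shifted l (proj_V x) = shifted l x"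
  by (simp add: shifted_def smooth_proj_V)

lemma shifted_diff: "inner (shifted l x) x - inner (shifted m x) x = (m - l) * inner (smooth x) x"
  by (simp add: shifted_def inner_diff_left algebra_simps)

lemma commuting_shifted:
  assumes "bounded_linear T" "commuting T smooth" "commuting T op_smooth"
  shows "commuting T (shifted l)"
  using assms(2,3) by (simp add: commuting_def shifted_def bounded_linear_simps[OF assms(1)])

lemmas projector_upper = orth_projector_positive_part[OF selfadj_shifted, folded upper_proj_def]
lemmas upper_nonneg = positive_part_nonneg[OF selfadj_shifted, folded upper_proj_def]
lemmas upper_complement_nonpos
    = positive_part_complement_nonpos[OF selfadj_shifted, folded upper_proj_def]
lemmas upper_kernel = positive_part_kernel[OF selfadj_shifted, folded upper_proj_def]
lemmas upper_commuting_shifted = positive_part_commuting[OF selfadj_shifted, folded upper_proj_def]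

lemma commuting_upper:
  assumes "bounded_linear T" "commuting T smooth" "commuting T op_smooth"
  shows "commuting T (upper_proj l)"
  by (rule upper_commuting_shifted[OF assms(1) commuting_shifted[OF assms]])

lemma upper_proj_V: "upper_proj l (proj_V x) = upper_proj l x"
    "proj_V (upper_proj l x) = upper_proj l x"
proof -
  have *: "upper_proj l (proj_V x) = upper_proj l x" for x
  proof -
    have "upper_proj l (x - proj_V x) = 0"
      by (rule upper_kernel) (simp add: selfadj_simps[OF selfadj_shifted] shifted_proj_V)
    then show ?thesis by (simp add: orth_projector_simps[OF projector_upper])
  qed
  then show "upper_proj l (proj_V x) = upper_proj l x" .
  have "norm (upper_proj l x) \<le> norm (proj_V x)" for x
    using orth_projector_norm_le[OF projector_upper, of l "proj_V x"] * by simp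
  from projector_le_absorb(1)[OF projector_upper projector_V this]
  show "proj_V (upper_proj l x) = upper_proj l x" .
qed

lemma projector_spectral: "orth_projector (spectral_proj l)"
proof -
  have "norm (upper_proj l x) \<le> norm (proj_V x)" for x
    using orth_projector_norm_le[OF projector_upper, of l "proj_V x"] by (simp add: upper_proj_V)
  from projector_le_diff(1)[OF projector_upper projector_V this] show ?thesis
    by (simp add: spectral_proj_def[abs_def])
qed

lemma spectral_proj_V: "spectral_proj l (proj_V x) = spectral_proj l x"
    "proj_V (spectral_proj l x) = spectral_proj l x"
  by (simp_all add: spectral_proj_def upper_proj_V orth_projector_simps[OF projector_V])

lemma spectral_in: "spectral_proj l x \<in> V"
  using spectral_proj_V(2) proj_V_eq_iff by blast

lemma commuting_spectral:
  assumes "bounded_linear T" "commuting T smooth" "commuting T op_smooth" "commuting T proj_V"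
  shows "commuting T (spectral_proj l)"
  using commuting_upper[OF assms(1-3), of l] assms(4)
  by (simp add: commuting_def spectral_proj_def bounded_linear_simps[OF assms(1)])

lemma commuting_smooth_proj_V: "commuting smooth proj_V" "commuting op_smooth proj_V"
  by (simp_all add: commuting_def smooth_proj_V proj_V_id smooth_in op_smooth_in)

lemma smooth_commuting_spectral:
  "commuting smooth (spectral_proj l)" "commuting op_smooth (spectral_proj l)"
  using commuting_spectral[OF bounded_linear_smooth _ commuting_smooth_op_smooth commuting_smooth_proj_V(1)]
    commuting_spectral[OF bounded_linear_op_smooth commuting_sym[OF commuting_smooth_op_smooth]
      _ commuting_smooth_proj_V(2)] by (simp_all add: commuting_def)

lemma spectral_commute: "spectral_proj l (spectral_proj m x) = spectral_proj m (spectral_proj l x)"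
proof (rule commutingD[OF commuting_spectral])
  show "bounded_linear (spectral_proj l)"
    by (rule selfadj_bounded_linear[OF orth_projector_selfadj[OF projector_spectral]])
qed (use smooth_commuting_spectral in \<open>auto simp: commuting_def spectral_proj_V\<close>)

lemma spectral_range_form:
  assumes "spectral_proj l x = x"
  shows "inner (shifted l x) x \<le> 0"
proof (rule upper_complement_nonpos)
  have "proj_V x = x" using assms spectral_proj_V(2) by metis
  then show "upper_proj l x = 0" using assms by (simp add: spectral_proj_def)
qed

lemma spectral_kernel_upper:
  assumes "x \<in> V" "spectral_proj l x = 0"
  shows "upper_proj l x = x"
  using assms by (simp add: spectral_proj_def proj_V_id)

lemma spectral_kernel_form: "x \<in> V \<Longrightarrow> spectral_proj l x = 0 \<Longrightarrow> 0 \<le> inner (shifted l x) x"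
  by (rule upper_nonneg[OF spectral_kernel_upper])

text \<open>
  A vector \<open>y\<close> in the range of the projector at \<open>l\<close> and in the kernel of the one at \<open>m\<close> satisfies
  \<open>\<langle>(Q - l) A y, y\<rangle> \<le> 0 \<le> \<langle>(Q - m) A y, y\<rangle>\<close>.  Hence \<open>(m - l) \<langle>A y, y\<rangle> \<le> 0\<close>, and \<open>y = 0\<close> as \<open>A\<close> is
  injective on \<open>V\<close>.
\<close>

lemma spectral_mono: 
  assumes "l \<le> m"
  shows "spectral_proj m (spectral_proj l x) = spectral_proj l x"
proof (cases "l = m")
  case True then show ?thesis by (simp add: orth_projector_simps[OF projector_spectral])
next
  case False
  define y where "y = spectral_proj l x - spectral_proj m (spectral_proj l x)"
  note lin = orth_projector_simps[OF projector_spectral]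
  have yV: "y \<in> V" unfolding y_def by (intro csubspaceD(4)[OF csubspace_V] spectral_in)
  have "spectral_proj l y = y" unfolding y_def by (simp add: lin spectral_commute[of l m])
  then have "inner (shifted l y) y \<le> 0" by (rule spectral_range_form)
  moreover have "0 \<le> inner (shifted m y) y"
    by (rule spectral_kernel_form[OF yV]) (simp add: y_def lin)
  ultimately have "(m - l) * inner (smooth y) y \<le> 0" using shifted_diff[of l y m] by linarith
  then have "inner (smooth y) y \<le> 0" using assms False by (simp add: mult_le_0_iff)
  then have "y = 0" by (rule smooth_form_zero[OF yV])
  then show ?thesis by (simp add: y_def)
qed

lemma spectral_mono': "l \<le> m \<Longrightarrow> spectral_proj l (spectral_proj m x) = spectral_proj l x"
  using spectral_mono spectral_commute by metis

lemma spectral_norm_mono: "l \<le> m \<Longrightarrow> norm (spectral_proj l x) \<le> norm (spectral_proj m x)"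
  using spectral_mono' orth_projector_norm_le[OF projector_spectral] by metis

lemma spectral_tendsto: "f \<longlonglongrightarrow> x \<Longrightarrow> (\<lambda>n. spectral_proj l (f n)) \<longlonglongrightarrow> spectral_proj l x"
  by (rule bounded_linear.tendsto[OF selfadj_bounded_linear[OF orth_projector_selfadj[OF projector_spectral]]])

text \<open>
  The limit from the right is a projector \<open>R\<close>.  For a vector \<open>y\<close> in the difference of \<open>R\<close> and the
  projector at \<open>l\<close> the form of \<open>(Q - l) A\<close> is both \<open>\<le> 0\<close>, as a limit, and \<open>\<ge> 0\<close>.  Then \<open>y\<close> is in the
  kernel of \<open>(Q - l) A\<close>, which belongs to the nonpositive part by construction, so \<open>y = 0\<close>.
\<close>

lemma spectral_right_cont: "(\<lambda>n. spectral_proj (l + 1 / real (Suc n)) x) \<longlonglongrightarrow> spectral_proj l x"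
proof -
  let ?P = "\<lambda>n. spectral_proj (l + 1 / real (Suc n))"
  note lin = orth_projector_simps[OF projector_spectral]
  have anti: "l + 1 / real (Suc n) \<le> l + 1 / real (Suc m)" if "m \<le> n" for m n
    using that by (auto intro!: divide_left_mono)
  obtain R where R: "orth_projector R" "\<And>x. (\<lambda>n. ?P n x) \<longlonglongrightarrow> R x"
    using decreasing_projectors_converge[of ?P, OF projector_spectral spectral_norm_mono[OF anti]]
      by auto
  define y where "y = R x - spectral_proj l x"
  have RV: "R x \<in> V" by (rule closed_sequentially[OF closed_V _ R(2)]) (simp add: spectral_in)
  then have yV: "y \<in> V" unfolding y_def by (intro csubspaceD(4)[OF csubspace_V] spectral_in)
  have PR: "?P n (R x) = R x" for n
  proof (rule LIMSEQ_unique)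
    show "(\<lambda>m. ?P n (?P m x)) \<longlonglongrightarrow> ?P n (R x)"
      by (rule spectral_tendsto[OF R(2)])
    have "eventually (\<lambda>m. ?P m x = ?P n (?P m x)) sequentially"
      using eventually_ge_at_top[of n] by eventually_elim (simp only: spectral_mono[OF anti])
    then show "(\<lambda>m. ?P n (?P m x)) \<longlonglongrightarrow> R x" using R(2)[of x] by (rule Lim_transform_eventually[rotated])
  qed
  have ER: "spectral_proj l (R x) = spectral_proj l x"
  proof (rule LIMSEQ_unique)
    show "(\<lambda>m. spectral_proj l (?P m x)) \<longlonglongrightarrow> spectral_proj l (R x)"
      by (rule spectral_tendsto[OF R(2)])
    show "(\<lambda>m. spectral_proj l (?P m x)) \<longlonglongrightarrow> spectral_proj l x"
      by (simp add: spectral_mono')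
  qed
  have "?P n y = y" for n
    unfolding y_def by (simp only: lin PR spectral_mono[of l "l + 1 / real (Suc n)"])
        (simp add: spectral_mono)
  then have le: "inner (shifted (l + 1 / real (Suc n)) y) y \<le> 0" for n by (rule spectral_range_form)
  have "inner (shifted l y) y \<le> 0 + 0 * inner (smooth y) y"
  proof (rule LIMSEQ_le_const)
    show "(\<lambda>n. 0 + (1 / real (Suc n)) * inner (smooth y) y) \<longlonglongrightarrow> 0 + 0 * inner (smooth y) y"
      by (intro tendsto_intros) (use LIMSEQ_inverse_real_of_nat in \<open>simp add: inverse_eq_divide\<close>)
    have "inner (shifted l y) y \<le> 0 + (1 / real (Suc n)) * inner (smooth y) y" for n
      using le[of n] shifted_diff[of l y "l + 1 / real (Suc n)"] by simp
    then show "\<exists>N. \<forall>n\<ge>N. inner (shifted l y) y \<le> 0 + (1 / real (Suc n)) * inner (smooth y) y" by blast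
  qed
  moreover have uy: "upper_proj l y = y"
    by (rule spectral_kernel_upper[OF yV]) (simp add: y_def lin ER)
  ultimately have form0: "inner (shifted l (upper_proj l y)) y = 0"
    using upper_nonneg[OF uy] by simp
  have com: "commuting (shifted l) (upper_proj l)"
    by (rule upper_commuting_shifted[OF selfadj_bounded_linear[OF selfadj_shifted]])
        (simp add: commuting_def)
  have "positive_op (\<lambda>x. shifted l (upper_proj l x))"
    unfolding positive_op_def
  proof (intro conjI allI)
    show "selfadj (\<lambda>x. shifted l (upper_proj l x))"
      by (rule selfadj_compose_commuting[OF selfadj_shifted orth_projector_selfadj[OF projector_upper] com])
    fix x
    have "inner (shifted l (upper_proj l x)) x = inner (shifted l (upper_proj l x)) (upper_proj l x)"
      using selfadj_inner[OF orth_projector_selfadj[OF projector_upper], of l "shifted l (upper_proj l x)" x]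
      by (simp add: commutingD[OF com, symmetric] orth_projector_simps[OF projector_upper])
    then show "0 \<le> inner (shifted l (upper_proj l x)) x"
      using upper_nonneg[of l "upper_proj l x"] by (simp add: orth_projector_simps[OF projector_upper])
  qed
  from positive_zero_form[OF this form0] have "shifted l y = 0" by (simp add: uy)
  then have "y = 0" using upper_kernel uy by metis
  then show ?thesis using R(2)[of x] by (simp add: y_def)
qed

text \<open>
  A vector \<open>y\<close> in all ranges would satisfy \<open>n \<langle>A y, y\<rangle> \<le> - \<langle>Q A y, y\<rangle>\<close> for all \<open>n\<close>.
\<close>

lemma spectral_at_bot: "(\<lambda>n. spectral_proj (- real n) x) \<longlonglongrightarrow> 0"
proof -
  let ?P = "\<lambda>n. spectral_proj (- real n)"
  have anti: "- real n \<le> - real m" if "m \<le> n" for m n using that by simp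
  obtain R where R: "orth_projector R" "\<And>x. (\<lambda>n. ?P n x) \<longlonglongrightarrow> R x"
    using decreasing_projectors_converge[of ?P, OF projector_spectral spectral_norm_mono[OF anti]]
      by auto
  define y where "y = R x"
  have yV: "y \<in> V" unfolding y_def
    by (rule closed_sequentially[OF closed_V _ R(2)]) (simp add: spectral_in)
  have "?P n y = y" for n
  proof (rule LIMSEQ_unique)
    show "(\<lambda>m. ?P n (?P m x)) \<longlonglongrightarrow> ?P n y" unfolding y_def
      by (rule spectral_tendsto[OF R(2)])
    have "eventually (\<lambda>m. ?P m x = ?P n (?P m x)) sequentially"
      using eventually_ge_at_top[of n] by eventually_elim (simp only: spectral_mono[OF anti])
    then show "(\<lambda>m. ?P n (?P m x)) \<longlonglongrightarrow> y"
      using R(2)[of x] unfolding y_def by (rule Lim_transform_eventually[rotated])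
  qed
  then have form: "inner (shifted (- real n) y) y \<le> 0" for n by (rule spectral_range_form)
  have le: "real n * inner (smooth y) y \<le> - inner (op_smooth y) y" for n
    using form[of n] by (simp add: shifted_def inner_add_left)
  have "inner (smooth y) y \<le> 0"
    using reals_Archimedean3[of "inner (smooth y) y"] le by (meson not_le)
  then have "y = 0" by (rule smooth_form_zero[OF yV])
  then show ?thesis using R(2)[of x] by (simp add: y_def)
qed

lemma spectral_at_top: "(\<lambda>n. spectral_proj (real n) x) \<longlonglongrightarrow> proj_V x"
proof -
  let ?P = "\<lambda>n. spectral_proj (real n)"
  note lin = orth_projector_simps[OF projector_spectral]
  have mono: "real m \<le> real n" if "m \<le> n" for m n using that by simp
  obtain R where R: "orth_projector R" "\<And>x. (\<lambda>n. ?P n x) \<longlonglongrightarrow> R x"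
    using increasing_projectors_converge[of ?P, OF projector_spectral spectral_norm_mono[OF mono]]
      by auto
  define y where "y = proj_V x - R x"
  have RV: "R x \<in> V" by (rule closed_sequentially[OF closed_V _ R(2)]) (simp add: spectral_in)
  then have yV: "y \<in> V" unfolding y_def by (intro csubspaceD(4)[OF csubspace_V] proj_V_in)
  have "?P n (R x) = ?P n x" for n
  proof (rule LIMSEQ_unique)
    show "(\<lambda>m. ?P n (?P m x)) \<longlonglongrightarrow> ?P n (R x)"
      by (rule spectral_tendsto[OF R(2)])
    have "eventually (\<lambda>m. ?P n x = ?P n (?P m x)) sequentially"
      using eventually_ge_at_top[of n] by eventually_elim (simp only: spectral_mono'[OF mono])
    then show "(\<lambda>m. ?P n (?P m x)) \<longlonglongrightarrow> ?P n x" by (rule Lim_transform_eventually[OF tendsto_const])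
  qed
  then have "?P n y = 0" for n by (simp add: y_def lin spectral_proj_V)
  then have "0 \<le> inner (shifted (real n) y) y" for n by (rule spectral_kernel_form[OF yV])
  then have le: "real n * inner (smooth y) y \<le> inner (op_smooth y) y" for n
    by (simp add: shifted_def inner_diff_left)
  have "inner (smooth y) y \<le> 0"
    using reals_Archimedean3[of "inner (smooth y) y"] le by (meson not_le)
  then have "y = 0" by (rule smooth_form_zero[OF yV])
  then show ?thesis using R(2)[of x] by (simp add: y_def)
qed

sublocale spectral_family spectral_proj proj_V
  by unfold_locales
    (rule projector_spectral spectral_norm_mono spectral_right_cont spectral_at_bot spectral_at_top
      projector_V | assumption)+

section \<open>Bounded spectral intervals\<close>

text \<open>
  On the range of the projector \<open>P\<close> of \<open>(a, b]\<close> the operator \<open>S = (Q - a) A\<close> satisfies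
  \<open>0 \<le> S \<le> (b - a) A\<close>.  The bound is the positivity of the product of the commuting operators
  \<open>(b - a) A - S\<close> and \<open>(b - a) A + S\<close>, that is, \<open>S\<^sup>2 \<le> (b - a)\<^sup>2 A\<^sup>2\<close>.  The factor \<open>P\<close> makes both
  operators positive on the whole space; note that \<open>(b - a) A - S = - (Q - b) A\<close>.
\<close>

lemma shifted_norm_le:
  assumes ab: "a \<le> b" and x: "spectral_proj b x = x" "spectral_proj a x = 0"
  shows "norm (shifted a x) \<le> (b - a) * norm (smooth x)"
proof -
  define P where "P x = spectral_proj b x - spectral_proj a x" for x
  have P: "orth_projector P"
    unfolding P_def[abs_def]
      by (rule projector_le_diff(1)[OF projector_spectral projector_spectral spectral_norm_mono[OF ab]])
  note Plin = orth_projector_simps[OF P]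
  have Px: "P x = x" by (simp add: P_def x)
  have PV: "P z \<in> V" for z unfolding P_def by (intro csubspaceD(4)[OF csubspace_V] spectral_in)
  have comP: "commuting smooth P" "commuting op_smooth P"
    using smooth_commuting_spectral
    by (simp_all add: commuting_def P_def smooth_lin op_smooth_lin)
  have comPS: "shifted c (P z) = P (shifted c z)" for c z
    using comP by (simp add: shifted_def commuting_def Plin)
  have rng: "spectral_proj b (P z) = P z" "spectral_proj a (P z) = 0" for z
    using spectral_mono[OF ab, of z] spectral_mono'[OF ab, of z]
    by (simp_all add: P_def orth_projector_simps[OF projector_spectral])
  have form_P: "inner (P (T z)) z = inner (T (P z)) (P z)" if "\<And>z. T (P z) = P (T z)" for T z
    using selfadj_inner[OF orth_projector_selfadj[OF P], of "T (P z)" z] that by (simp add: Plin)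
  have pos1: "positive_op (\<lambda>z. - P (shifted b z))"
    unfolding positive_op_def
  proof (intro conjI allI)
    have "selfadj (\<lambda>z. P (shifted b z))"
      by (rule selfadj_compose_commuting[OF orth_projector_selfadj[OF P] selfadj_shifted])
         (simp add: commuting_def comPS)
    from selfadj_scaleR[OF this, of "-1"] show "selfadj (\<lambda>z. - P (shifted b z))" by simp
    show "0 \<le> inner (- P (shifted b z)) z" for z
      using spectral_range_form[OF rng(1), of z] form_P[of "shifted b" z] comPS by simp
  qed
  have pos2: "positive_op (\<lambda>z. (b - a) *\<^sub>R smooth z + P (shifted a z))"
    unfolding positive_op_def
  proof (intro conjI allI)
    have "selfadj (\<lambda>z. P (shifted a z))"
      by (rule selfadj_compose_commuting[OF orth_projector_selfadj[OF P] selfadj_shifted])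
         (simp add: commuting_def comPS)
    from selfadj_linear_combination[OF selfadj_smooth this, of "b - a" 1]
    show "selfadj (\<lambda>z. (b - a) *\<^sub>R smooth z + P (shifted a z))" by simp
    show "0 \<le> inner ((b - a) *\<^sub>R smooth z + P (shifted a z)) z" for z
      using spectral_kernel_form[OF PV rng(2), of z] form_P[of "shifted a" z] comPS ab
        positive_opD[OF positive_smooth, of z] by (simp add: inner_add_left)
  qed
  have sm: "shifted c (smooth z) = smooth (shifted c z)" for c z
    by (simp add: shifted_def smooth_op_smooth smooth_lin)
  have ss: "shifted c (shifted d z) = shifted d (shifted c z)" for c d z
    by (simp add: shifted_def smooth_op_smooth smooth_lin op_smooth_lin algebra_simps)
  have "0 \<le> inner (- P (shifted b ((b - a) *\<^sub>R smooth x + P (shifted a x)))) x"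
  proof (rule positive_commuting_product[OF pos1 pos2])
    show "commuting (\<lambda>z. - P (shifted b z)) (\<lambda>z. (b - a) *\<^sub>R smooth z + P (shifted a z))"
      using comP by (simp add: commuting_def Plin comPS sm smooth_lin selfadj_simps[OF selfadj_shifted] ss)
  qed
  also have "- P (shifted b ((b - a) *\<^sub>R smooth x + P (shifted a x)))
      = - (shifted b ((b - a) *\<^sub>R smooth x + shifted a x))"
    using comP(1) by (simp add: comPS[symmetric] Px Plin selfadj_simps[OF selfadj_shifted] commuting_def)
      (metis comPS Px)
  also have "\<dots> = (b - a) *\<^sub>R smooth ((b - a) *\<^sub>R smooth x) - shifted a (shifted a x)"
    by (simp add: shifted_def smooth_op_smooth smooth_lin op_smooth_lin algebra_simps)
  finally have "0 \<le> inner ((b - a) *\<^sub>R smooth ((b - a) *\<^sub>R smooth x) - shifted a (shifted a x)) x" .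
  also have "\<dots> = ((b - a) * norm (smooth x))\<^sup>2 - (norm (shifted a x))\<^sup>2"
    using selfadj_inner[OF selfadj_smooth, of "smooth x" x] selfadj_inner[OF selfadj_shifted, of a "shifted a x" x]
    by (simp add: inner_diff_left smooth_lin power_mult_distrib power2_norm_eq_inner)
       (simp add: power2_eq_square)
  finally show ?thesis using ab by (auto intro: power2_le_imp_le)
qed

text \<open>
  Let \<open>K\<close> be the spectral subspace of \<open>(a, b]\<close>.  The vectors \<open>A z\<close> with \<open>z \<in> K\<close> lie in the domain,
  satisfy the bound by the previous lemma, and are dense in \<open>K\<close> because \<open>A\<close> is injective.  The bound
  makes \<open>Q\<close> converge along approximating sequences, and the graph is closed.
\<close>

lemma spectral_interval_domain:
  assumes ab: "a \<le> b" and x: "spectral_proj b x = x" "spectral_proj a x = 0"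
  shows "x \<in> odom M" "norm (oapp M x - a *\<^sub>R x) \<le> (b - a) * norm x"
proof -
  define K where "K = {x. spectral_proj b x = x \<and> spectral_proj a x = 0}"
  note lin = orth_projector_simps[OF projector_spectral]
  have K: "subspace K" by (auto simp: subspace_def K_def lin)
  have cont: "continuous_on UNIV (spectral_proj c)" for c
    by (intro linear_continuous_on selfadj_bounded_linear orth_projector_selfadj projector_spectral)
  have clK: "closed K" unfolding K_def
    by (intro closed_Collect_conj closed_Collect_eq cont continuous_on_id continuous_on_const)
  define L where "L = closure (smooth ` K)"
  have sub: "subspace (smooth ` K)"
    by (rule linear_subspace_image[OF bounded_linear.linear[OF bounded_linear_smooth] K])
  have L: "subspace L" "closed L" unfolding L_def by (simp_all add: subspace_closure_normed[OF sub])
  have smK: "smooth z \<in> K" if "z \<in> K" for z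
    using that commutingD[OF smooth_commuting_spectral(1), of a z]
      commutingD[OF smooth_commuting_spectral(1), of b z] by (simp add: K_def smooth_lin)
  then have LK: "L \<subseteq> K" unfolding L_def by (intro closure_minimal clK) auto
  define r where "r = x - orth_proj L x"
  have rK: "r \<in> K"
    unfolding r_def using x LK orth_proj_in[OF L] K by (intro subspace_diff) (auto simp: K_def)
  then have "smooth r \<in> L" unfolding L_def by (intro subsetD[OF closure_subset] imageI)
  then have "inner (smooth r) r \<le> 0"
    using orth_proj_orthogonal[OF L, of "smooth r" x] by (simp add: r_def inner_commute)
  moreover have "r \<in> V" using rK spectral_in[of b r] by (simp add: K_def)
  ultimately have "r = 0" by (rule smooth_form_zero[rotated])
  then have "x \<in> L" using orth_proj_in[OF L, of x] by (simp add: r_def)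
  then obtain f where f: "\<And>n. f n \<in> smooth ` K" "f \<longlonglongrightarrow> x"
    unfolding L_def closure_sequential by blast
  have "\<forall>n. \<exists>z. z \<in> K \<and> f n = smooth z" using f(1) by fast
  then obtain k where k: "\<And>n. k n \<in> K" "\<And>n. f n = smooth (k n)"
    using choice[of "\<lambda>n z. z \<in> K \<and> f n = smooth z"] by auto
  have bound: "norm (shifted a (k n) - shifted a (k m)) \<le> (b - a) * norm (f n - f m)" for n m
    using shifted_norm_le[OF ab, of "k n - k m"] k
    by (simp add: K_def lin selfadj_simps[OF selfadj_shifted] smooth_lin)
  have "Cauchy (\<lambda>n. shifted a (k n))"
  proof (rule metric_CauchyI)
    fix e :: real assume e: "e > 0"
    have "Cauchy f" using f(2) LIMSEQ_imp_Cauchy by blast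
    then obtain N where N: "\<And>m n. m \<ge> N \<Longrightarrow> n \<ge> N \<Longrightarrow> dist (f m) (f n) < e / (b - a + 1)"
      using metric_CauchyD[of f "e / (b - a + 1)"] e ab by auto
    have "dist (shifted a (k m)) (shifted a (k n)) < e" if "m \<ge> N" "n \<ge> N" for m n
    proof -
      have "dist (shifted a (k m)) (shifted a (k n)) \<le> (b - a + 1) * dist (f m) (f n)"
        using bound[of m n] by (simp add: dist_norm algebra_simps add_increasing)
      also have "\<dots> < e" using N[OF that] ab by (simp add: field_simps)
      finally show ?thesis .
    qed
    then show "\<exists>N. \<forall>m\<ge>N. \<forall>n\<ge>N. dist (shifted a (k m)) (shifted a (k n)) < e" by blast
  qed
  then obtain h where h: "(\<lambda>n. shifted a (k n)) \<longlonglongrightarrow> h" using Cauchy_convergent convergentD by blast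
  have "(\<lambda>n. (f n, shifted a (k n) + a *\<^sub>R f n)) \<longlonglongrightarrow> (x, h + a *\<^sub>R x)"
    by (intro tendsto_intros f(2) h)
  moreover have "(f n, shifted a (k n) + a *\<^sub>R f n) \<in> G" for n
    using smooth_G[of "k n"] by (simp add: k(2) shifted_def)
  ultimately have xG: "(x, h + a *\<^sub>R x) \<in> G" by (rule closed_sequentially[OF closed_G, rotated])
  show "x \<in> odom M" by (rule odomI[OF xG])
  have "norm h \<le> (b - a) * norm x"
  proof (rule LIMSEQ_le)
    show "(\<lambda>n. norm (shifted a (k n))) \<longlonglongrightarrow> norm h" by (intro tendsto_intros h)
    show "(\<lambda>n. (b - a) * norm (f n)) \<longlonglongrightarrow> (b - a) * norm x" by (intro tendsto_intros f(2))
    have "norm (shifted a (k n)) \<le> (b - a) * norm (f n)" for n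
      using shifted_norm_le[OF ab, of "k n"] k by (simp add: K_def)
    then show "\<exists>N. \<forall>n\<ge>N. norm (shifted a (k n)) \<le> (b - a) * norm (f n)" by blast
  qed
  then show "norm (oapp M x - a *\<^sub>R x) \<le> (b - a) * norm x" by (simp add: oapp_eq[OF xG])
qed

subsection \<open>The projection-valued measure commutes with everything that commutes with \<open>Q\<close>\<close>

lemma pvm_proj_V:
  assumes B: "B \<in> sets borel"
  shows "proj_V (family_pvm B x) = family_pvm B x" "family_pvm B (proj_V x) = family_pvm B x"
proof -
  have "norm (family_pvm B x) \<le> norm (proj_V x)" for x
  proof (rule power2_le_imp_le)
    interpret finite_measure "family_measure x" by (rule finite_measure_family)
    show "(norm (family_pvm B x))\<^sup>2 \<le> (norm (proj_V x))\<^sup>2"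
      using finite_measure_mono[of B UNIV] by (simp add: norm_pvm[OF B] measure_family_UNIV)
  qed simp
  note * = projector_le_absorb[OF projector_pvm[OF B] projector_V this]
  show "proj_V (family_pvm B x) = family_pvm B x" "family_pvm B (proj_V x) = family_pvm B x"
    by (rule *)+
qed

lemma pvm_in: "B \<in> sets borel \<Longrightarrow> family_pvm B x \<in> V"
  using pvm_proj_V(1) proj_V_eq_iff by blast

lemma commuting_smooth_pvm:
  assumes "bounded_linear T" "commuting T smooth" "commuting T op_smooth" "commuting T proj_V"
      "B \<in> sets borel"
  shows "commuting T (family_pvm B)"
  by (rule commuting_pvm[OF assms(5,1) commuting_spectral[OF assms(1-4)]])

lemma pvm_G:
  assumes B: "B \<in> sets borel" and xy: "(x, y) \<in> G"
  shows "(family_pvm B x, family_pvm B y) \<in> G"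
proof (rule G_invariant[OF _ _ _ _ xy])
  show "bounded_linear (family_pvm B)"
    by (rule selfadj_bounded_linear[OF orth_projector_selfadj[OF projector_pvm[OF B]]])
  show "commuting (family_pvm B) smooth" "commuting (family_pvm B) op_smooth"
    using commuting_smooth_pvm[OF bounded_linear_smooth _ commuting_smooth_op_smooth commuting_smooth_proj_V(1) B]
      commuting_smooth_pvm[OF bounded_linear_op_smooth commuting_sym[OF commuting_smooth_op_smooth]
        _ commuting_smooth_proj_V(2) B] by (simp_all add: commuting_def)
qed (rule pvm_in[OF B])

lemma projection_valued_measure_family: "projection_valued_measure V family_pvm"
  unfolding projection_valued_measure_def projection_on_def bounded_op_on_def clinear_on_def
proof (intro conjI ballI allI impI)
  fix B :: "real set" assume B: "B \<in> sets borel"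
  note P = projector_pvm[OF B]
  have i: "commuting (\<lambda>x. c *\<^sub>C x) (family_pvm B)" for c
    unfolding proj_V_def
    by (rule commuting_smooth_pvm[OF bounded_linear_scaleC commuting_scaleC_smooth _ B])
       (simp add: proj_V_def orth_proj_scaleC_commuting[OF csubspace_V closed_V])
  show "family_pvm B ` V \<subseteq> V" using pvm_in[OF B] by auto
  show "family_pvm B (x + y) = family_pvm B x + family_pvm B y" for x y
    by (simp add: orth_projector_simps[OF P])
  show "family_pvm B (c *\<^sub>C x) = c *\<^sub>C family_pvm B x" for c x
    using i by (simp add: commuting_def)
  show "\<exists>C. \<forall>x\<in>V. norm (family_pvm B x) \<le> C * norm x"
    by (intro exI[of _ 1]) (simp add: orth_projector_norm_le[OF P])
  show "family_pvm B (family_pvm B x) = family_pvm B x" for x by (rule orth_projector_idem[OF P])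
  show "cinner (family_pvm B x) y = cinner x (family_pvm B y)" for x y
    by (rule selfadj_cinner[OF orth_projector_selfadj[OF P] i])
next
  show "family_pvm UNIV x = x" if "x \<in> V" for x using that by (simp add: pvm_UNIV proj_V_id)
  show "(\<lambda>n. family_pvm (B n) x) sums family_pvm (\<Union>n. B n) x"
    if "range B \<subseteq> sets borel" "disjoint_family B" for B x by (rule pvm_sums[OF that])
qed

end

section \<open>Projection-valued measures\<close>

locale pvm =
  fixes V :: "'a::chilbert_space set" and E :: "real set \<Rightarrow> 'a \<Rightarrow> 'a"
  assumes csubspace: "csubspace V" and pvm: "projection_valued_measure V E"
begin

lemma
  assumes B: "B \<in> sets borel" and x: "x \<in> V"
  shows E_in: "E B x \<in> V"
    and E_add: "y \<in> V \<Longrightarrow> E B (x + y) = E B x + E B y"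
    and E_scaleC: "E B (c *\<^sub>C x) = c *\<^sub>C E B x"
    and E_idem: "E B (E B x) = E B x"
    and E_cinner: "y \<in> V \<Longrightarrow> cinner (E B x) y = cinner x (E B y)"
  using pvm B x
  by (auto simp: projection_valued_measure_def projection_on_def bounded_op_on_def clinear_on_def
      image_subset_iff)

lemma E_UNIV: "x \<in> V \<Longrightarrow> E UNIV x = x"
  using pvm by (simp add: projection_valued_measure_def)

lemma E_sums: "range B \<subseteq> sets borel \<Longrightarrow> disjoint_family B \<Longrightarrow> x \<in> V \<Longrightarrow> (\<lambda>n. E (B n) x) sums E (\<Union>n. B n) x"
  using pvm by (simp add: projection_valued_measure_def)

lemma E_scaleR: "B \<in> sets borel \<Longrightarrow> x \<in> V \<Longrightarrow> E B (r *\<^sub>R x) = r *\<^sub>R E B x"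
  using E_scaleC[of B x "complex_of_real r"] by (simp add: scaleC_of_real)

lemma E_diff:
  assumes "B \<in> sets borel" "x \<in> V" "y \<in> V"
  shows "E B (x - y) = E B x - E B y"
  using E_add[OF assms(1,2), of "- y"] E_scaleR[OF assms(1,3), of "-1"] assms csubspaceD[OF csubspace]
  by simp

lemma E_cinner_self:
  assumes "B \<in> sets borel" "x \<in> V"
  shows "cinner (E B x) x = complex_of_real ((norm (E B x))\<^sup>2)"
  using E_cinner[OF assms E_in[OF assms]] E_cinner[OF assms(1) E_in[OF assms] assms(2)]
  by (simp add: E_idem[OF assms] cinner_self)

lemma E_inner: "B \<in> sets borel \<Longrightarrow> x \<in> V \<Longrightarrow> y \<in> V \<Longrightarrow> inner (E B x) y = inner x (E B y)"
  using E_cinner by (simp flip: Re_cinner)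

lemma E_inner_self: "B \<in> sets borel \<Longrightarrow> x \<in> V \<Longrightarrow> inner (E B x) x = (norm (E B x))\<^sup>2"
  using E_cinner_self by (simp flip: Re_cinner)

lemma E_empty:
  assumes "x \<in> V"
  shows "E {} x = 0"
proof -
  have "(\<lambda>n :: nat. E {} x) sums E (\<Union>n :: nat. {}) x"
    by (rule E_sums) (auto simp: disjoint_family_on_def assms)
  then have "summable (\<lambda>n :: nat. E {} x)" by (rule sums_summable)
  then have "(\<lambda>n :: nat. E {} x) \<longlonglongrightarrow> 0" by (rule summable_LIMSEQ_zero)
  then show ?thesis by (simp add: LIMSEQ_const_iff)
qed

lemma norm_E_sums:
  assumes "range B \<subseteq> sets borel" "disjoint_family B" "x \<in> V"
  shows "(\<lambda>n. (norm (E (B n) x))\<^sup>2) sums (norm (E (\<Union>n. B n) x))\<^sup>2"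
proof -
  have "(\<lambda>n. inner (E (B n) x) x) sums inner (E (\<Union>n. B n) x) x"
    by (rule bounded_linear.sums[OF bounded_linear_inner_left E_sums[OF assms]])
  moreover have "B n \<in> sets borel" for n using assms(1) by auto
  ultimately show ?thesis using assms by (simp add: E_inner_self sets.countable_UN)
qed

lemma E_Un:
  assumes "A \<in> sets borel" "B \<in> sets borel" "A \<inter> B = {}" "x \<in> V"
  shows "E (A \<union> B) x = E A x + E B x"
proof -
  have "disjoint_family (binaryset A B)"
    using assms(3) by (simp add: disjoint_family_on_def binaryset_def Int_commute)
  then have "(\<lambda>n. E (binaryset A B n) x) sums E (\<Union>n. binaryset A B n) x"
    using assms by (intro E_sums) (auto simp: range_binaryset_eq)
  moreover have "(\<lambda>n. E (binaryset A B n) x) sums (E A x + E B x)"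
    by (rule binaryset_sums) (rule E_empty[OF assms(4)])
  ultimately show ?thesis by (simp add: UN_binaryset_eq sums_unique2)
qed

lemma norm_E_Un:
  assumes "A \<in> sets borel" "B \<in> sets borel" "A \<inter> B = {}" "x \<in> V"
  shows "(norm (E (A \<union> B) x))\<^sup>2 = (norm (E A x))\<^sup>2 + (norm (E B x))\<^sup>2"
proof -
  have "(norm (E (A \<union> B) x))\<^sup>2 = inner (E (A \<union> B) x) x" using assms by (simp add: E_inner_self)
  also have "\<dots> = inner (E A x) x + inner (E B x) x" unfolding E_Un[OF assms] by (rule inner_add_left)
  finally show ?thesis using assms by (simp add: E_inner_self)
qed

lemma norm_E_le:
  assumes "B \<in> sets borel" "x \<in> V"
  shows "norm (E B x) \<le> norm x"
proof (rule power2_le_imp_le)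
  have "(norm (E (B \<union> - B) x))\<^sup>2 = (norm (E B x))\<^sup>2 + (norm (E (- B) x))\<^sup>2"
    using assms by (intro norm_E_Un) auto
  then show "(norm (E B x))\<^sup>2 \<le> (norm x)\<^sup>2" using assms by (simp add: E_UNIV)
qed simp

lemma E_Int:
  assumes A: "A \<in> sets borel" and B: "B \<in> sets borel" and x: "x \<in> V"
  shows "E A (E B x) = E (A \<inter> B) x"
proof -
  \<comment> \<open>Additivity on \<open>C \<union> D\<close> and \<open>\<parallel>E(C \<union> D) z\<parallel> \<le> \<parallel>z\<parallel>\<close>, applied to \<open>z = E(D) y\<close>, leave no room for \<open>E(C) z\<close>.\<close>
  have disj: "E C (E D y) = 0" if C: "C \<in> sets borel" and D: "D \<in> sets borel" and CD: "C \<inter> D = {}"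
      and y: "y \<in> V" for C D y
  proof -
    have "(norm (E (C \<union> D) (E D y)))\<^sup>2 = (norm (E C (E D y)))\<^sup>2 + (norm (E D (E D y)))\<^sup>2"
      by (rule norm_E_Un[OF C D CD E_in[OF D y]])
    moreover have "(norm (E (C \<union> D) (E D y)))\<^sup>2 \<le> (norm (E D y))\<^sup>2"
      using C D E_in[OF D y] by (intro power_mono norm_E_le) auto
    ultimately show ?thesis using E_idem[OF D y] by simp
  qed
  have "E B x = E ((A \<inter> B) \<union> (B - A)) x" by (rule arg_cong[where f = "\<lambda>C. E C x"]) auto
  also have "\<dots> = E (A \<inter> B) x + E (B - A) x" using A B x by (intro E_Un) auto
  finally have "E A (E B x) = E A (E (A \<inter> B) x) + E A (E (B - A) x)"
    using A B x by (simp add: E_add E_in)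
  also have "E A (E (B - A) x) = 0" using A B x by (intro disj) auto
  also have "E A (E (A \<inter> B) x) = E ((A \<inter> B) \<union> (A - B)) (E (A \<inter> B) x)"
    by (rule arg_cong[where f = "\<lambda>C. E C (E (A \<inter> B) x)"]) auto
  also have "\<dots> = E (A \<inter> B) (E (A \<inter> B) x) + E (A - B) (E (A \<inter> B) x)"
    using A B x by (intro E_Un E_in) auto
  also have "E (A - B) (E (A \<inter> B) x) = 0" using A B x by (intro disj) auto
  finally show ?thesis using A B x by (simp add: E_idem)
qed

lemma sets_scalar_measure [simp, measurable_cong]: "sets (scalar_measure E x) = sets borel"
  and space_scalar_measure [simp]: "space (scalar_measure E x) = UNIV"
proof -
  show "sets (scalar_measure E x) = sets borel"
    using sets.sets_measure_of_eq[of "borel :: real measure"] by (simp add: scalar_measure_def)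
  show "space (scalar_measure E x) = UNIV"
    unfolding scalar_measure_def by (rule space_measure_of) simp
qed

lemma emeasure_scalar_measure:
  assumes x: "x \<in> V" and B: "B \<in> sets borel"
  shows "emeasure (scalar_measure E x) B = ennreal ((norm (E B x))\<^sup>2)"
proof -
  have "emeasure (scalar_measure E x) B = ennreal (Re (cinner (E B x) x))"
  proof (rule emeasure_measure_of[OF scalar_measure_def])
    show "positive (sets (scalar_measure E x)) (\<lambda>B. ennreal (Re (cinner (E B x) x)))"
      by (simp add: positive_def E_empty x)
    show "countably_additive (sets (scalar_measure E x)) (\<lambda>B. ennreal (Re (cinner (E B x) x)))"
    proof (rule countably_additiveI)
      fix A :: "nat \<Rightarrow> real set"
      assume A: "range A \<subseteq> sets (scalar_measure E x)" "disjoint_family A"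
      then have A': "A i \<in> sets borel" "range A \<subseteq> sets borel" for i by auto
      have "(\<Sum>i. ennreal ((norm (E (A i) x))\<^sup>2)) = ennreal ((norm (E (\<Union>i. A i) x))\<^sup>2)"
        by (rule suminf_ennreal_eq[OF _ norm_E_sums[OF A'(2) A(2) x]]) simp
      then show "(\<Sum>i. ennreal (Re (cinner (E (A i) x) x))) = ennreal (Re (cinner (E (\<Union>i. A i) x) x))"
        by (simp only: E_cinner_self[OF A'(1) x] E_cinner_self[OF sets.countable_UN[OF A'(2)] x] Re_complex_of_real)
    qed
  qed (use B in auto)
  then show ?thesis using E_cinner_self[OF B x] by simp
qed

lemma measure_scalar_measure:
  "x \<in> V \<Longrightarrow> B \<in> sets borel \<Longrightarrow> measure (scalar_measure E x) B = (norm (E B x))\<^sup>2"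
  by (simp add: measure_def emeasure_scalar_measure)

lemma finite_scalar_measure: "x \<in> V \<Longrightarrow> finite_measure (scalar_measure E x)"
  by (rule finite_measureI) (simp add: emeasure_scalar_measure)

lemma scalar_measure_invariant:
  assumes "\<And>B. B \<in> sets borel \<Longrightarrow> cinner (E B y) y = cinner (E B x) x"
  shows "scalar_measure E y = scalar_measure E x"
  unfolding scalar_measure_def
proof (rule measure_of_eq)
  fix B :: "real set" assume "B \<in> sigma_sets UNIV (sets borel)"
  then have "B \<in> sets borel" using sets.sigma_sets_eq[of "borel :: real measure"] by simp
  then show "ennreal (Re (cinner (E B y) y)) = ennreal (Re (cinner (E B x) x))" using assms by simp
qed simp

end

text \<open>
  Repeated bisection: each halving of the interval gains a factor of 2 in the bound.
\<close>

lemma interval_additive_zero: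
  fixes h \<nu> :: "real \<Rightarrow> real \<Rightarrow> real"
  assumes h: "\<And>a b c. lo \<le> a \<Longrightarrow> a \<le> b \<Longrightarrow> b \<le> c \<Longrightarrow> c \<le> hi \<Longrightarrow> h a c = h a b + h b c"
    and \<nu>: "\<And>a b c. lo \<le> a \<Longrightarrow> a \<le> b \<Longrightarrow> b \<le> c \<Longrightarrow> c \<le> hi \<Longrightarrow> \<nu> a c = \<nu> a b + \<nu> b c"
    and le: "\<And>a b. lo \<le> a \<Longrightarrow> a \<le> b \<Longrightarrow> b \<le> hi \<Longrightarrow> \<bar>h a b\<bar> \<le> C * (b - a) * \<nu> a b"
    and ab: "lo \<le> a" "a \<le> b" "b \<le> hi"
  shows "h a b = 0"
proof -
  have *: "\<bar>h a b\<bar> \<le> C * (b - a) / 2 ^ k * \<nu> a b" if "lo \<le> a" "a \<le> b" "b \<le> hi" for a b k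
    using that
  proof (induction k arbitrary: a b)
    case 0 then show ?case using le by simp
  next
    case (Suc k)
    define m where "m = (a + b) / 2"
    have m: "lo \<le> m" "a \<le> m" "m \<le> b" "m \<le> hi" "m - a = (b - a) / 2" "b - m = (b - a) / 2"
      using Suc.prems by (simp_all add: m_def field_simps)
    have "\<bar>h a b\<bar> \<le> \<bar>h a m\<bar> + \<bar>h m b\<bar>" using h[of a m b] Suc.prems m by simp
    also have "\<dots> \<le> C * (m - a) / 2 ^ k * \<nu> a m + C * (b - m) / 2 ^ k * \<nu> m b"
      using Suc.prems m by (intro add_mono Suc.IH) auto
    also have "\<dots> = C * (b - a) / 2 ^ Suc k * \<nu> a b"
      unfolding m(5,6) using \<nu>[of a m b] Suc.prems m by (simp add: field_simps)
    finally show ?case .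
  qed
  have "(\<lambda>k. C * (b - a) * \<nu> a b * (1 / 2) ^ k) \<longlonglongrightarrow> C * (b - a) * \<nu> a b * 0"
    by (intro tendsto_intros LIMSEQ_power_zero) simp
  then have "\<bar>h a b\<bar> \<le> C * (b - a) * \<nu> a b * 0"
    by (rule LIMSEQ_le_const) (use *[OF ab] in \<open>auto simp: power_one_over field_simps\<close>)
  then show ?thesis by simp
qed

text \<open>
  An additive interval function that on short intervals is close to \<open>\<phi>(a) \<mu>((a, b])\<close> is the integral
  of \<open>\<phi>\<close>.  This replaces approximation by Riemann sums.
\<close>

lemma interval_integral_eqI:
  fixes \<mu> :: "real measure" and \<phi> :: "real \<Rightarrow> real" and g :: "real \<Rightarrow> real \<Rightarrow> real"
  assumes "finite_measure \<mu>" and sets [simp, measurable_cong]: "sets \<mu> = sets borel"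
    and [measurable]: "\<phi> \<in> borel_measurable borel" and K: "K \<ge> 0"
    and \<phi>: "\<And>a t. lo \<le> a \<Longrightarrow> a \<le> t \<Longrightarrow> t \<le> hi \<Longrightarrow> \<bar>\<phi> t - \<phi> a\<bar> \<le> K * (t - a)"
    and add: "\<And>a b c. lo \<le> a \<Longrightarrow> a \<le> b \<Longrightarrow> b \<le> c \<Longrightarrow> c \<le> hi \<Longrightarrow> g a c = g a b + g b c"
    and close: "\<And>a b. lo \<le> a \<Longrightarrow> a \<le> b \<Longrightarrow> b \<le> hi \<Longrightarrow>
      \<bar>g a b - \<phi> a * measure \<mu> {a<..b}\<bar> \<le> K * (b - a) * measure \<mu> {a<..b}"
    and ab: "lo \<le> a" "a \<le> b" "b \<le> hi"
  shows "g a b = (\<integral>t. indicator {a<..b} t * \<phi> t \<partial>\<mu>)"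
proof -
  interpret finite_measure \<mu> by fact
  let ?G = "\<lambda>a b. \<integral>t. indicator {a<..b} t * \<phi> t \<partial>\<mu>"
  have split: "indicator {a<..c} t = indicator {a<..b} t + (indicator {b<..c} t :: real)"
    if "a \<le> b" "b \<le> c" for a b c t :: real
    using that by (auto simp: indicator_def)
  have int: "integrable \<mu> (\<lambda>t. indicator {a<..b} t * \<phi> t)" if "lo \<le> a" "a \<le> b" "b \<le> hi" for a b
  proof (rule integrable_const_bound[where B = "\<bar>\<phi> a\<bar> + K * (b - a)"])
    have "\<bar>\<phi> t\<bar> \<le> \<bar>\<phi> a\<bar> + K * (b - a)" if "t \<in> {a<..b}" for t
      using \<phi>[of a t] that \<open>lo \<le> a\<close> \<open>b \<le> hi\<close> mult_left_mono[OF _ K, of "t - a" "b - a"] by auto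
    then show "AE t in \<mu>. norm (indicator {a<..b} t * \<phi> t) \<le> \<bar>\<phi> a\<bar> + K * (b - a)"
      using K that by (intro AE_I2) (simp add: indicator_def)
  qed simp
  have "g a b - ?G a b = 0"
  proof (rule interval_additive_zero[where h = "\<lambda>a b. g a b - ?G a b" and \<nu> = "\<lambda>a b. measure \<mu> {a<..b}"
        and lo = lo and hi = hi and C = "2 * K"])
    fix a b c assume abc: "lo \<le> a" "a \<le> b" "b \<le> c" "c \<le> hi"
    have "?G a c = ?G a b + ?G b c"
      using abc by (simp add: split[of a b c] distrib_right int)
    then show "g a c - ?G a c = (g a b - ?G a b) + (g b c - ?G b c)" using add[OF abc] by simp
    have "{a<..c} = {a<..b} \<union> {b<..c}" using abc by auto
    then show "measure \<mu> {a<..c} = measure \<mu> {a<..b} + measure \<mu> {b<..c}"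
      using abc by (subst finite_measure_Union[symmetric]) auto
  next
    fix a b assume *: "lo \<le> a" "a \<le> b" "b \<le> hi"
    have ind: "integrable \<mu> (\<lambda>t. indicator {a<..b} t * c)" for c :: real
      by (rule integrable_const_bound[where B = "\<bar>c\<bar>"]) (auto simp: indicator_def)
    have ic: "(\<integral>t. indicator {a<..b} t * c \<partial>\<mu>) = c * measure \<mu> {a<..b}" for c :: real
      by (simp add: mult.commute)
    have "\<bar>?G a b - \<phi> a * measure \<mu> {a<..b}\<bar>
        = \<bar>\<integral>t. indicator {a<..b} t * \<phi> t - indicator {a<..b} t * \<phi> a \<partial>\<mu>\<bar>"
      using int[OF *] ind by (simp add: ic[symmetric])
    also have "\<dots> \<le> (\<integral>t. \<bar>indicator {a<..b} t * \<phi> t - indicator {a<..b} t * \<phi> a\<bar> \<partial>\<mu>)"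
      by (rule integral_abs_bound)
    also have "\<dots> \<le> (\<integral>t. indicator {a<..b} t * (K * (b - a)) \<partial>\<mu>)"
    proof (rule integral_mono)
      fix t
      show "\<bar>indicator {a<..b} t * \<phi> t - indicator {a<..b} t * \<phi> a\<bar>
          \<le> indicator {a<..b} t * (K * (b - a))"
        using \<phi>[of a t] * mult_left_mono[OF _ K, of "t - a" "b - a"] by (auto simp: indicator_def)
    qed (use int[OF *] ind in auto)
    also have "\<dots> = K * (b - a) * measure \<mu> {a<..b}" by (rule ic)
    finally show "\<bar>g a b - ?G a b\<bar> \<le> 2 * K * (b - a) * measure \<mu> {a<..b}"
      using close[OF *] unfolding mult.assoc by linarith
  qed (use ab in auto)
  then show ?thesis by simp
qed

section \<open>Existence of the spectral resolution\<close>

context selfadjoint_operator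
begin

sublocale fam: pvm V family_pvm
  by unfold_locales (rule csubspace_V projection_valued_measure_family)+

abbreviation "\<mu> \<equiv> scalar_measure family_pvm"

lemma oapp_pvm:
  assumes "B \<in> sets borel" "x \<in> odom M"
  shows "family_pvm B x \<in> odom M" "oapp M (family_pvm B x) = family_pvm B (oapp M x)"
  using pvm_G[OF assms(1) oapp_in[OF assms(2)]] odomI oapp_eq by auto

text \<open>
  The basis of all integral formulas: a vector of the spectral subspace of \<open>(a, b]\<close> is in the domain
  and is an eigenvector for \<open>a\<close> up to an error of \<open>b - a\<close>.
\<close>

lemma interval_in_domain:
  assumes "a \<le> b"
  shows "family_pvm {a<..b} x \<in> odom M"
    and "norm (oapp M (family_pvm {a<..b} x) - a *\<^sub>R family_pvm {a<..b} x)
        \<le> (b - a) * norm (family_pvm {a<..b} x)"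
proof -
  have "spectral_proj b (family_pvm {a<..b} x) = family_pvm {a<..b} x"
    "spectral_proj a (family_pvm {a<..b} x) = 0"
    using spectral_mono[OF assms, of x] spectral_mono'[OF assms, of x]
    by (simp_all add: pvm_Ioc[OF assms] orth_projector_simps[OF projector_spectral])
  from spectral_interval_domain[OF assms this] show "family_pvm {a<..b} x \<in> odom M"
    "norm (oapp M (family_pvm {a<..b} x) - a *\<^sub>R family_pvm {a<..b} x)
        \<le> (b - a) * norm (family_pvm {a<..b} x)" .
qed

lemma oapp_interval:
  assumes "a \<le> b"
  shows "family_pvm {a<..b} (oapp M (family_pvm {a<..b} x)) = oapp M (family_pvm {a<..b} x)"
  using oapp_pvm(2)[of "{a<..b}", OF _ interval_in_domain(1)[OF assms, of x]]
    orth_projector_idem[OF projector_pvm[of "{a<..b}"], of x] by simp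

lemma oapp_interval_split:
  assumes "a \<le> b" "b \<le> c" and x: "x \<in> V"
  shows "oapp M (family_pvm {a<..c} x) = oapp M (family_pvm {a<..b} x) + oapp M (family_pvm {b<..c} x)"
    and "inner (oapp M (family_pvm {a<..b} x)) (oapp M (family_pvm {b<..c} x)) = 0"
proof -
  have "family_pvm {a<..c} x = family_pvm {a<..b} x + family_pvm {b<..c} x"
    using assms by (simp add: pvm_Ioc)
  then show "oapp M (family_pvm {a<..c} x)
      = oapp M (family_pvm {a<..b} x) + oapp M (family_pvm {b<..c} x)"
    using clinear_oapp interval_in_domain(1) assms by (simp add: clinear_on_def)
  let ?y = "oapp M (family_pvm {a<..b} x)" and ?z = "oapp M (family_pvm {b<..c} x)"
  have V: "?y \<in> V" "?z \<in> V"
    by (intro G_in(2)[OF oapp_in[OF interval_in_domain(1)]] assms)+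
  have "inner ?y ?z = inner (family_pvm {a<..b} ?y) (family_pvm {b<..c} ?z)"
    by (simp add: oapp_interval assms)
  also have "\<dots> = inner ?y (family_pvm {a<..b} (family_pvm {b<..c} ?z))"
    by (rule selfadj_inner[OF orth_projector_selfadj[OF projector_pvm]]) simp
  also have "family_pvm {a<..b} (family_pvm {b<..c} ?z) = family_pvm ({a<..b} \<inter> {b<..c}) ?z"
    by (rule fam.E_Int) (use V in auto)
  also have "{a<..b} \<inter> {b<..c} = {}" by auto
  finally show "inner ?y ?z = 0" by (simp add: fam.E_empty V)
qed

lemma interval_form_integral:
  assumes ab: "a \<le> b" and x: "x \<in> V"
  shows "inner (oapp M (family_pvm {a<..b} x)) x = (\<integral>t. indicator {a<..b} t * t \<partial>\<mu> x)"
proof (rule interval_integral_eqI[where K = 1 and lo = a and hi = b])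
  show "finite_measure (\<mu> x)" by (rule fam.finite_scalar_measure[OF x])
  fix c d e assume "a \<le> c" "c \<le> d" "d \<le> e" "e \<le> b"
  then show "inner (oapp M (family_pvm {c<..e} x)) x
      = inner (oapp M (family_pvm {c<..d} x)) x + inner (oapp M (family_pvm {d<..e} x)) x"
    using oapp_interval_split(1)[of c d e, OF _ _ x] by (simp add: inner_add_left)
next
  fix c d assume cd: "a \<le> c" "c \<le> d" "d \<le> b"
  let ?z = "family_pvm {c<..d} x"
  have "inner (oapp M ?z) x = inner (oapp M ?z) ?z"
    using selfadj_inner[OF orth_projector_selfadj[OF projector_pvm[of "{c<..d}"]], of "oapp M ?z" x]
    by (simp add: oapp_interval cd)
  then have "\<bar>inner (oapp M ?z) x - c * (norm ?z)\<^sup>2\<bar> = \<bar>inner (oapp M ?z - c *\<^sub>R ?z) ?z\<bar>"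
    by (simp add: inner_diff_left power2_norm_eq_inner)
  also have "\<dots> \<le> norm (oapp M ?z - c *\<^sub>R ?z) * norm ?z" by (rule Cauchy_Schwarz_ineq2)
  also have "\<dots> \<le> ((d - c) * norm ?z) * norm ?z"
    by (intro mult_right_mono interval_in_domain(2) cd) auto
  finally show "\<bar>inner (oapp M ?z) x - c * measure (\<mu> x) {c<..d}\<bar>
      \<le> 1 * (d - c) * measure (\<mu> x) {c<..d}"
    by (simp add: fam.measure_scalar_measure[OF x] power2_eq_square mult.assoc)
qed (use ab in auto)

lemma interval_norm_integral:
  assumes ab: "a \<le> b" and x: "x \<in> V"
  shows "(norm (oapp M (family_pvm {a<..b} x)))\<^sup>2 = (\<integral>t. indicator {a<..b} t * t\<^sup>2 \<partial>\<mu> x)"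
proof (rule interval_integral_eqI[where K = "4 * (\<bar>a\<bar> + \<bar>b\<bar>)" and lo = a and hi = b])
  show "finite_measure (\<mu> x)" by (rule fam.finite_scalar_measure[OF x])
  fix c t assume ct: "a \<le> c" "c \<le> t" "t \<le> b"
  have "\<bar>t\<^sup>2 - c\<^sup>2\<bar> = \<bar>t + c\<bar> * (t - c)" using ct
    by (simp add: power2_eq_square square_diff_square_factored abs_mult)
  also have "\<dots> \<le> 4 * (\<bar>a\<bar> + \<bar>b\<bar>) * (t - c)" using ct by (intro mult_right_mono) auto
  finally show "\<bar>t\<^sup>2 - c\<^sup>2\<bar> \<le> 4 * (\<bar>a\<bar> + \<bar>b\<bar>) * (t - c)" .
next
  fix c d e assume "a \<le> c" "c \<le> d" "d \<le> e" "e \<le> b"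
  then show "(norm (oapp M (family_pvm {c<..e} x)))\<^sup>2
      = (norm (oapp M (family_pvm {c<..d} x)))\<^sup>2 + (norm (oapp M (family_pvm {d<..e} x)))\<^sup>2"
    using oapp_interval_split[of c d e, OF _ _ x]
    by (simp add: power2_norm_eq_inner inner_add_left inner_add_right inner_commute)
next
  fix c d assume cd: "a \<le> c" "c \<le> d" "d \<le> b"
  let ?z = "family_pvm {c<..d} x"
  have close: "norm (oapp M ?z - c *\<^sub>R ?z) \<le> (d - c) * norm ?z"
    by (rule interval_in_domain(2)[OF cd(2)])
  have diff: "\<bar>norm (oapp M ?z) - \<bar>c\<bar> * norm ?z\<bar> \<le> (d - c) * norm ?z"
    using norm_triangle_ineq3[of "oapp M ?z" "c *\<^sub>R ?z"] close by simp
  have "norm (oapp M ?z) + \<bar>c\<bar> * norm ?z \<le> ((d - c) + 2 * \<bar>c\<bar>) * norm ?z"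
    using diff by (simp add: algebra_simps)
  also have "\<dots> \<le> 4 * (\<bar>a\<bar> + \<bar>b\<bar>) * norm ?z" using cd by (intro mult_right_mono) auto
  finally have sum: "norm (oapp M ?z) + \<bar>c\<bar> * norm ?z \<le> 4 * (\<bar>a\<bar> + \<bar>b\<bar>) * norm ?z" .
  have "\<bar>(norm (oapp M ?z))\<^sup>2 - c\<^sup>2 * (norm ?z)\<^sup>2\<bar>
      = \<bar>(norm (oapp M ?z) + \<bar>c\<bar> * norm ?z) * (norm (oapp M ?z) - \<bar>c\<bar> * norm ?z)\<bar>"
    by (simp add: algebra_simps power2_eq_square)
  also have "\<dots> = (norm (oapp M ?z) + \<bar>c\<bar> * norm ?z) * \<bar>norm (oapp M ?z) - \<bar>c\<bar> * norm ?z\<bar>"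
    by (simp add: abs_mult)
  also have "\<dots> \<le> (4 * (\<bar>a\<bar> + \<bar>b\<bar>) * norm ?z) * ((d - c) * norm ?z)"
    by (intro mult_mono sum diff) auto
  finally show "\<bar>(norm (oapp M ?z))\<^sup>2 - c\<^sup>2 * measure (\<mu> x) {c<..d}\<bar>
      \<le> 4 * (\<bar>a\<bar> + \<bar>b\<bar>) * (d - c) * measure (\<mu> x) {c<..d}"
    by (simp add: fam.measure_scalar_measure[OF x] power2_eq_square mult_ac)
qed (use ab in auto)

abbreviation "window n \<equiv> {- real n<..real n}"

lemma pvm_window_tendsto:
  assumes "x \<in> V"
  shows "(\<lambda>n. family_pvm (window n) x) \<longlonglongrightarrow> x"
  using tendsto_diff[OF spectral_at_top[of x] spectral_at_bot[of x]] assms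
  by (simp add: pvm_Ioc proj_V_id)

lemma window_tendsto: "(\<lambda>n. indicator (window n) t * f t) \<longlonglongrightarrow> (f t :: real)"
proof (rule tendsto_eventually)
  obtain N where N: "\<bar>t\<bar> < real N" using reals_Archimedean2 by blast
  have "indicator (window n) t * f t = f t" if "N \<le> n" for n
  proof -
    have "- real n < t \<and> t \<le> real n" using N that by (simp add: abs_less_iff)
    then show ?thesis by simp
  qed
  then show "\<forall>\<^sub>F n in sequentially. indicator (window n) t * f t = f t"
    by (rule eventually_sequentiallyI)
qed

lemma square_le_if_abs_le: "\<bar>t\<bar> \<le> real n \<Longrightarrow> \<bar>t\<^sup>2\<bar> \<le> (real n)\<^sup>2"
  using abs_le_square_iff[of t "real n"] by simp

lemma integrable_window:
  fixes f :: "real \<Rightarrow> real"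
  assumes x: "x \<in> V" and f: "f \<in> borel_measurable borel" "\<And>t. \<bar>t\<bar> \<le> real n \<Longrightarrow> \<bar>f t\<bar> \<le> C"
  shows "integrable (\<mu> x) (\<lambda>t. indicator (window n) t * f t)"
proof -
  interpret finite_measure "\<mu> x" by (rule fam.finite_scalar_measure[OF x])
  show ?thesis
  proof (rule integrable_const_bound[where B = "\<bar>C\<bar>"])
    have "norm (indicator (window n) t * f t) \<le> \<bar>C\<bar>" for t
    proof (cases "t \<in> window n")
      case True
      then have "\<bar>t\<bar> \<le> real n" by auto
      from f(2)[OF this] show ?thesis using True by simp
    qed simp
    then show "AE t in \<mu> x. norm (indicator (window n) t * f t) \<le> \<bar>C\<bar>" by simp
    have [measurable]: "f \<in> borel_measurable (\<mu> x)"
      using f(1) by (simp add: measurable_def)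
    show "(\<lambda>t. indicator (window n) t * f t) \<in> borel_measurable (\<mu> x)" by simp
  qed
qed

lemma integrable_window_square:
  assumes "x \<in> V"
  shows "integrable (\<mu> x) (\<lambda>t. indicator (window n) t * t\<^sup>2)"
proof (rule integrable_window[OF assms])
  show "\<bar>t\<^sup>2\<bar> \<le> (real n)\<^sup>2" if "\<bar>t\<bar> \<le> real n" for t by (rule square_le_if_abs_le[OF that])
qed simp

text \<open>
  For \<open>x\<close> in the domain \<open>Q\<close> commutes with the cut-off to \<open>(-n, n]\<close>, so \<open>\<parallel>Q x\<parallel>\<^sup>2\<close> is the limit of the
  truncated second moments; the first moments converge by domination.
\<close>

lemma domain_integrals:
  assumes x: "x \<in> odom M"
  shows "integrable (\<mu> x) (\<lambda>t. t\<^sup>2)"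
    and "inner (oapp M x) x = (\<integral>t. t \<partial>\<mu> x)"
proof -
  have xV: "x \<in> V" and QV: "oapp M x \<in> V" using oapp_in[OF x] G_in by auto
  interpret finite_measure "\<mu> x" by (rule fam.finite_scalar_measure[OF xV])
  have lim: "(\<lambda>n. family_pvm (window n) (oapp M x)) \<longlonglongrightarrow> oapp M x" by (rule pvm_window_tendsto[OF QV])
  have Q: "oapp M (family_pvm (window n) x) = family_pvm (window n) (oapp M x)" for n
    by (rule oapp_pvm(2)[OF _ x]) simp
  show int: "integrable (\<mu> x) (\<lambda>t. t\<^sup>2)"
  proof (rule integrable_monotone_convergence[where f = "\<lambda>n t. indicator (window n) t * t\<^sup>2"])
    show "integrable (\<mu> x) (\<lambda>t. indicator (window n) t * t\<^sup>2)" for n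
      by (rule integrable_window_square[OF xV])
    show "AE t in \<mu> x. mono (\<lambda>n. indicator (window n) t * t\<^sup>2)"
      by (intro AE_I2 monoI) (auto simp: indicator_def)
    show "AE t in \<mu> x. (\<lambda>n. indicator (window n) t * t\<^sup>2) \<longlonglongrightarrow> t\<^sup>2"
      by (intro AE_I2 window_tendsto)
    have "(\<lambda>n. (norm (family_pvm (window n) (oapp M x)))\<^sup>2) \<longlonglongrightarrow> (norm (oapp M x))\<^sup>2"
      by (intro tendsto_intros lim)
    then show "(\<lambda>n. \<integral>t. indicator (window n) t * t\<^sup>2 \<partial>\<mu> x) \<longlonglongrightarrow> (norm (oapp M x))\<^sup>2"
      by (simp add: interval_norm_integral[OF _ xV, symmetric] Q)
  qed simp
  have "(\<lambda>n. \<integral>t. indicator (window n) t * t \<partial>\<mu> x) \<longlonglongrightarrow> (\<integral>t. t \<partial>\<mu> x)"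
  proof (rule integral_dominated_convergence[where w = "\<lambda>t. 1 + t\<^sup>2"])
    show "integrable (\<mu> x) (\<lambda>t. 1 + t\<^sup>2)" by (intro Bochner_Integration.integrable_add int) simp
    show "AE t in \<mu> x. (\<lambda>n. indicator (window n) t * t) \<longlonglongrightarrow> t"
      by (intro AE_I2 window_tendsto)
    have "norm (indicator (window n) t * t) \<le> 1 + t\<^sup>2" for n and t :: real
    proof -
      have "0 \<le> (\<bar>t\<bar> - 1)\<^sup>2" by simp
      then have "2 * \<bar>t\<bar> \<le> 1 + t\<^sup>2" by (simp add: power2_diff)
      then show ?thesis by (auto simp: indicator_def)
    qed
    then show "AE t in \<mu> x. norm (indicator (window n) t * t) \<le> 1 + t\<^sup>2" for n by simp
  qed simp_all
  moreover have "(\<lambda>n. \<integral>t. indicator (window n) t * t \<partial>\<mu> x) \<longlonglongrightarrow> inner (oapp M x) x"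
    using tendsto_inner[OF lim tendsto_const[of x]]
      by (simp add: interval_form_integral[OF _ xV, symmetric] Q)
  ultimately show "inner (oapp M x) x = (\<integral>t. t \<partial>\<mu> x)" by (rule LIMSEQ_unique[rotated])
qed

text \<open>
  If the second moment is finite, the truncated second moments bound the vectors \<open>Q\<close> applied to the
  cut-offs of \<open>x\<close>.  The increments of these vectors are orthogonal, so they converge; the graph is
  closed.
\<close>

lemma domain_if_integrable:
  assumes x: "x \<in> V" and int: "integrable (\<mu> x) (\<lambda>t. t\<^sup>2)"
  shows "x \<in> odom M"
proof -
  let ?y = "\<lambda>n. oapp M (family_pvm (window n) x)"
  have G: "(family_pvm (window n) x, ?y n) \<in> G" for n by (rule oapp_in[OF interval_in_domain(1)]) simp
  have "Cauchy ?y"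
  proof (rule Cauchy_by_increasing_real)
    fix m n :: nat assume mn: "m \<le> n"
    have "family_pvm (window m) (family_pvm (window n) x) = family_pvm (window m \<inter> window n) x"
      by (rule fam.E_Int) (use x in auto)
    also have "window m \<inter> window n = window m" using mn by auto
    finally have "?y m = family_pvm (window m) (?y n)"
      using oapp_pvm(2)[of "window m", OF _ odomI[OF G[of n]]] by simp
    then show "(norm (?y n - ?y m))\<^sup>2 \<le> (norm (?y n))\<^sup>2 - (norm (?y m))\<^sup>2"
      using orth_projector_pythagoras[OF projector_pvm[of "window m"], of "?y n"] by simp
  next
    fix n
    have "(norm (?y n))\<^sup>2 = (\<integral>t. indicator (window n) t * t\<^sup>2 \<partial>\<mu> x)"
      by (rule interval_norm_integral[OF _ x]) simp
    also have "\<dots> \<le> (\<integral>t. t\<^sup>2 \<partial>\<mu> x)"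
      by (rule integral_mono[OF integrable_window_square[OF x] int]) (auto simp: indicator_def)
    finally show "(norm (?y n))\<^sup>2 \<le> (\<integral>t. t\<^sup>2 \<partial>\<mu> x)" .
  qed
  then obtain y where y: "?y \<longlonglongrightarrow> y" using Cauchy_convergent convergentD by blast
  have "(x, y) \<in> G"
    by (rule closed_sequentially[OF closed_G G tendsto_Pair[OF pvm_window_tendsto[OF x] y]])
  then show ?thesis by (rule odomI)
qed

lemma oapp_form_real:
  assumes "x \<in> odom M"
  shows "cinner (oapp M x) x = complex_of_real (inner (oapp M x) x)"
proof (rule complex_eqI)
  have "cinner (oapp M x) x = cnj (cinner (oapp M x) x)"
    using csymmetric[OF oapp_in[OF assms] oapp_in[OF assms]] cinner_commute[of x "oapp M x"] by simp
  then have "Im (cinner (oapp M x) x) = Im (cnj (cinner (oapp M x) x))" by (rule arg_cong)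
  then show "Im (cinner (oapp M x) x) = Im (complex_of_real (inner (oapp M x) x))" by simp
qed (simp add: Re_cinner)

lemma spectral_resolution_family: "spectral_resolution M family_pvm"
  unfolding spectral_resolution_def
proof (intro conjI ballI)
  show "projection_valued_measure V family_pvm" by (rule projection_valued_measure_family)
  show "odom M = {x \<in> V. integrable (scalar_measure family_pvm x) (\<lambda>t. t\<^sup>2)}"
    using domain_integrals(1) domain_if_integrable odom_subset by fast
  show "cinner (oapp M x) x = complex_of_real (\<integral>t. t \<partial>scalar_measure family_pvm x)"
      if "x \<in> odom M" for x
    by (simp only: oapp_form_real[OF that] domain_integrals(2)[OF that])
qed

end

section \<open>Automorphisms and the uniqueness of the spectral resolution\<close>

text \<open>
  Complex polarization with the vectors \<open>x + y\<close> and \<open>x + \<i> y\<close>.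
\<close>

lemma form_polarization:
  fixes S T :: "'a::complex_inner \<Rightarrow> 'a"
  assumes W: "csubspace W" and S: "clinear_on W S" and T: "clinear_on W T"
    and 0: "\<And>x. x \<in> W \<Longrightarrow> cinner (T x) (S x) = 0" and xy: "x \<in> W" "y \<in> W"
  shows "cinner (T x) (S y) = 0"
proof -
  have lin: "T (u + v) = T u + T v" "T (c *\<^sub>C u) = c *\<^sub>C T u" "S (u + v) = S u + S v"
      "S (c *\<^sub>C u) = c *\<^sub>C S u"
    if "u \<in> W" "v \<in> W" for u v c
    using S T that by (auto simp: clinear_on_def)
  have sum: "cinner (T x) (S u) + cinner (T u) (S x) = 0" if "u \<in> W" for u
    using 0[OF csubspaceD(2)[OF W xy(1) that]] 0[OF xy(1)] 0[OF that] lin[OF xy(1) that]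
    by (simp add: cinner_add_left cinner_add_right add_ac)
  have "\<i> * (cinner (T y) (S x) - cinner (T x) (S y)) = 0"
    using sum[OF csubspaceD(3)[OF W xy(2), of \<i>]] lin(2,4)[OF xy(2,2), of \<i>]
    by (simp add: cinner_scaleC_left cinner_scaleC_right algebra_simps)
  then show ?thesis using sum[OF xy(2)] by simp
qed

lemma orthogonal_to_dense:
  assumes "x \<in> closure W" "\<And>w. w \<in> W \<Longrightarrow> inner x w = 0"
  shows "x = 0"
proof -
  obtain f where f: "\<And>n. f n \<in> W" "f \<longlonglongrightarrow> x" using assms(1) unfolding closure_sequential by blast
  have "(\<lambda>n. inner x (f n)) \<longlonglongrightarrow> inner x x" by (intro tendsto_intros f(2))
  then have "inner x x = 0" using f(1) assms(2) by (simp add: LIMSEQ_const_iff)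
  then show ?thesis by simp
qed

lemma unitary_on_norm:
  assumes "unitary_on V U" "x \<in> V"
  shows "norm (U x) = norm x"
proof (rule power2_eq_imp_eq)
  have "cinner (U x) (U x) = cinner x x" using assms by (simp add: unitary_on_def)
  then show "(norm (U x))\<^sup>2 = (norm x)\<^sup>2" unfolding cinner_self by (simp only: of_real_eq_iff)
qed auto

lemma unitary_on_in: "unitary_on V U \<Longrightarrow> x \<in> V \<Longrightarrow> U x \<in> V"
  by (auto simp: unitary_on_def bij_betw_def)

lemma unitary_on_reflection:
  assumes V: "csubspace V" and P: "projection_on V P"
  shows "unitary_on V (\<lambda>x. 2 *\<^sub>R P x - x)"
proof -
  have PV: "P x \<in> V" "P (P x) = P x" "P (c *\<^sub>C x) = c *\<^sub>C P x" if "x \<in> V" for x c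
    using P that by (auto simp: projection_on_def bounded_op_on_def clinear_on_def image_subset_iff)
  have add: "P (x + y) = P x + P y" "cinner (P x) y = cinner x (P y)" if "x \<in> V" "y \<in> V" for x y
    using P that by (auto simp: projection_on_def bounded_op_on_def clinear_on_def)
  have R: "P (r *\<^sub>R x) = r *\<^sub>R P x" if "x \<in> V" for r x
    using PV(3)[OF that, of "complex_of_real r"] by (simp add: scaleC_of_real)
  have diff: "P (x - y) = P x - P y" if "x \<in> V" "y \<in> V" for x y
    using add(1)[OF that(1), of "- y"] R[OF that(2), of "-1"] csubspaceD(6)[OF V that(2)] by simp
  let ?U = "\<lambda>x. 2 *\<^sub>R P x - x"
  have UV: "?U x \<in> V" if "x \<in> V" for x
    using PV(1)[OF that] that by (intro csubspaceD(4,5)[OF V])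
  have UU: "?U (?U x) = x" if "x \<in> V" for x
  proof -
    have "P (?U x) = 2 *\<^sub>R P (P x) - P x"
      using PV(1)[OF that] that csubspaceD(5)[OF V, of "P x" 2] by (simp add: diff R)
    then show ?thesis by (simp add: PV(2)[OF that] scaleR_2)
  qed
  have "bij_betw ?U V V" by (rule bij_betw_byWitness[where f' = ?U]) (use UU UV in auto)
  moreover have "clinear_on V ?U"
    by (auto simp: clinear_on_def add PV scaleR_add_right scaleC_diff_right scaleC_scaleR)
  moreover have "cinner (?U x) (?U y) = cinner x y" if "x \<in> V" "y \<in> V" for x y
  proof -
    have *: "cinner (P x) (P y) = cinner x (P y)"
      using add(2)[OF that(1) PV(1)[OF that(2)]] PV(2)[OF that(2)] by simp
    have sc: "2 *\<^sub>R z = complex_of_real 2 *\<^sub>C z" for z :: 'a by (simp only: scaleC_of_real)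
    show ?thesis
      unfolding sc by (simp add: cinner_diff_left cinner_diff_right cinner_scaleC_left cinner_scaleC_right add(2)[OF that] *)
  qed
  ultimately show ?thesis by (simp add: unitary_on_def)
qed

context selfadjoint_operator
begin

lemma resolution_pvm: "spectral_resolution M F \<Longrightarrow> pvm V F"
  by unfold_locales (simp_all add: csubspace_V spectral_resolution_def)

lemma automorphismD:
  assumes "automorphism M U"
  shows "unitary_on V U" "(x, y) \<in> G \<Longrightarrow> (U x, U y) \<in> G"
proof -
  show "unitary_on V U" using assms by (simp add: automorphism_def)
  assume xy: "(x, y) \<in> G"
  have "U x \<in> odom M" "U y = oapp M (U x)"
    using assms odomI[OF xy] oapp_eq[OF xy] by (auto simp: automorphism_def)
  then show "(U x, U y) \<in> G" using oapp_in by simp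
qed

text \<open>
  A unitary that commutes with a spectral resolution preserves the scalar measures, hence the
  domain and, by polarization, the quadratic form of \<open>Q\<close>.
\<close>

lemma automorphism_if_commuting_resolution:
  assumes F: "spectral_resolution M F" and U: "unitary_on V U"
    and com: "\<And>B x. B \<in> sets borel \<Longrightarrow> x \<in> V \<Longrightarrow> U (F B x) = F B (U x)"
  shows "automorphism M U"
proof -
  interpret F: pvm V F
    by (rule resolution_pvm[OF F])
  have dom: "odom M = {x \<in> V. integrable (scalar_measure F x) (\<lambda>t. t\<^sup>2)}"
    and form: "\<And>x. x \<in> odom M \<Longrightarrow> cinner (oapp M x) x = complex_of_real (\<integral>t. t \<partial>scalar_measure F x)"
    using F by (auto simp: spectral_resolution_def)
  note UV = unitary_on_in[OF U]
  have Uc: "cinner (U x) (U y) = cinner x y" if "x \<in> V" "y \<in> V" for x y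
    using U that by (simp add: unitary_on_def)
  have Ulin: "clinear_on V U" and Usurj: "U ` V = V" using U by (auto simp: unitary_on_def bij_betw_def)
  have meas: "scalar_measure F (U x) = scalar_measure F x" if x: "x \<in> V" for x
    by (rule F.scalar_measure_invariant) (simp add: com[symmetric] x Uc F.E_in)
  have Udom: "U x \<in> odom M \<longleftrightarrow> x \<in> odom M" if "x \<in> V" for x
    unfolding dom using meas[OF that] UV[OF that] that by simp
  have Uodom: "U ` odom M = odom M"
  proof
    show "U ` odom M \<subseteq> odom M" using Udom odom_subset by auto
    show "odom M \<subseteq> U ` odom M"
    proof
      fix y assume y: "y \<in> odom M"
      then have "y \<in> U ` V" unfolding Usurj using odom_subset by auto
      then obtain x where "x \<in> V" "y = U x" by blast
      then show "y \<in> U ` odom M" using y Udom by auto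
    qed
  qed
  have QV: "oapp M x \<in> V" if "x \<in> odom M" for x using G_in(2)[OF oapp_in[OF that]] .
  have oV: "x \<in> V" if "x \<in> odom M" for x using that odom_subset by auto
  have oU: "U x \<in> odom M" if "x \<in> odom M" for x using Udom[OF oV[OF that]] that by simp
  let ?T = "\<lambda>x. oapp M (U x) - U (oapp M x)"
  have Tlin: "clinear_on (odom M) ?T"
    using clinear_oapp Ulin QV oV oU by (auto simp: clinear_on_def scaleC_diff_right)
  have UW: "clinear_on (odom M) U" using Ulin oV by (auto simp: clinear_on_def)
  have form0: "cinner (?T x) (U x) = 0" if x: "x \<in> odom M" for x
    using form[OF x] form[OF oU[OF x]] meas[OF oV[OF x]] by (simp add: cinner_diff_left Uc QV oV x)
  have "U (oapp M x) = oapp M (U x)" if x: "x \<in> odom M" for x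
  proof -
    have "?T x = 0"
    proof (rule orthogonal_to_dense)
      have "?T x \<in> V" using QV[OF oU[OF x]] UV[OF QV[OF x]] by (rule csubspaceD(4)[OF csubspace_V])
      then show "?T x \<in> closure (odom M)" using dense by auto
      fix w assume "w \<in> odom M"
      then have "w \<in> U ` odom M" unfolding Uodom .
      then obtain y where y: "y \<in> odom M" "w = U y" by blast
      have "cinner (?T x) (U y) = 0" by (rule form_polarization[OF csubspace_odom UW Tlin form0 x y(1)])
      then show "inner (?T x) w = 0" using y(2) by (simp flip: Re_cinner)
    qed
    then show ?thesis by simp
  qed
  with U Uodom show ?thesis by (simp add: automorphism_def)
qed

text \<open>
  Operators defined on \<open>V\<close> only are extended by 0 on the orthogonal complement, so that the
  commutation lemmas for operators on the ambient space apply.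
\<close>

lemma unitary_extension:
  assumes U: "clinear_on V U" "\<And>x. x \<in> V \<Longrightarrow> U x \<in> V" "\<And>x. x \<in> V \<Longrightarrow> norm (U x) \<le> norm x"
  shows "bounded_linear (\<lambda>x. U (proj_V x))" "commuting (\<lambda>x. U (proj_V x)) proj_V"
proof -
  note lin = orth_projector_simps[OF projector_V]
  have add: "U (x + y) = U x + U y" if "x \<in> V" "y \<in> V" for x y using U(1) that
    by (simp add: clinear_on_def)
  have sc: "U (r *\<^sub>R x) = r *\<^sub>R U x" if "x \<in> V" for r x
    using U(1) that unfolding clinear_on_def by (metis scaleC_of_real)
  show "bounded_linear (\<lambda>x. U (proj_V x))"
  proof (rule bounded_linear_intro[where K = 1])
    show "norm (U (proj_V x)) \<le> norm x * 1" for x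
      using order_trans[OF U(3)[OF proj_V_in] orth_projector_norm_le[OF projector_V]] by simp
  qed (simp_all add: lin add sc proj_V_in)
  show "commuting (\<lambda>x. U (proj_V x)) proj_V"
    by (simp add: commuting_def lin proj_V_id U(2) proj_V_in)
qed

lemma G_preserving_commutes:
  assumes U: "clinear_on V U" "\<And>x. x \<in> V \<Longrightarrow> U x \<in> V" "\<And>x. x \<in> V \<Longrightarrow> norm (U x) \<le> norm x"
    and G: "\<And>x y. (x, y) \<in> G \<Longrightarrow> (U x, U y) \<in> G" and B: "B \<in> sets borel" and x: "x \<in> V"
  shows "U (family_pvm B x) = family_pvm B (U x)"
proof -
  let ?T = "\<lambda>x. U (proj_V x)"
  note T = unitary_extension[OF U]
  have inv: "(?T x, ?T y) \<in> G" if "(x, y) \<in> G" for x y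
    using G[OF that] G_in[OF that] by (simp add: proj_V_id)
  have Tproj: "?T x = ?T (proj_V x)" for x by (simp add: orth_projector_simps[OF projector_V])
  have "commuting ?T (family_pvm B)"
    by (rule commuting_smooth_pvm[OF T(1) commuting_if_G_invariant[OF T(1) Tproj inv] T(2) B])
  then have "?T (family_pvm B x) = family_pvm B (?T x)" by (rule commutingD)
  then show ?thesis by (simp add: proj_V_id x pvm_in[OF B])
qed

text \<open>
  The reflection \<open>2 F(B) - 1\<close> commutes with \<open>F\<close>, so it is an automorphism; averaging it with the
  identity shows that \<open>F(B)\<close> preserves the graph of \<open>Q\<close>.
\<close>

lemma resolution_commutes_family:
  assumes F: "spectral_resolution M F" and B: "B \<in> sets borel" and C: "C \<in> sets borel" and x: "x \<in> V"
  shows "F B (family_pvm C x) = family_pvm C (F B x)"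
proof -
  interpret F: pvm V F
    by (rule resolution_pvm[OF F])
  have P: "projection_on V (F B)" using F.pvm B by (simp add: projection_valued_measure_def)
  have "automorphism M (\<lambda>x. 2 *\<^sub>R F B x - x)"
  proof (rule automorphism_if_commuting_resolution[OF F unitary_on_reflection[OF csubspace_V P]])
    fix D :: "real set" and x assume D: "D \<in> sets borel" and x: "x \<in> V"
    show "2 *\<^sub>R F B (F D x) - F D x = F D (2 *\<^sub>R F B x - x)"
      using csubspaceD(5)[OF csubspace_V F.E_in[OF B x]]
      by (simp add: F.E_diff F.E_scaleR F.E_Int B D x F.E_in Int_commute)
  qed
  note refl = automorphismD(2)[OF this]
  have "(F B x, F B y) \<in> G" if "(x, y) \<in> G" for x y
    using G_scaleR[OF G_add[OF refl[OF that] that], of "1/2"] by simp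
  moreover have "clinear_on V (F B)" by (simp add: clinear_on_def F.E_add F.E_scaleC B)
  ultimately show ?thesis
    by (intro G_preserving_commutes[of "F B", OF _ _ _ _ C x] F.E_in F.norm_E_le B)
qed

text \<open>
  The scalar measure of \<open>x\<close> is concentrated on \<open>(-\<infinity>, l]\<close> for \<open>E\<close> and on \<open>(l, \<infinity>)\<close> for \<open>F\<close>, but both
  measures have the same total mass \<open>\<parallel>x\<parallel>\<^sup>2\<close> and the same first moment \<open>\<langle>Q x, x\<rangle>\<close>.
\<close>

lemma halfline_comparison:
  assumes E: "spectral_resolution M E" and F: "spectral_resolution M F" and x: "x \<in> odom M"
    and Ex: "E {..l} x = x" and Fx: "F {..l} x = 0"
  shows "x = 0"
proof -
  interpret E: pvm V E
    by (rule resolution_pvm[OF E])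
  interpret F: pvm V F
    by (rule resolution_pvm[OF F])
  have xV: "x \<in> V" using x odom_subset by auto
  interpret Em: finite_measure "scalar_measure E x" by (rule E.finite_scalar_measure[OF xV])
  interpret Fm: finite_measure "scalar_measure F x" by (rule F.finite_scalar_measure[OF xV])
  have sq: "integrable (scalar_measure E x) (\<lambda>t. t\<^sup>2)" "integrable (scalar_measure F x) (\<lambda>t. t\<^sup>2)"
    using E F x by (auto simp: spectral_resolution_def)
  have bound: "AE t in \<mu>. norm t \<le> norm (1 + t\<^sup>2)" for \<mu> :: "real measure"
  proof (rule AE_I2)
    fix t :: real
    have "0 \<le> (\<bar>t\<bar> - 1)\<^sup>2" by simp
    then show "norm t \<le> norm (1 + t\<^sup>2)" by (simp add: power2_diff)
  qed
  have intE: "integrable (scalar_measure E x) (\<lambda>t. t)"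
    by (rule Bochner_Integration.integrable_bound[OF Bochner_Integration.integrable_add[OF Em.integrable_const[of 1] sq(1)] _ bound]) simp
  have intF: "integrable (scalar_measure F x) (\<lambda>t. t)"
    by (rule Bochner_Integration.integrable_bound[OF Bochner_Integration.integrable_add[OF Fm.integrable_const[of 1] sq(2)] _ bound]) simp
  have "cinner (oapp M x) x = complex_of_real (\<integral>t. t \<partial>scalar_measure E x)"
    using E x unfolding spectral_resolution_def by blast
  moreover have "cinner (oapp M x) x = complex_of_real (\<integral>t. t \<partial>scalar_measure F x)"
    using F x unfolding spectral_resolution_def by blast
  ultimately have eq: "(\<integral>t. t \<partial>scalar_measure E x) = (\<integral>t. t \<partial>scalar_measure F x)" by simp
  have mE: "measure (scalar_measure E x) UNIV = (norm x)\<^sup>2"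
      and mF: "measure (scalar_measure F x) UNIV = (norm x)\<^sup>2"
    by (simp_all add: E.measure_scalar_measure F.measure_scalar_measure xV E.E_UNIV F.E_UNIV)
  have "E {l<..} x = E ({l<..} \<inter> {..l}) x" using E.E_Int[of "{l<..}" "{..l}" x] Ex xV by simp
  moreover have "{l<..} \<inter> {..l} = {}" by auto
  ultimately have "E {l<..} x = 0" by (simp add: E.E_empty xV)
  then have "emeasure (scalar_measure E x) {l<..} = 0" by (simp add: E.emeasure_scalar_measure xV)
  then have AE_E: "AE t in scalar_measure E x. t \<le> l"
    by (intro AE_I[of _ _ "{l<..}"]) auto
  have "emeasure (scalar_measure F x) {..l} = 0" by (simp add: F.emeasure_scalar_measure xV Fx)
  then have AE_F: "AE t in scalar_measure F x. l < t"
    by (intro AE_I[of _ _ "{..l}"]) auto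
  have "(\<integral>t. t \<partial>scalar_measure E x) \<le> (\<integral>t. l \<partial>scalar_measure E x)"
    by (rule integral_mono_AE[OF intE _ AE_E]) simp
  then have "(\<integral>t. t - l \<partial>scalar_measure F x) \<le> 0"
    using eq intF by (simp add: mE mF)
  moreover have "0 \<le> (\<integral>t. t - l \<partial>scalar_measure F x)"
    by (rule integral_nonneg_AE) (use AE_F in \<open>auto elim: eventually_mono\<close>)
  ultimately have "(\<integral>t. t - l \<partial>scalar_measure F x) = 0" by simp
  then have "AE t in scalar_measure F x. t - l = 0"
    by (subst (asm) integral_nonneg_eq_0_iff_AE) (use AE_F intF in \<open>auto elim: eventually_mono\<close>)
  with AE_F have "AE t in scalar_measure F x. False" by eventually_elim simp
  then have "emeasure (scalar_measure F x) UNIV = 0"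
    by (subst (asm) AE_iff_measurable[where N = UNIV]) auto
  then show ?thesis using mF by (simp add: measure_def)
qed

lemma halfline_domination:
  assumes E: "spectral_resolution M E" and F: "spectral_resolution M F" and x: "x \<in> V"
    and com: "\<And>x. x \<in> V \<Longrightarrow> E {..l} (F {..l} x) = F {..l} (E {..l} x)"
  shows "F {..l} (E {..l} x) = E {..l} x"
proof -
  interpret E: pvm V E
    by (rule resolution_pvm[OF E])
  interpret F: pvm V F
    by (rule resolution_pvm[OF F])
  define y where "y = E {..l} x - F {..l} (E {..l} x)"
  have yV: "y \<in> V" unfolding y_def by (intro csubspaceD(4)[OF csubspace_V] E.E_in F.E_in x) auto
  have Ey: "E {..l} y = y" "F {..l} y = 0"
    unfolding y_def by (simp_all add: E.E_diff F.E_diff E.E_in F.E_in x com E.E_idem F.E_idem)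
  \<comment> \<open>The cut-offs are in the domain and stay in both subspaces.\<close>
  have "family_pvm (window n) y = 0" for n
  proof (rule halfline_comparison[OF E F])
    show "family_pvm (window n) y \<in> odom M" by (rule interval_in_domain) simp
    show "E {..l} (family_pvm (window n) y) = family_pvm (window n) y"
      "F {..l} (family_pvm (window n) y) = 0"
      using resolution_commutes_family[OF E _ _ yV, of "{..l}" "window n"]
        resolution_commutes_family[OF F _ _ yV, of "{..l}" "window n"] Ey
      by (simp_all add: orth_projector_simps[OF projector_pvm])
  qed
  then have "y = 0" using pvm_window_tendsto[OF yV] by (simp add: LIMSEQ_const_iff)
  then show ?thesis by (simp add: y_def)
qed

lemma spectral_resolution_unique:
  assumes F: "spectral_resolution M F" and B: "B \<in> sets borel" and x: "x \<in> V"
  shows "F B x = family_pvm B x"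
proof -
  note E = spectral_resolution_family
  interpret F: pvm V F
    by (rule resolution_pvm[OF F])
  have com: "F {..l} (family_pvm {..l} x) = family_pvm {..l} (F {..l} x)" if "x \<in> V" for l x
    by (rule resolution_commutes_family[OF F _ _ that]) simp_all
  have half: "F {..l} x = family_pvm {..l} x" if x: "x \<in> V" for l x
  proof -
    have "F {..l} (family_pvm {..l} x) = family_pvm {..l} x"
      by (rule halfline_domination[OF E F x]) (rule com[symmetric])
    moreover have "family_pvm {..l} (F {..l} x) = F {..l} x"
      by (rule halfline_domination[OF F E x]) (rule com)
    ultimately show ?thesis using com[OF x, of l] by simp
  qed
  have meas: "scalar_measure F x = scalar_measure family_pvm x" if x: "x \<in> V" for x
  proof (rule measure_eqI_generator_eq[where E = "range atMost" and \<Omega> = UNIV and A = "\<lambda>n. {..real n}"])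
    show "Int_stable (range atMost :: real set set)" by (auto simp: Int_stable_def)
    show "emeasure (scalar_measure F x) X = emeasure (scalar_measure family_pvm x) X"
        if "X \<in> range atMost" for X
      using that by (auto simp: F.emeasure_scalar_measure fam.emeasure_scalar_measure x half)
    show "sets (scalar_measure F x) = sigma_sets UNIV (range atMost)"
      "sets (scalar_measure family_pvm x) = sigma_sets UNIV (range atMost)"
      by (simp_all add: borel_eq_atMost)
    show "(\<Union>i. {..real i}) = UNIV" using real_arch_simple by auto
    show "emeasure (scalar_measure F x) {..real i} \<noteq> \<infinity>" for i
      by (simp add: F.emeasure_scalar_measure x)
  qed auto
  let ?T = "\<lambda>x. F B x - family_pvm B x"
  have lin: "clinear_on V ?T"
    by (auto simp: clinear_on_def F.E_add fam.E_add F.E_scaleC fam.E_scaleC B scaleC_diff_right)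
  have id: "clinear_on V (\<lambda>x. x)" by (simp add: clinear_on_def)
  have form0: "cinner (?T x) x = 0" if x: "x \<in> V" for x
  proof -
    have "ennreal ((norm (F B x))\<^sup>2) = ennreal ((norm (family_pvm B x))\<^sup>2)"
      using F.emeasure_scalar_measure[OF x B] fam.emeasure_scalar_measure[OF x B] meas[OF x] by simp
    then show ?thesis by (simp add: cinner_diff_left F.E_cinner_self fam.E_cinner_self B x)
  qed
  have TV: "?T x \<in> V" by (intro csubspaceD(4)[OF csubspace_V] F.E_in fam.E_in B x)
  have "cinner (?T x) (?T x) = 0"
    using form_polarization[OF csubspace_V id lin form0 x TV] by simp
  then show ?thesis by (simp add: cinner_self)
qed

lemma spectral_resolution_spectral_measure: "spectral_resolution M (spectral_measure M)"
  unfolding spectral_measure_def by (rule someI[of _ family_pvm]) (rule spectral_resolution_family)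

sublocale spm: pvm V "spectral_measure M"
  by (rule resolution_pvm[OF spectral_resolution_spectral_measure])

abbreviation "\<E> \<equiv> spectral_measure M"

lemma automorphism_iff_commuting:
  assumes "unitary_on V U"
  shows "automorphism M U \<longleftrightarrow>
    (\<forall>B \<in> sets borel. \<forall>x\<in>V. U (\<E> B x) = \<E> B (U x))"
proof
  assume U: "automorphism M U"
  show "\<forall>B \<in> sets borel. \<forall>x\<in>V. U (\<E> B x) = \<E> B (U x)"
  proof (intro ballI)
    fix B :: "real set" and x assume B: "B \<in> sets borel" and x: "x \<in> V"
    have "U (family_pvm B x) = family_pvm B (U x)"
      by (rule G_preserving_commutes[OF _ unitary_on_in[OF assms] _ automorphismD(2)[OF U] B x])
         (use assms unitary_on_norm[OF assms] in \<open>auto simp: unitary_on_def\<close>)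
    then show "U (\<E> B x) = \<E> B (U x)"
      using spectral_resolution_unique[OF spectral_resolution_spectral_measure B] unitary_on_in[OF assms x] x
      by simp
  qed
next
  assume "\<forall>B \<in> sets borel. \<forall>x\<in>V. U (\<E> B x) = \<E> B (U x)"
  then show "automorphism M U"
    by (intro automorphism_if_commuting_resolution[OF spectral_resolution_spectral_measure assms]) simp
qed

end

section \<open>The bounded Borel functional calculus\<close>

lemma symmetric_form_norm_bound:
  fixes D :: "'a::real_inner \<Rightarrow> 'a"
  assumes W: "subspace W" and D: "\<And>x. x \<in> W \<Longrightarrow> D x \<in> W" "\<And>x y. x \<in> W \<Longrightarrow> y \<in> W \<Longrightarrow> D (x + y) = D x + D y"
    and scale: "\<And>r x. x \<in> W \<Longrightarrow> D (r *\<^sub>R x) = r *\<^sub>R D x"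
    and sym: "\<And>x y. x \<in> W \<Longrightarrow> y \<in> W \<Longrightarrow> inner (D x) y = inner x (D y)"
    and form: "\<And>x. x \<in> W \<Longrightarrow> \<bar>inner (D x) x\<bar> \<le> c * (norm x)\<^sup>2" and x: "x \<in> W"
  shows "norm (D x) \<le> c * norm x"
proof (cases "D x = 0 \<or> x = 0")
  case True
  show ?thesis
  proof (cases "x = 0")
    case False
    then have "0 \<le> c" using order_trans[OF abs_ge_zero form[OF x]] by (simp add: zero_le_mult_iff)
    then show ?thesis using True False by simp
  qed (use scale[OF x, of 0] in simp)
next
  case False
  \<comment> \<open>The multiple of \<open>D x\<close> that has the norm of \<open>x\<close>, so that both terms of the polarization balance.\<close>
  define y where "y = (norm x / norm (D x)) *\<^sub>R D x"
  have y: "y \<in> W" "- y \<in> W" unfolding y_def using D(1)[OF x] W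
    by (simp_all add: subspace_scale subspace_neg)
  have xy: "x + y \<in> W" "x - y \<in> W" using x y W by (simp_all add: subspace_add subspace_diff)
  have ny: "norm y = norm x" using False by (simp add: y_def)
  have Dm: "D (x - y) = D x - D y" using D(2)[OF x y(2)] scale[OF y(1), of "-1"] by simp
  have "4 * inner (D x) y = inner (D (x + y)) (x + y) - inner (D (x - y)) (x - y)"
    using sym[OF y(1) x] unfolding D(2)[OF x y(1)] Dm
    by (simp add: inner_add_left inner_add_right inner_diff_left inner_diff_right inner_commute)
  also have "\<dots> \<le> c * (norm (x + y))\<^sup>2 + c * (norm (x - y))\<^sup>2"
    using form[OF xy(1)] form[OF xy(2)] by linarith
  also have "\<dots> = 2 * c * ((norm x)\<^sup>2 + (norm y)\<^sup>2)"
    by (simp add: power2_norm_eq_inner inner_add_left inner_add_right inner_diff_left inner_diff_right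
        inner_commute algebra_simps)
  finally have "inner (D x) y \<le> c * (norm x)\<^sup>2" by (simp add: ny)
  moreover have "inner (D x) y = norm x * norm (D x)"
    using False by (simp add: y_def power2_norm_eq_inner[symmetric] power2_eq_square)
  ultimately have "norm x * norm (D x) \<le> norm x * (c * norm x)" by (simp add: power2_eq_square mult_ac)
  then show ?thesis using False by simp
qed

context pvm
begin

lemma subspace_V: "subspace V"
  by (rule csubspace_imp_subspace[OF csubspace])

definition level_set :: "(real \<Rightarrow> real) \<Rightarrow> nat \<Rightarrow> int \<Rightarrow> real set" where
  "level_set g n k = {t. \<lfloor>real (Suc n) * g t\<rfloor> = k}"

text \<open>
  The operator of the step function \<open>\<lfloor>(n + 1) g\<rfloor> / (n + 1)\<close>, for \<open>\<bar>g\<bar> \<le> c\<close>.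
\<close>

definition step_op :: "(real \<Rightarrow> real) \<Rightarrow> int \<Rightarrow> nat \<Rightarrow> 'a \<Rightarrow> 'a" where
  "step_op g c n x = (\<Sum>k\<in>{- c * int (Suc n)..c * int (Suc n)}. (real_of_int k / real (Suc n)) *\<^sub>R E (level_set g n k) x)"

context
  fixes g :: "real \<Rightarrow> real" and c :: int
  assumes g [measurable]: "g \<in> borel_measurable borel" and c: "\<And>t. \<bar>g t\<bar> \<le> real_of_int c"
begin

lemma level_set_borel: "level_set g n k \<in> sets borel"
  unfolding level_set_def by measurable

lemma step_op_in: "x \<in> V \<Longrightarrow> step_op g c n x \<in> V"
  unfolding step_op_def
  by (intro subspace_sum subspace_V subspace_scale E_in level_set_borel)

lemma step_op_linear:
  assumes "x \<in> V"
  shows "y \<in> V \<Longrightarrow> step_op g c n (x + y) = step_op g c n x + step_op g c n y"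
    and "step_op g c n (d *\<^sub>C x) = d *\<^sub>C step_op g c n x"
proof -
  show "step_op g c n (x + y) = step_op g c n x + step_op g c n y" if "y \<in> V"
    using assms that by (simp add: step_op_def E_add level_set_borel scaleR_add_right sum.distrib)
  show "step_op g c n (d *\<^sub>C x) = d *\<^sub>C step_op g c n x"
    using assms by (simp add: step_op_def E_scaleC level_set_borel scaleC_scaleR
        linear_sum[OF bounded_linear.linear[OF bounded_linear_scaleC]])
qed

lemma step_op_symmetric: "x \<in> V \<Longrightarrow> y \<in> V \<Longrightarrow> inner (step_op g c n x) y = inner x (step_op g c n y)"
  by (simp add: step_op_def inner_sum_left inner_sum_right E_inner level_set_borel)

lemma step_op_form:
  assumes x: "x \<in> V"
  shows "cinner (step_op g c n x) x
      = complex_of_real (\<integral>t. \<lfloor>real (Suc n) * g t\<rfloor> / real (Suc n) \<partial>scalar_measure E x)"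
proof -
  interpret finite_measure "scalar_measure E x" by (rule finite_scalar_measure[OF x])
  let ?I = "{- c * int (Suc n)..c * int (Suc n)}"
  have clin: "cinner (\<Sum>k\<in>I. f k) z = (\<Sum>k\<in>I. cinner (f k) z)" if "finite I" for I :: "int set"
      and f and z :: 'a
    using that by (induction I rule: finite_induct) (auto simp: cinner_add_left)
  have cR: "cinner (r *\<^sub>R y) z = complex_of_real r * cinner y z" for r and y z :: 'a
    by (metis cinner_scaleC_left scaleC_of_real)
  have range: "\<lfloor>real (Suc n) * g t\<rfloor> \<in> ?I" for t
  proof -
    define y K where "y = real (Suc n) * g t" and "K = c * int (Suc n)"
    have "real (Suc n) * \<bar>g t\<bar> \<le> real (Suc n) * real_of_int c" using c by (intro mult_left_mono) auto
    then have "\<bar>y\<bar> \<le> real_of_int K" by (simp add: y_def K_def abs_mult mult.commute)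
    then have "\<lfloor>y\<rfloor> \<le> K" "- K \<le> \<lfloor>y\<rfloor>" by linarith+
    then show ?thesis by (simp add: y_def K_def)
  qed
  have "\<lfloor>real (Suc n) * g t\<rfloor> / real (Suc n)
      = (\<Sum>k\<in>?I. (real_of_int k / real (Suc n)) * indicator (level_set g n k) t)" for t
  proof -
    have "(\<Sum>k\<in>?I. (real_of_int k / real (Suc n)) * indicator (level_set g n k) t)
        = (\<Sum>k\<in>?I. if k = \<lfloor>real (Suc n) * g t\<rfloor> then real_of_int k / real (Suc n) else 0)"
      by (intro sum.cong) (auto simp: level_set_def indicator_def)
    then show ?thesis using range[of t] by simp
  qed
  then have "(\<integral>t. \<lfloor>real (Suc n) * g t\<rfloor> / real (Suc n) \<partial>scalar_measure E x)
      = (\<Sum>k\<in>?I. (real_of_int k / real (Suc n)) * measure (scalar_measure E x) (level_set g n k))"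
    by (simp add: level_set_borel less_top[symmetric] emeasure_finite)
  then show ?thesis
    by (simp add: step_op_def clin cR E_cinner_self x level_set_borel measure_scalar_measure)
qed

lemma integrable_bounded: "x \<in> V \<Longrightarrow> integrable (scalar_measure E x) g"
  using finite_measure.integrable_const_bound[OF finite_scalar_measure, of x g "real_of_int c"] c
    by simp

lemma step_op_form_close:
  assumes x: "x \<in> V"
  shows "\<bar>inner (step_op g c n x) x - (\<integral>t. g t \<partial>scalar_measure E x)\<bar> \<le> 1 / real (Suc n) * (norm x)\<^sup>2"
proof -
  interpret finite_measure "scalar_measure E x" by (rule finite_scalar_measure[OF x])
  let ?s = "\<lambda>t. \<lfloor>real (Suc n) * g t\<rfloor> / real (Suc n)"
  have close: "\<bar>?s t - g t\<bar> \<le> 1 / real (Suc n)" for t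
  proof -
    have "\<bar>real_of_int \<lfloor>real (Suc n) * g t\<rfloor> - real (Suc n) * g t\<bar> \<le> 1" by linarith
    then have "\<bar>(real_of_int \<lfloor>real (Suc n) * g t\<rfloor> - real (Suc n) * g t) / real (Suc n)\<bar>
        \<le> 1 / real (Suc n)"
      by (simp add: divide_right_mono)
    then show ?thesis by (simp add: diff_divide_distrib)
  qed
  have "\<bar>?s t\<bar> \<le> real_of_int c + 1" for t
  proof -
    have "1 / real (Suc n) \<le> 1" by simp
    then show ?thesis using close[of t] c[of t] by linarith
  qed
  then have ints: "integrable (scalar_measure E x) ?s"
    by (intro integrable_const_bound[where B = "real_of_int c + 1"]) auto
  have "inner (step_op g c n x) x - (\<integral>t. g t \<partial>scalar_measure E x)
      = (\<integral>t. ?s t - g t \<partial>scalar_measure E x)"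
    using step_op_form[OF x, of n] ints integrable_bounded[OF x] by (simp flip: Re_cinner)
  moreover have "\<bar>\<integral>t. ?s t - g t \<partial>scalar_measure E x\<bar> \<le> (\<integral>t. \<bar>?s t - g t\<bar> \<partial>scalar_measure E x)"
    by (rule integral_abs_bound)
  moreover have "\<dots> \<le> (\<integral>t. 1 / real (Suc n) \<partial>scalar_measure E x)"
    by (rule integral_mono) (use ints integrable_bounded[OF x] close in auto)
  moreover have "(\<integral>t. 1 / real (Suc n) \<partial>scalar_measure E x) = 1 / real (Suc n) * (norm x)\<^sup>2"
    using measure_scalar_measure[OF x, of UNIV] by (simp add: E_UNIV x)
  ultimately show ?thesis by linarith
qed

text \<open>
  The step functions are uniformly close to \<open>g\<close>, which bounds the quadratic form of the difference;
  for a symmetric operator the form bounds the norm.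
\<close>

lemma step_op_Cauchy_bound:
  assumes x: "x \<in> V"
  shows "norm (step_op g c n x - step_op g c m x) \<le> (1 / real (Suc n) + 1 / real (Suc m)) * norm x"
proof (rule symmetric_form_norm_bound[OF subspace_V])
  have R: "step_op g c n (r *\<^sub>R x) = r *\<^sub>R step_op g c n x" if "x \<in> V" for n r x
    using step_op_linear(2)[OF that, of n "complex_of_real r"] by (simp add: scaleC_of_real)
  show "step_op g c n (r *\<^sub>R x) - step_op g c m (r *\<^sub>R x)
      = r *\<^sub>R (step_op g c n x - step_op g c m x)" if "x \<in> V" for r x
    using that by (simp add: R scaleR_diff_right)
  show "\<bar>inner (step_op g c n x - step_op g c m x) x\<bar>
      \<le> (1 / real (Suc n) + 1 / real (Suc m)) * (norm x)\<^sup>2"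
    if "x \<in> V" for x
    using step_op_form_close[OF that, of n] step_op_form_close[OF that, of m]
    unfolding inner_diff_left distrib_right by linarith
qed (use x in \<open>auto simp: step_op_in step_op_linear step_op_symmetric inner_diff_left inner_diff_right
      subspace_diff[OF subspace_V]\<close>)

end

text \<open>
  The operator of a bounded real function is the norm limit of operators of step functions; it
  therefore takes values in the closed span of the spectral projections.
\<close>

lemma real_calculus_exists:
  assumes g: "g \<in> borel_measurable borel" "bounded (range g)" and cl: "closed V"
  shows "\<exists>T. bounded_op_on V T \<and>
    (\<forall>x\<in>V. cinner (T x) x = complex_of_real (\<integral>t. g t \<partial>scalar_measure E x)) \<and>
    (\<forall>x\<in>V. T x \<in> closed_cspan {E B x | B. B \<in> sets borel})"
proof -
  obtain b where b: "\<And>t. \<bar>g t\<bar> \<le> b" using g(2) by (auto simp: bounded_iff)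
  define c where "c = \<lceil>b\<rceil>"
  have c: "\<bar>g t\<bar> \<le> real_of_int c" for t using b[of t] by (simp add: c_def) linarith
  let ?S = "step_op g c"
  note bound = step_op_Cauchy_bound[OF g(1) c]
  have inv: "(\<lambda>n. 1 / real (Suc n)) \<longlonglongrightarrow> 0"
    using LIMSEQ_inverse_real_of_nat by (simp add: inverse_eq_divide)
  have "Cauchy (\<lambda>n. ?S n x)" if x: "x \<in> V" for x
  proof (rule metric_CauchyI)
    fix e :: real assume e: "e > 0"
    have "(\<lambda>n. 1 / real (Suc n) * (2 * norm x)) \<longlonglongrightarrow> 0 * (2 * norm x)" by (intro tendsto_intros inv)
    then have "\<forall>\<^sub>F n in sequentially. 1 / real (Suc n) * (2 * norm x) < e" using e
      by (simp add: order_tendstoD)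
    then obtain N where N: "1 / real (Suc N) * (2 * norm x) < e" by (auto simp: eventually_sequentially)
    have "dist (?S m x) (?S n x) < e" if "N \<le> m" "N \<le> n" for m n
    proof -
      have "1 / real (Suc m) \<le> 1 / real (Suc N)" "1 / real (Suc n) \<le> 1 / real (Suc N)"
        using that by (auto intro!: divide_left_mono)
      then have "(1 / real (Suc m) + 1 / real (Suc n)) * norm x
          \<le> (1 / real (Suc N) + 1 / real (Suc N)) * norm x"
        by (intro mult_right_mono add_mono) auto
      then show ?thesis using bound[OF x, of m n] N by (simp add: dist_norm)
    qed
    then show "\<exists>N. \<forall>m\<ge>N. \<forall>n\<ge>N. dist (?S m x) (?S n x) < e" by blast
  qed
  then have "\<forall>x\<in>V. \<exists>y. (\<lambda>n. ?S n x) \<longlonglongrightarrow> y" using Cauchy_convergent convergentD by blast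
  then obtain T where T: "\<And>x. x \<in> V \<Longrightarrow> (\<lambda>n. ?S n x) \<longlonglongrightarrow> T x" by metis
  have TV: "T x \<in> V" if "x \<in> V" for x
    by (rule closed_sequentially[OF cl step_op_in[OF g(1) c that] T[OF that]])
  have add: "T (x + y) = T x + T y" if x: "x \<in> V" and y: "y \<in> V" for x y
  proof (rule LIMSEQ_unique[OF T])
    show "(\<lambda>n. ?S n (x + y)) \<longlonglongrightarrow> T x + T y"
      unfolding step_op_linear(1)[OF g(1) c x y] by (intro tendsto_intros T x y)
  qed (intro csubspaceD(2)[OF csubspace] x y)
  have scale: "T (d *\<^sub>C x) = d *\<^sub>C T x" if x: "x \<in> V" for x d
  proof (rule LIMSEQ_unique[OF T])
    show "(\<lambda>n. ?S n (d *\<^sub>C x)) \<longlonglongrightarrow> d *\<^sub>C T x"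
      unfolding step_op_linear(2)[OF g(1) c x]
        by (intro bounded_linear.tendsto[OF bounded_linear_scaleC] T x)
  qed (intro csubspaceD(3)[OF csubspace] x)
  have sym: "inner (T x) y = inner x (T y)" if x: "x \<in> V" and y: "y \<in> V" for x y
  proof (rule LIMSEQ_unique)
    show "(\<lambda>n. inner (?S n x) y) \<longlonglongrightarrow> inner (T x) y" by (intro tendsto_intros T x)
    show "(\<lambda>n. inner (?S n x) y) \<longlonglongrightarrow> inner x (T y)"
      unfolding step_op_symmetric[OF g(1) c x y] by (intro tendsto_intros T y)
  qed
  have form: "inner (T x) x = (\<integral>t. g t \<partial>scalar_measure E x)" if x: "x \<in> V" for x
  proof (rule LIMSEQ_unique)
    show "(\<lambda>n. inner (?S n x) x) \<longlonglongrightarrow> inner (T x) x" by (intro tendsto_intros T x)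
    have "(\<lambda>n. inner (?S n x) x - (\<integral>t. g t \<partial>scalar_measure E x)) \<longlonglongrightarrow> 0"
    proof (rule Lim_null_comparison)
      show "\<forall>\<^sub>F n in sequentially. norm (inner (?S n x) x - (\<integral>t. g t \<partial>scalar_measure E x))
          \<le> 1 / real (Suc n) * (norm x)\<^sup>2"
        using step_op_form_close[OF g(1) c x] by (intro always_eventually) simp
      show "(\<lambda>n. 1 / real (Suc n) * (norm x)\<^sup>2) \<longlonglongrightarrow> 0"
        using tendsto_mult_left_zero[OF inv] by simp
    qed
    then show "(\<lambda>n. inner (?S n x) x) \<longlonglongrightarrow> (\<integral>t. g t \<partial>scalar_measure E x)" by (rule LIM_zero_cancel)
  qed
  have imag: "inner (T x) (\<i> *\<^sub>C x) = 0" if x: "x \<in> V" for x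
  proof (rule LIMSEQ_unique)
    show "(\<lambda>n. inner (?S n x) (\<i> *\<^sub>C x)) \<longlonglongrightarrow> inner (T x) (\<i> *\<^sub>C x)" by (intro tendsto_intros T x)
    have "inner (?S n x) (\<i> *\<^sub>C x) = 0" for n
      using arg_cong[OF step_op_form[OF g(1) c x, of n], of Im] by (simp add: cinner_eq_Complex)
    then show "(\<lambda>n. inner (?S n x) (\<i> *\<^sub>C x)) \<longlonglongrightarrow> 0" by simp
  qed
  have "\<bar>\<integral>t. g t \<partial>scalar_measure E x\<bar> \<le> real_of_int c * (norm x)\<^sup>2" if x: "x \<in> V" for x
  proof -
    interpret finite_measure "scalar_measure E x" by (rule finite_scalar_measure[OF x])
    have int: "integrable (scalar_measure E x) g" by (rule integrable_bounded[OF g(1) c x])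
    have "\<bar>\<integral>t. g t \<partial>scalar_measure E x\<bar> \<le> (\<integral>t. \<bar>g t\<bar> \<partial>scalar_measure E x)"
      by (rule integral_abs_bound)
    also have "\<dots> \<le> (\<integral>t. real_of_int c \<partial>scalar_measure E x)"
      by (rule integral_mono) (use int c in auto)
    also have "\<dots> = real_of_int c * (norm x)\<^sup>2"
      using measure_scalar_measure[OF x, of UNIV] by (simp add: E_UNIV x)
    finally show ?thesis .
  qed
  then have bdd: "norm (T x) \<le> real_of_int c * norm x" if "x \<in> V" for x
    using that TV add sym form scale[of _ "complex_of_real r" for r]
    by (intro symmetric_form_norm_bound[OF subspace_V]) (auto simp: scaleC_of_real)
  have span: "T x \<in> closed_cspan {E B x | B. B \<in> sets borel}" if x: "x \<in> V" for x
  proof (rule closed_sequentially[OF closed_closed_cspan _ T[OF x]])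
    show "?S n x \<in> closed_cspan {E B x | B. B \<in> sets borel}" for n
      unfolding step_op_def
      by (intro subspace_sum subspace_scale csubspace_imp_subspace csubspace_closed_cspan
          subsetD[OF closed_cspan_superset]) (use level_set_borel[OF g(1) c] in blast)
  qed
  have "bounded_op_on V T"
    unfolding bounded_op_on_def clinear_on_def using TV add scale bdd by blast
  moreover have "cinner (T x) x = complex_of_real (\<integral>t. g t \<partial>scalar_measure E x)" if "x \<in> V" for x
    by (rule complex_eqI) (simp_all add: cinner_eq_Complex form imag that)
  ultimately show ?thesis using span by blast
qed

lemma complex_calculus_exists:
  assumes f: "f \<in> borel_measurable borel" "bounded (range f)" and cl: "closed V"
  shows "\<exists>T. bounded_op_on V T \<and>
    (\<forall>x\<in>V. cinner (T x) x = (\<integral>t. f t \<partial>scalar_measure E x)) \<and>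
    (\<forall>x\<in>V. T x \<in> closed_cspan {E B x | B. B \<in> sets borel})"
proof -
  obtain b where b: "\<And>t. cmod (f t) \<le> b" using f(2) by (auto simp: bounded_iff)
  have "bounded (range (\<lambda>t. Re (f t)))" "bounded (range (\<lambda>t. Im (f t)))"
    unfolding bounded_iff using order_trans[OF abs_Re_le_cmod b] order_trans[OF abs_Im_le_cmod b]
      by auto
  moreover have "(\<lambda>t. Re (f t)) \<in> borel_measurable borel" "(\<lambda>t. Im (f t)) \<in> borel_measurable borel"
    using f(1) by simp_all
  ultimately have ex: "\<exists>T. bounded_op_on V T
      \<and> (\<forall>x\<in>V. cinner (T x) x = complex_of_real (\<integral>t. h t \<partial>scalar_measure E x)) \<and>
      (\<forall>x\<in>V. T x \<in> closed_cspan {E B x | B. B \<in> sets borel})" if "h = (\<lambda>t. Re (f t)) \<or> h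
          = (\<lambda>t. Im (f t))" for h
    using that cl by (elim disjE) (auto intro: real_calculus_exists)
  obtain R where R: "bounded_op_on V R"
      "\<And>x. x \<in> V \<Longrightarrow> cinner (R x) x = complex_of_real (\<integral>t. Re (f t) \<partial>scalar_measure E x)"
      "\<And>x. x \<in> V \<Longrightarrow> R x \<in> closed_cspan {E B x | B. B \<in> sets borel}"
    using ex[of "\<lambda>t. Re (f t)"] by blast
  obtain I where I: "bounded_op_on V I"
      "\<And>x. x \<in> V \<Longrightarrow> cinner (I x) x = complex_of_real (\<integral>t. Im (f t) \<partial>scalar_measure E x)"
      "\<And>x. x \<in> V \<Longrightarrow> I x \<in> closed_cspan {E B x | B. B \<in> sets borel}"
    using ex[of "\<lambda>t. Im (f t)"] by blast
  define T where "T x = R x + \<i> *\<^sub>C I x" for x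
  obtain CR where CR: "\<And>x. x \<in> V \<Longrightarrow> norm (R x) \<le> CR * norm x"
    using R(1) unfolding bounded_op_on_def by blast
  obtain CI where CI: "\<And>x. x \<in> V \<Longrightarrow> norm (I x) \<le> CI * norm x"
    using I(1) unfolding bounded_op_on_def by blast
  have "norm (T x) \<le> (CR + CI) * norm x" if "x \<in> V" for x
    using norm_triangle_ineq[of "R x" "\<i> *\<^sub>C I x"] CR[OF that] CI[OF that]
    by (simp add: T_def norm_scaleC distrib_right)
  then have "\<exists>C. \<forall>x\<in>V. norm (T x) \<le> C * norm x" by blast
  moreover have "T ` V \<subseteq> V \<and> clinear_on V T"
    using R(1) I(1) csubspaceD(2,3)[OF csubspace] unfolding bounded_op_on_def clinear_on_def T_def
    by (auto simp: image_subset_iff scaleC_add_right scaleC_scaleC mult.commute)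
  ultimately have "bounded_op_on V T" by (simp add: bounded_op_on_def)
  moreover have "cinner (T x) x = (\<integral>t. f t \<partial>scalar_measure E x)" if x: "x \<in> V" for x
  proof -
    have "integrable (scalar_measure E x) f"
      using finite_measure.integrable_const_bound[OF finite_scalar_measure[OF x], of f b] f(1) b by simp
    then have "(\<integral>t. f t \<partial>scalar_measure E x)
        = Complex (\<integral>t. Re (f t) \<partial>scalar_measure E x) (\<integral>t. Im (f t) \<partial>scalar_measure E x)"
      by (intro complex_eqI) simp_all
    then show ?thesis
      by (simp add: T_def cinner_add_left cinner_scaleC_left R(2) I(2) x Complex_eq)
  qed
  moreover have "T x \<in> closed_cspan {E B x | B. B \<in> sets borel}" if "x \<in> V" for x
    unfolding T_def by (intro csubspaceD(2,3)[OF csubspace_closed_cspan] R(3) I(3) that)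
  ultimately show ?thesis by blast
qed

end

lemma bounded_op_on_eqI:
  assumes V: "csubspace V" and S: "bounded_op_on V S" and T: "bounded_op_on V T"
    and eq: "\<And>x. x \<in> V \<Longrightarrow> cinner (S x) x = cinner (T x) x" and x: "x \<in> V"
  shows "S x = T x"
proof -
  have D: "clinear_on V (\<lambda>x. S x - T x)"
    using S T by (auto simp: bounded_op_on_def clinear_on_def scaleC_diff_right)
  have "S x - T x \<in> V" using S T x csubspaceD(4)[OF V]
    by (auto simp: bounded_op_on_def image_subset_iff)
  then have "cinner (S x - T x) (S x - T x) = 0"
    using form_polarization[OF V _ D _ x, of "\<lambda>x. x"] eq by (simp add: clinear_on_def cinner_diff_left)
  then show ?thesis by (simp add: cinner_self)
qed

text \<open>
  The bound on \<open>V\<close> makes the operator continuous along sequences in \<open>V\<close>, which is closed.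
\<close>

lemma csubspace_closed_preimage:
  fixes V L :: "'a::complex_inner set"
  assumes V: "csubspace V" "closed V" and T: "bounded_op_on V T" and L: "csubspace L" "closed L"
  shows "csubspace {x \<in> V. T x \<in> L}" "closed {x \<in> V. T x \<in> L}"
proof -
  have add: "T (x + y) = T x + T y" and scale: "T (c *\<^sub>C x) = c *\<^sub>C T x" if "x \<in> V" "y \<in> V" for x y c
    using T that by (auto simp: bounded_op_on_def clinear_on_def)
  have "T 0 = 0" using scale[OF csubspaceD(1,1)[OF V(1)], of 0] by simp
  then show "csubspace {x \<in> V. T x \<in> L}"
    using csubspaceD(1-3)[OF V(1)] csubspaceD(1-3)[OF L(1)]
      by (simp add: csubspace_def[of "{x \<in> V. T x \<in> L}"] add scale)
  obtain C where C: "\<And>x. x \<in> V \<Longrightarrow> norm (T x) \<le> C * norm x" using T unfolding bounded_op_on_def by blast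
  show "closed {x \<in> V. T x \<in> L}"
    unfolding closed_sequential_limits
  proof (intro allI impI)
    fix x l assume *: "(\<forall>n. x n \<in> {x \<in> V. T x \<in> L}) \<and> x \<longlonglongrightarrow> l"
    then have xV: "x n \<in> V" and xL: "T (x n) \<in> L" and lim: "x \<longlonglongrightarrow> l" for n by auto
    have lV: "l \<in> V" by (rule closed_sequentially[OF V(2) xV lim])
    have "T (x n - l) = T (x n) - T l" for n
      using add[OF xV csubspaceD(6)[OF V(1) lV], of n] scale[OF lV lV, of "-1"] by simp
    then have le: "norm (T (x n) - T l) \<le> C * norm (x n - l)" for n
      using C[OF csubspaceD(4)[OF V(1) xV lV], of n] by simp
    have lim0: "(\<lambda>n. C * norm (x n - l)) \<longlonglongrightarrow> 0"
      using tendsto_mult_right_zero[OF tendsto_norm_zero[OF LIM_zero[OF lim]]] .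
    have "(\<lambda>n. T (x n) - T l) \<longlonglongrightarrow> 0"
      by (rule Lim_null_comparison[OF _ lim0]) (simp add: le)
    then have "(\<lambda>n. T (x n)) \<longlonglongrightarrow> T l" by (rule LIM_zero_cancel)
    then have "T l \<in> L" by (rule closed_sequentially[OF L(2) xL])
    then show "l \<in> {x \<in> V. T x \<in> L}" using lV by simp
  qed
qed

context selfadjoint_operator
begin

lemma borel_calculus_unique:
  assumes T: "bounded_op_on V T"
    and form: "\<And>x. x \<in> V \<Longrightarrow> cinner (T x) x = (\<integral>t. f t \<partial>scalar_measure (\<E>) x)"
    and x: "x \<in> V"
  shows "borel_calculus M f x = T x"
proof -
  have "bounded_op_on V (borel_calculus M f) \<and>
      (\<forall>x\<in>V. cinner (borel_calculus M f x) x = (\<integral>t. f t \<partial>scalar_measure (\<E>) x))"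
    unfolding borel_calculus_def by (rule someI[of _ T]) (use T form in auto)
  then show ?thesis using form by (intro bounded_op_on_eqI[OF csubspace_V _ T _ x]) auto
qed

text \<open>
  The chosen operator coincides on \<open>V\<close> with the limit of the step operators, by polarization.
\<close>

lemma borel_calculus_in_span:
  assumes f: "f \<in> borel_measurable borel" "bounded (range f)" and x: "x \<in> V"
  shows "borel_calculus M f x \<in> closed_cspan {\<E> B x | B. B \<in> sets borel}"
proof -
  obtain T where T: "bounded_op_on V T"
      "\<And>x. x \<in> V \<Longrightarrow> cinner (T x) x = (\<integral>t. f t \<partial>scalar_measure (\<E>) x)"
      "\<And>x. x \<in> V \<Longrightarrow> T x \<in> closed_cspan {\<E> B x | B. B \<in> sets borel}"
    using spm.complex_calculus_exists[OF f closed_V] by blast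
  have "borel_calculus M f x = T x" by (rule borel_calculus_unique[OF T(1) T(2) x])
  then show ?thesis using T(3)[OF x] by simp
qed

lemma borel_calculus_indicator:
  assumes B: "B \<in> sets borel" and x: "x \<in> V"
  shows "borel_calculus M (indicator B) x = \<E> B x"
proof (rule borel_calculus_unique[OF _ _ x])
  show "bounded_op_on V (\<E> B)"
    using spm.pvm B by (simp add: projection_valued_measure_def projection_on_def)
  fix x assume x: "x \<in> V"
  interpret finite_measure "scalar_measure (\<E>) x" by (rule spm.finite_scalar_measure[OF x])
  have "(\<integral>t. indicator B t \<partial>scalar_measure (\<E>) x)
      = (\<integral>t. complex_of_real (indicator B t) \<partial>scalar_measure (\<E>) x)"
    by (simp add: indicator_def of_bool_def if_distrib cong: if_cong)
  also have "\<dots> = complex_of_real ((norm (\<E> B x))\<^sup>2)"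
    using B by (simp only: integral_complex_of_real) (simp add: spm.measure_scalar_measure x)
  finally show "cinner (\<E> B x) x = (\<integral>t. indicator B t \<partial>scalar_measure (\<E>) x)"
    using spm.E_cinner_self[OF B x] by simp
qed

lemma generated_subspace_eq:
  assumes A: "A \<subseteq> V"
  shows "generated_subspace M A = closed_cspan {\<E> B v | B v. B \<in> sets borel \<and> v \<in> A}"
    (is "_ = ?L")
proof
  show "generated_subspace M A \<subseteq> ?L"
    unfolding generated_subspace_def
  proof (rule closed_cspan_minimal[OF _ csubspace_closed_cspan closed_closed_cspan], safe)
    fix f :: "real \<Rightarrow> complex" and v
    assume v: "v \<in> A" and f: "f \<in> borel_measurable borel" "bounded (range f)"
    have "closed_cspan {\<E> B v | B. B \<in> sets borel} \<subseteq> ?L"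
      by (rule closed_cspan_minimal[OF order_trans[OF _ closed_cspan_superset] csubspace_closed_cspan closed_closed_cspan])
         (use v in auto)
    then show "borel_calculus M f v \<in> ?L" using borel_calculus_in_span[OF f] v A by blast
  qed
  show "?L \<subseteq> generated_subspace M A"
    unfolding generated_subspace_def
  proof (rule closed_cspan_minimal[OF order_trans[OF _ closed_cspan_superset] csubspace_closed_cspan closed_closed_cspan], safe)
    fix B :: "real set" and v assume B: "B \<in> sets borel" and v: "v \<in> A"
    have "bounded (range (indicator B :: real \<Rightarrow> complex))"
      by (rule boundedI[of _ 1]) (auto simp: indicator_def)
    then show "\<exists>f va. \<E> B v = borel_calculus M f va \<and> va \<in> A \<and>
        f \<in> borel_measurable borel \<and> bounded (range f)"
      using borel_calculus_indicator[OF B] v A B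
      by (intro exI[of _ "indicator B"] exI[of _ v]) auto
  qed
qed

section \<open>The definable closure\<close>

lemma generated_subset_dcl:
  assumes A: "A \<subseteq> V"
  shows "generated_subspace M A \<subseteq> dcl M A"
proof -
  have fixed: "generated_subspace M A \<subseteq> {x \<in> V. U x - x \<in> {0}}"
    if U: "automorphism M U" "\<forall>a\<in>A. U a = a" for U
    unfolding generated_subspace_eq[OF A]
  proof (rule closed_cspan_minimal)
    note unitary = automorphismD(1)[OF U(1)]
    have "norm (U x - x) \<le> 2 * norm x" if "x \<in> V" for x
      using norm_triangle_ineq4[of "U x" x] unitary_on_norm[OF unitary that] by simp
    then have "\<exists>C. \<forall>x\<in>V. norm (U x - x) \<le> C * norm x" by blast
    moreover have "U x - x \<in> V" if "x \<in> V" for x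
      using unitary_on_in[OF unitary that] that by (rule csubspaceD(4)[OF csubspace_V])
    moreover have "clinear_on V (\<lambda>x. U x - x)"
      using unitary by (auto simp: unitary_on_def clinear_on_def scaleC_diff_right)
    ultimately have "bounded_op_on V (\<lambda>x. U x - x)" by (auto simp: bounded_op_on_def)
    from csubspace_closed_preimage[OF csubspace_V closed_V this, of "{0}"]
    show "csubspace {x \<in> V. U x - x \<in> {0}}" "closed {x \<in> V. U x - x \<in> {0}}"
      by (simp_all add: csubspace_def)
    show "{\<E> B v | B v. B \<in> sets borel \<and> v \<in> A} \<subseteq> {x \<in> V. U x - x \<in> {0}}"
    proof safe
      fix B :: "real set" and v assume B: "B \<in> sets borel" and v: "v \<in> A"
      then have vV: "v \<in> V" using A by auto
      show "\<E> B v \<in> V" by (rule spm.E_in[OF B vV])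
      have "U (\<E> B v) = \<E> B (U v)"
        using automorphism_iff_commuting[OF unitary] U(1) B vV by simp
      then show "U (\<E> B v) - \<E> B v = 0" using U(2) v by simp
    qed
  qed
  have "generated_subspace M A \<subseteq> V"
    unfolding generated_subspace_eq[OF A]
    by (rule closed_cspan_minimal[OF _ csubspace_V closed_V]) (use A in \<open>auto intro: spm.E_in\<close>)
  then show ?thesis using fixed by (auto simp: dcl_def)
qed

text \<open>
  The reflection in the generated subspace \<open>L\<close> is an automorphism that fixes exactly the vectors of
  \<open>L\<close>.
\<close>

lemma dcl_subset_generated:
  assumes A: "A \<subseteq> V"
  shows "dcl M A \<subseteq> generated_subspace M A"
proof
  fix m assume m: "m \<in> dcl M A"
  define L where "L = closed_cspan {\<E> B v | B v. B \<in> sets borel \<and> v \<in> A}"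
  have L: "csubspace L" "closed L" unfolding L_def by (rule csubspace_closed_cspan closed_closed_cspan)+
  note L' = csubspace_imp_subspace[OF L(1)] L(2)
  have gen: "{\<E> B v | B v. B \<in> sets borel \<and> v \<in> A} \<subseteq> L"
    unfolding L_def by (rule closed_cspan_superset)
  have LV: "L \<subseteq> V" unfolding L_def
    by (rule closed_cspan_minimal[OF _ csubspace_V closed_V]) (use A in \<open>auto intro: spm.E_in\<close>)
  have EL: "\<E> B x \<in> L" if B: "B \<in> sets borel" and x: "x \<in> L" for B x
  proof -
    have bop: "bounded_op_on V (\<E> B)"
      using spm.pvm B by (simp add: projection_valued_measure_def projection_on_def)
    have "L \<subseteq> {x \<in> V. \<E> B x \<in> L}"
      unfolding L_def
    proof (rule closed_cspan_minimal[OF _ csubspace_closed_preimage[OF csubspace_V closed_V bop L, unfolded L_def]], safe)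
      fix C :: "real set" and v assume C: "C \<in> sets borel" and v: "v \<in> A"
      then have vV: "v \<in> V" using A by auto
      show "\<E> C v \<in> V" by (rule spm.E_in[OF C vV])
      have "\<E> (B \<inter> C) v \<in> L" using gen B C v by blast
      then show "\<E> B (\<E> C v)
          \<in> closed_cspan {\<E> B v | B v. B \<in> sets borel \<and> v \<in> A}"
        by (simp add: spm.E_Int[OF B C vV] L_def)
    qed
    then show ?thesis using x by blast
  qed
  define P where "P = orth_proj L"
  note PL = orth_projector_orth_proj[OF L', folded P_def]
  have Pin: "P x \<in> L" for x unfolding P_def by (rule orth_proj_in[OF L'])
  have Pfix: "P x = x \<longleftrightarrow> x \<in> L" for x unfolding P_def by (rule orth_proj_eq_iff[OF L'])
  have Pi: "commuting (\<lambda>x. c *\<^sub>C x) P" for c unfolding P_def by (rule orth_proj_scaleC_commuting[OF L])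
  have "projection_on V P"
    unfolding projection_on_def bounded_op_on_def clinear_on_def
  proof (intro conjI ballI allI)
    show "P ` V \<subseteq> V" using Pin LV by auto
    show "P (x + y) = P x + P y" for x y by (rule orth_projector_simps[OF PL])
    show "P (c *\<^sub>C x) = c *\<^sub>C P x" for c x using Pi by (simp add: commuting_def)
    show "\<exists>C. \<forall>x\<in>V. norm (P x) \<le> C * norm x"
      by (intro exI[of _ 1]) (simp add: orth_projector_norm_le[OF PL])
    show "P (P x) = P x" for x by (rule orth_projector_idem[OF PL])
    show "cinner (P x) y = cinner x (P y)" for x y
      by (rule selfadj_cinner[OF orth_projector_selfadj[OF PL] Pi])
  qed
  note U = unitary_on_reflection[OF csubspace_V this]
  have EP: "\<E> B (P x) = P (\<E> B x)" if B: "B \<in> sets borel" and x: "x \<in> V" for B x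
  proof -
    have PV: "P x \<in> V" using Pin LV by auto
    \<comment> \<open>\<open>E(B)\<close> is symmetric and maps \<open>L\<close> into itself, so it also preserves the complement of \<open>L\<close>.\<close>
    have "inner (\<E> B x - \<E> B (P x)) s = 0" if s: "s \<in> L" for s
    proof -
      have "inner (\<E> B x - \<E> B (P x)) s = inner (x - P x) (\<E> B s)"
        using spm.E_inner[OF B csubspaceD(4)[OF csubspace_V x PV], of s] s LV
        by (simp add: spm.E_diff B x PV subsetD)
      then show ?thesis using orth_proj_orthogonal[OF L' EL[OF B s], of x] by (simp add: P_def)
    qed
    from orth_proj_unique[OF L' EL[OF B Pin] this] show ?thesis by (simp add: P_def)
  qed
  have "automorphism M (\<lambda>x. 2 *\<^sub>R P x - x)"
    unfolding automorphism_iff_commuting[OF U]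
  proof (intro ballI)
    fix B :: "real set" and x assume B: "B \<in> sets borel" and x: "x \<in> V"
    have PV: "P x \<in> V" using Pin LV by auto
    show "2 *\<^sub>R P (\<E> B x) - \<E> B x = \<E> B (2 *\<^sub>R P x - x)"
      using csubspaceD(5)[OF csubspace_V PV, of 2] by (simp add: spm.E_diff spm.E_scaleR B x PV EP)
  qed
  moreover have "2 *\<^sub>R P a - a = a" if a: "a \<in> A" for a
  proof -
    have "\<E> UNIV a \<in> L"
      by (rule subsetD[OF gen], intro CollectI exI[of _ UNIV] exI[of _ a]) (simp add: a)
    moreover have "a \<in> V" using a A by auto
    ultimately have "P a = a" using spm.E_UNIV[of a] Pfix[of a] by simp
    then show ?thesis by (simp add: scaleR_2)
  qed
  ultimately have "2 *\<^sub>R P m - m = m" using m by (auto simp: dcl_def)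
  then have "2 *\<^sub>R P m = 2 *\<^sub>R m" by (simp add: scaleR_2 diff_eq_eq)
  then have "m \<in> L" using Pfix[of m] by simp
  then show "m \<in> generated_subspace M A" by (simp add: generated_subspace_eq[OF A] L_def)
qed

end

theorem theorem4p2:
  fixes H M :: "'a::chilbert_space opstruct"
    and \<kappa> :: "'k rel"
    and G :: "'a set"
  assumes "selfadjoint_structure H"
    and "monster_model \<kappa> H M"
    and "G \<subseteq> hspace M"
    and "|G| <o \<kappa>"
  shows "dcl M G = generated_subspace M G"
proof -
  interpret selfadjoint_operator M
    using assms(2) by unfold_locales (simp add: monster_model_def Kclass_def)
  show ?thesis
    using dcl_subset_generated[OF assms(3)] generated_subset_dcl[OF assms(3)] by (rule subset_antisym)
qed

end
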